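(* Fix $s>2$ and assume that $\theta_0\in H^s(\mathbb{T}^2)$ has zero mean on $\mathbb{T}^2$. Then there exist a $T>0$ and a unique smooth solution $\theta^0$ to (IPMB$_0$), i.e. (IPMB$_\nu$) with $\nu=0$, such that $$\theta^0\in L^\infty(0,T;H^s(\mathbb{T}^2)).$$
   Context: Setting. $\mathbb{T}^2=[0,2\pi]^2$ with periodic boundary conditions. For $\nu\ge0$, (IPMB$_\nu$) denotes the incompressible porous media Brinkman problem $$\partial_t\theta^\nu+(u^\nu\cdot\nabla)\theta^\nu=0,\qquad u^\nu=M^\nu[\theta^\nu],\qquad\theta^\nu(x,0)=\theta_0(x),$$ where $M^\nu=(M^\nu_1,M^\nu_2)$ is the Fourier multiplier operator with symbols, for $k=(k_1,k_2)\in\mathbb{Z}^2\setminus\{0\}$, $$\widehat M^\nu_1(k)=\frac{1}{1+\nu(k_1^2+k_2^2)}\cdot\frac{k_1k_2}{k_1^2+k_2^2},\qquad \widehat M^\nu_2(k)=\frac{1}{1+\nu(k_1^2+k_2^2)}\cdot\frac{-k_1^2}{k_1^2+k_2^2}.$$ Solutions $\theta^\nu(\cdot,t)$ have zero mean on $\mathbb{T}^2$ for all $t$. $H^s=W^{s,2}$. *)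

theory Defs
  imports "HOL-Analysis.Analysis"
begin

text \<open>Functions on the torus are functions on the plane that are \<open>2 * pi\<close>-periodic in each coordinate;
  they are integrated over one period cell.\<close>

definition torus_cell :: "(real^2) set" where
  "torus_cell = cbox 0 (\<chi> i. 2 * pi)"

definition torus_periodic :: "(real^2 \<Rightarrow> 'a) \<Rightarrow> bool" where
  "torus_periodic f \<longleftrightarrow> (\<forall>x i. f (x + axis i (2 * pi)) = f x)"

definition zero_mean :: "(real^2 \<Rightarrow> real) \<Rightarrow> bool" where
  "zero_mean f \<longleftrightarrow> (LINT x:torus_cell|lebesgue. f x) = 0"

definition torus_L2 :: "(real^2 \<Rightarrow> real) set" where
  "torus_L2 = {f. torus_periodic f \<and> set_borel_measurable lebesgue torus_cell f
                \<and> set_integrable lebesgue torus_cell (\<lambda>x. (f x)\<^sup>2)}"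

definition fourier_coeff :: "(real^2 \<Rightarrow> real) \<Rightarrow> int^2 \<Rightarrow> complex" where
  "fourier_coeff f k = (1 / (2 * pi)\<^sup>2) *\<^sub>R
     (LINT x:torus_cell|lebesgue. complex_of_real (f x) * cis (- (\<Sum>i\<in>UNIV. real_of_int (k $ i) * x $ i)))"

definition freq_sq :: "int^2 \<Rightarrow> real" where
  "freq_sq k = (real_of_int (k $ 1))\<^sup>2 + (real_of_int (k $ 2))\<^sup>2"

text \<open>The Sobolev space \<open>H\<^sup>s = W\<^sup>s\<^sup>,\<^sup>2\<close> of real order \<open>s \<ge> 0\<close>. Its elements are representatives:
  functions that agree almost everywhere are not identified.\<close>

definition sobolev :: "real \<Rightarrow> (real^2 \<Rightarrow> real) set" where
  "sobolev s = {f \<in> torus_L2.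
     (\<lambda>k. (1 + freq_sq k) powr s * (cmod (fourier_coeff f k))\<^sup>2) summable_on UNIV}"

definition sobolev_norm :: "real \<Rightarrow> (real^2 \<Rightarrow> real) \<Rightarrow> real" where
  "sobolev_norm s f =
     sqrt (\<Sum>\<^sub>\<infinity>k. (1 + freq_sq k) powr s * (cmod (fourier_coeff f k))\<^sup>2)"

text \<open>The Bochner space \<open>L\<^sup>\<infinity>(0,T;H\<^sup>s)\<close>: strong measurability (almost everywhere limit of simple functions
  with values in \<open>H\<^sup>s\<close>) and essential boundedness of the norm.\<close>

definition Linf_sobolev :: "real \<Rightarrow> real \<Rightarrow> (real \<Rightarrow> real^2 \<Rightarrow> real) set" where
  "Linf_sobolev T s = {\<theta>.
     (AE t in lebesgue_on {0<..<T}. \<theta> t \<in> sobolev s) \<and>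
     (\<exists>g. (\<forall>n::nat. simple_function (lebesgue_on {0<..<T}) (g n) \<and> (\<forall>t\<in>{0<..<T}. g n t \<in> sobolev s)) \<and>
          (AE t in lebesgue_on {0<..<T}. (\<lambda>n. sobolev_norm s (\<lambda>x. g n t x - \<theta> t x)) \<longlonglongrightarrow> 0)) \<and>
     (\<exists>C. AE t in lebesgue_on {0<..<T}. sobolev_norm s (\<theta> t) \<le> C)}"

definition fourier_multiplier :: "(int^2 \<Rightarrow> real) \<Rightarrow> (real^2 \<Rightarrow> real) \<Rightarrow> (real^2 \<Rightarrow> real) \<Rightarrow> bool" where
  "fourier_multiplier m f g \<longleftrightarrow>
     f \<in> torus_L2 \<and> g \<in> torus_L2 \<and> (\<forall>k. fourier_coeff g k = complex_of_real (m k) * fourier_coeff f k)"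

text \<open>At \<open>k = 0\<close>, where the symbols are not specified, the convention \<open>x / 0 = 0\<close> gives them the
  value 0; this is immaterial since the operators are applied to functions of zero mean.\<close>

definition M1_symbol :: "real \<Rightarrow> int^2 \<Rightarrow> real" where
  "M1_symbol \<nu> k = 1 / (1 + \<nu> * freq_sq k) * (real_of_int (k $ 1) * real_of_int (k $ 2) / freq_sq k)"

definition M2_symbol :: "real \<Rightarrow> int^2 \<Rightarrow> real" where
  "M2_symbol \<nu> k = 1 / (1 + \<nu> * freq_sq k) * (- (real_of_int (k $ 1))\<^sup>2 / freq_sq k)"

definition C1_on :: "'a::real_normed_vector set \<Rightarrow> ('a \<Rightarrow> 'b::real_normed_vector) \<Rightarrow> bool" where
  "C1_on S f \<longleftrightarrow> (\<exists>D :: 'a \<Rightarrow> 'a \<Rightarrow>\<^sub>L 'b.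
     (\<forall>p\<in>S. (f has_derivative blinfun_apply (D p)) (at p within S)) \<and> continuous_on S D)"

text \<open>Smooth solutions on \<open>[0,T]\<close> are classical ones: \<open>\<theta>\<close> is continuously differentiable and the velocity
  continuous in time and space, up to \<open>t = 0\<close> and \<open>t = T\<close>, and the equation holds pointwise.
  (For data that are merely in \<open>H\<^sup>s\<close>, infinite differentiability fails already at \<open>t = 0\<close>.)
  The datum is attained almost everywhere because it is only a representative of its \<open>L\<^sup>2\<close> class.\<close>

definition ipmb_smooth_solution ::
    "real \<Rightarrow> (real^2 \<Rightarrow> real) \<Rightarrow> real \<Rightarrow> (real \<Rightarrow> real^2 \<Rightarrow> real) \<Rightarrow> bool" where
  "ipmb_smooth_solution \<nu> \<theta>\<^sub>0 T \<theta> \<longleftrightarrow>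
     C1_on ({0..T} \<times> UNIV) (\<lambda>(t, x). \<theta> t x) \<and>
     (\<forall>t\<in>{0..T}. torus_periodic (\<theta> t) \<and> zero_mean (\<theta> t)) \<and>
     (AE x in lebesgue. \<theta> 0 x = \<theta>\<^sub>0 x) \<and>
     (\<exists>u :: real \<Rightarrow> real^2 \<Rightarrow> real^2.
        continuous_on ({0..T} \<times> UNIV) (\<lambda>(t, x). u t x) \<and>
        (\<forall>t\<in>{0..T}. fourier_multiplier (M1_symbol \<nu>) (\<theta> t) (\<lambda>x. u t x $ 1) \<and>
                    fourier_multiplier (M2_symbol \<nu>) (\<theta> t) (\<lambda>x. u t x $ 2)) \<and>
        (\<forall>t\<in>{0..T}. \<forall>x.
           vector_derivative (\<lambda>\<tau>. \<theta> \<tau> x) (at t within {0..T})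
           + (\<Sum>i\<in>UNIV. u t x $ i * frechet_derivative (\<theta> t) (at x) (axis i 1)) = 0))"

end

theory Submission imports Defs "HOL-Complex_Analysis.Great_Picard"
begin

text \<open>
  On the Fourier side the equation is a quadratic system \<open>c' = transport c c\<close> for the
  coefficients of the scalar, and everything happens there. Since \<open>s > 2\<close>, the sum of
  \<open>bracket k powr (2 - 2 * s)\<close> over the lattice converges, so an \<open>H\<^sup>s\<close> bound controls the sum of
  \<open>bracket k * cmod (c k)\<close>: the series for the scalar, its velocity and its gradient converge
  absolutely, with tails that depend only on the bound.

  The a priori estimate (\<open>energy_estimate\<close>) rests on two symmetries. The scalar is real and the velocity is
  divergence free, so in the derivative of the \<open>H\<^sup>s\<close> energy only the difference of the weights at
  the two interacting frequencies remains (\<open>energy_antisym\<close>). This commutator gains the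
  one derivative that the transport term loses, and Young's inequality bounds the growth of the energy by the
  cube of the norm, whatever the truncation of the frequencies.

  For existence, time and frequency are discretised together by an explicit Euler scheme on growing
  boxes, with steps so small that the second-order error is harmless. The
  \<open>H\<^sup>s\<close> norm then stays bounded on a common time interval. A diagonal subsequence converges
  coefficient by coefficient, and since the transport term at a fixed frequency is Lipschitz in the supremum norm
  (\<open>transport_diff_le\<close>), the limit solves the system (\<open>fourier_transport_local_solution\<close>). Summing the
  Fourier series gives a function that is continuously differentiable in time and space and satisfies
  the equation (\<open>sol_is_solution\<close>). It attains the datum because integrable functions are determined by
  their Fourier coefficients (\<open>fourier_coeff_eq_0_imp_AE_0\<close>), which follows from the Stone-Weierstrass theorem
  on a product of two circles.

  For uniqueness, the coefficients of any solution in the class satisfy the same system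
  (\<open>solution_coefficients\<close>). The difference of two solutions is estimated in \<open>L\<^sup>2\<close>, where the transport of the
  difference cancels and the remaining term loses no derivative on it; Gronwall's inequality concludes
  (\<open>fourier_transport_unique\<close>).
\<close>

section \<open>Frequencies and their weights\<close>

definition bracket :: "int^2 \<Rightarrow> real" where
  "bracket k = sqrt (1 + freq_sq k)"

lemma freq_sq_nonneg [simp]: "0 \<le> freq_sq k"
  by (simp add: freq_sq_def)

lemma freq_sq_minus [simp]: "freq_sq (- k) = freq_sq k"
  by (simp add: freq_sq_def)

lemma bracket_ge_1 [simp]: "1 \<le> bracket k"
  by (simp add: bracket_def)

lemma bracket_pos [simp]: "0 < bracket k"
  using bracket_ge_1[of k] by linarith

lemma bracket_nonneg [simp]: "0 \<le> bracket k"
  using bracket_pos[of k] by linarith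

lemma bracket_neq_0 [simp]: "bracket k \<noteq> 0"
  using bracket_pos[of k] by (metis less_irrefl)

lemma bracket_minus [simp]: "bracket (- k) = bracket k"
  by (simp add: bracket_def)

text \<open>Up to the constant component 1, the bracket is a Euclidean norm; this makes it
  1-Lipschitz and gives the triangle inequalities below.\<close>

lemma bracket_norm:
  "bracket k = norm (1::real, Complex (real_of_int (k $ 1)) (real_of_int (k $ 2)))"
  by (simp add: bracket_def norm_Pair freq_sq_def cmod_def)

lemma freq_le_bracket: "sqrt (freq_sq k) \<le> bracket k"
  by (simp add: bracket_def)

lemma bracket_diff_le: "\<bar>bracket k - bracket l\<bar> \<le> bracket (k - l)"
proof -
  let ?z = "\<lambda>k::int^2. Complex (real_of_int (k $ 1)) (real_of_int (k $ 2))"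
  have "\<bar>bracket k - bracket l\<bar> \<le> norm ((1::real, ?z k) - (1, ?z l))"
    unfolding bracket_norm by (rule norm_triangle_ineq3)
  also have "\<dots> = norm (0::real, ?z (k - l))"
    by (simp add: complex_eq_iff norm_Pair cmod_def)
  also have "\<dots> \<le> bracket (k - l)"
    unfolding bracket_norm by (simp add: norm_Pair real_le_rsqrt)
  finally show ?thesis .
qed

lemma bracket_powr_sq: "bracket k powr (2 * s) = (1 + freq_sq k) powr s"
proof -
  have "bracket k = (1 + freq_sq k) powr (1/2)"
    by (simp add: bracket_def powr_half_sqrt)
  then show ?thesis by (simp add: powr_powr)
qed

lemma powr_diff_le:
  fixes x y s :: real
  assumes "0 < x" "0 < y" "1 \<le> s"
  shows "\<bar>x powr s - y powr s\<bar> \<le> s * \<bar>x - y\<bar> * (max x y) powr (s - 1)"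
proof -
  have *: "\<bar>x powr s - y powr s\<bar> \<le> s * \<bar>x - y\<bar> * y powr (s - 1)" if "0 < x" "x < y" for x y :: real
  proof -
    have "\<exists>z>x. z < y \<and> y powr s - x powr s = (y - x) * (s * z powr (s - 1))"
      using that by (intro MVT2) (auto intro!: derivative_eq_intros)
    then obtain z where z: "x < z" "z < y" "y powr s - x powr s = (y - x) * (s * z powr (s - 1))"
      by blast
    have "z powr (s - 1) \<le> y powr (s - 1)"
      using z that assms by (intro powr_mono2) auto
    then have "(y - x) * (s * z powr (s - 1)) \<le> (y - x) * (s * y powr (s - 1))"
      using that assms by (intro mult_left_mono) auto
    moreover have "x powr s \<le> y powr s"
      using that assms by (intro powr_mono2) auto
    ultimately show ?thesis
      using z that by (simp add: abs_if mult_ac)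
  qed
  consider "x < y" | "x = y" | "y < x" by linarith
  then show ?thesis
  proof cases
    case 1 then show ?thesis using *[of x y] assms by (simp add: max_def)
  next
    case 2 then show ?thesis using assms by simp
  next
    case 3 then show ?thesis using *[of y x] assms by (simp add: max_def abs_minus_commute)
  qed
qed

text \<open>The mean value theorem, together with the fact that the larger of the two brackets is at
  most twice the maximum of \<open>bracket (k - l)\<close> and \<open>bracket l\<close>. The factor \<open>bracket (k - l)\<close> is the
  derivative that the commutator takes off the transported function.\<close>

lemma bracket_powr_diff_le:
  assumes "1 \<le> s"
  shows "\<bar>bracket k powr s - bracket l powr s\<bar>
    \<le> s * 2 powr (s - 1) * bracket (k - l) * (bracket (k - l) powr (s - 1) + bracket l powr (s - 1))"
proof -
  let ?m = "max (bracket k) (bracket l)" and ?j = "bracket (k - l)"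
  have "?m \<le> 2 * max ?j (bracket l)"
    using bracket_diff_le[of k l] bracket_nonneg[of l] by (auto simp: max_def abs_if split: if_splits)
  then have "?m powr (s - 1) \<le> (2 * max ?j (bracket l)) powr (s - 1)"
    using assms by (intro powr_mono2) (auto simp: le_max_iff_disj)
  also have "\<dots> = 2 powr (s - 1) * max ?j (bracket l) powr (s - 1)"
    by (simp add: powr_mult le_max_iff_disj)
  also have "\<dots> \<le> 2 powr (s - 1) * (?j powr (s - 1) + bracket l powr (s - 1))"
    by (intro mult_left_mono) (auto simp: max_def)
  finally have m: "?m powr (s - 1) \<le> 2 powr (s - 1) * (?j powr (s - 1) + bracket l powr (s - 1))" .
  have "\<bar>bracket k powr s - bracket l powr s\<bar> \<le> s * \<bar>bracket k - bracket l\<bar> * ?m powr (s - 1)"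
    using assms by (intro powr_diff_le) auto
  also have "\<dots> \<le> s * ?j * (2 powr (s - 1) * (?j powr (s - 1) + bracket l powr (s - 1)))"
    using m assms bracket_diff_le[of k l] by (intro mult_mono) auto
  finally show ?thesis by (simp add: mult_ac)
qed

text \<open>These boxes serve as truncations throughout: they are finite, invariant under \<open>k \<mapsto> - k\<close>
  (so that truncation preserves real-valuedness) and eventually contain every frequency.\<close>

definition freq_box :: "nat \<Rightarrow> (int^2) set" where
  "freq_box N = {k. \<forall>i. \<bar>k $ i\<bar> \<le> int N}"

lemma vec2_bij: "bij_betw (\<lambda>(a::'a, b). vector [a, b] :: 'a::zero ^ 2) UNIV UNIV"
proof (rule bij_betwI[where g = "\<lambda>v. (v $ 1, v $ 2)"])
  show "(\<lambda>(a::'a, b). vector [a, b] :: 'a::zero ^ 2) (x $ 1, x $ 2) = x" for x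
    by (simp add: vec_eq_iff forall_2 )
qed (auto)

lemma freq_box_eq: "freq_box N = (\<lambda>(a, b). vector [a, b]) ` ({- int N..int N} \<times> {- int N..int N})"
proof safe
  fix k assume "k \<in> freq_box N"
  then have "k = (\<lambda>(a, b). vector [a, b]) (k $ 1, k $ 2)" "(k $ 1, k $ 2) \<in> {- int N..int N} \<times> {- int N..int N}"
    by (auto simp: freq_box_def vec_eq_iff forall_2 abs_le_iff)
  then show "k \<in> (\<lambda>(a, b). vector [a, b]) ` ({- int N..int N} \<times> {- int N..int N})"
    by (rule image_eqI)
qed (auto simp: freq_box_def forall_2)

lemma finite_freq_box [simp, intro]: "finite (freq_box N)"
  by (simp add: freq_box_eq)

lemma freq_box_mono: "M \<le> N \<Longrightarrow> freq_box M \<subseteq> freq_box N"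
  by (auto simp: freq_box_def intro: order_trans)

lemma freq_box_minus [simp]: "- k \<in> freq_box N \<longleftrightarrow> k \<in> freq_box N"
  by (simp add: freq_box_def)

lemma in_freq_box: "k \<in> freq_box (nat \<bar>k $ 1\<bar> + nat \<bar>k $ 2\<bar>)"
  by (auto simp: freq_box_def forall_2)

lemma filterlim_freq_box: "filterlim freq_box (finite_subsets_at_top UNIV) sequentially"
  unfolding filterlim_finite_subsets_at_top
proof safe
  fix X :: "(int^2) set" assume X: "finite X"
  define N where "N = (\<Sum>k\<in>X. nat \<bar>k $ 1\<bar> + nat \<bar>k $ 2\<bar>)"
  show "\<forall>\<^sub>F n in sequentially. finite (freq_box n) \<and> X \<subseteq> freq_box n \<and> freq_box n \<subseteq> UNIV"
    using eventually_ge_at_top[of N]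
  proof eventually_elim
    case (elim n)
    have "k \<in> freq_box n" if "k \<in> X" for k
    proof -
      have "nat \<bar>k $ 1\<bar> + nat \<bar>k $ 2\<bar> \<le> N"
        unfolding N_def using that X by (intro member_le_sum) auto
      then show ?thesis using in_freq_box[of k] freq_box_mono elim by (meson order_trans subsetD)
    qed
    then show ?case by auto
  qed
qed

lemma freq_box_eventually: "\<forall>\<^sub>F N in sequentially. k \<in> freq_box N"
  using filterlim_freq_box unfolding filterlim_finite_subsets_at_top
  by (auto dest!: spec[of _ "{k}"])

lemma has_sum_freq_box:
  assumes "(f has_sum S) UNIV"
  shows "(\<lambda>N. \<Sum>k\<in>freq_box N. f k) \<longlonglongrightarrow> S"
  using assms filterlim_compose[OF _ filterlim_freq_box] unfolding has_sum_def by blast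

lemma infsum_outside_box_tendsto:
  fixes f :: "int^2 \<Rightarrow> real"
  assumes "f summable_on UNIV"
  shows "(\<lambda>N. infsum f (- freq_box N)) \<longlonglongrightarrow> 0"
proof -
  have eq: "infsum f (- freq_box N) = infsum f UNIV - (\<Sum>k\<in>freq_box N. f k)" for N
  proof -
    have "infsum f (freq_box N \<union> - freq_box N) = infsum f (freq_box N) + infsum f (- freq_box N)"
      using assms by (intro infsum_Un_disjoint summable_on_finite summable_on_subset_banach[OF assms]) auto
    then show ?thesis by simp
  qed
  have "(\<lambda>N. infsum f UNIV - (\<Sum>k\<in>freq_box N. f k)) \<longlonglongrightarrow> infsum f UNIV - infsum f UNIV"
    using has_sum_infsum[OF assms] by (intro tendsto_intros has_sum_freq_box)
  then show ?thesis by (simp add: eq)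
qed

lemma summable_int_one_plus_sq:
  assumes "1 < r"
  shows "(\<lambda>n::int. (1 + (real_of_int n)\<^sup>2) powr (- r / 2)) summable_on UNIV"
proof -
  let ?f = "\<lambda>n::int. (1 + (real_of_int n)\<^sup>2) powr (- r / 2)"
  have bound: "(1 + (real n)\<^sup>2) powr (- r / 2) \<le> real n powr (- r)" if "n > 0" for n :: nat
  proof -
    have "(1 + (real n)\<^sup>2) powr (- r / 2) \<le> ((real n)\<^sup>2) powr (- r / 2)"
      using that assms by (intro powr_mono2') auto
    also have "(real n)\<^sup>2 = real n powr 2" using that by simp
    also have "(real n powr 2) powr (- r / 2) = real n powr (- r)"
      by (subst powr_powr) simp
    finally show ?thesis using that by simp
  qed
  have "summable (\<lambda>n. real n powr (- r))"
    using assms by (simp add: summable_real_powr_iff)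
  then have "summable (\<lambda>n::nat. (1 + (real n)\<^sup>2) powr (- r / 2))"
    by (rule summable_comparison_test_ev[rotated])
       (rule eventually_mono[OF eventually_gt_at_top[of 0]], use bound in simp)
  then have nat: "(\<lambda>n::nat. (1 + (real n)\<^sup>2) powr (- r / 2)) summable_on UNIV"
    by (intro summable_nonneg_imp_summable_on) auto
  have "?f summable_on (int ` UNIV)"
    using nat by (subst summable_on_reindex) (auto simp: o_def)
  moreover have "?f summable_on ((\<lambda>n. - int n) ` UNIV)"
    using nat by (subst summable_on_reindex) (auto simp: o_def inj_on_def)
  ultimately have "?f summable_on (int ` UNIV \<union> (\<lambda>n. - int n) ` UNIV)"
    by (rule summable_on_union)
  moreover have "int ` UNIV \<union> (\<lambda>n. - int n) ` UNIV = UNIV"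
    by (auto simp: image_iff) (metis int_cases2)
  ultimately show ?thesis by simp
qed

text \<open>Since \<open>(1 + freq_sq k)\<^sup>2\<close> dominates the product of \<open>1 + (k $ 1)\<^sup>2\<close> and \<open>1 + (k $ 2)\<^sup>2\<close>, the lattice
  sum is dominated by a product of two convergent one-dimensional sums.\<close>

lemma summable_bracket_powr:
  assumes "2 < p"
  shows "(\<lambda>k. bracket k powr (- p)) summable_on UNIV"
proof -
  define r where "r = p / 2"
  have r: "1 < r" using assms by (simp add: r_def)
  let ?g = "\<lambda>n::int. (1 + (real_of_int n)\<^sup>2) powr (- r / 2)"
  have "(\<lambda>(a, b). ?g a * ?g b) summable_on (UNIV \<times> UNIV)"
  proof -
    have "(\<lambda>x. norm (?g x)) summable_on UNIV"
      using summable_int_one_plus_sq[OF r] by simp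
    then have "(\<lambda>x. norm ((\<lambda>(a, b). ?g a * ?g b) x)) summable_on UNIV \<times> UNIV"
      apply (subst Infinite_Sum.abs_summable_on_Sigma_iff)
      by (auto simp: abs_mult infsum_cmult_right' intro!: summable_on_cmult_right summable_on_cmult_left)
    then show ?thesis by (rule abs_summable_summable)
  qed
  then have "(\<lambda>v::int^2. ?g (v $ 1) * ?g (v $ 2)) summable_on UNIV"
    using summable_on_reindex_bij_betw[OF vec2_bij, of "\<lambda>v::int^2. ?g (v $ 1) * ?g (v $ 2)"]
    by (simp add: case_prod_unfold)
  moreover have "bracket k powr (- p) \<le> ?g (k $ 1) * ?g (k $ 2)" for k
  proof -
    let ?a = "(real_of_int (k $ 1))\<^sup>2" and ?b = "(real_of_int (k $ 2))\<^sup>2"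
    have "(1 + ?a) * (1 + ?b) \<le> (1 + freq_sq k)\<^sup>2"
      unfolding power2_eq_square[of "1 + freq_sq k"] by (intro mult_mono) (auto simp: freq_sq_def)
    then have "((1 + freq_sq k)\<^sup>2) powr (- r / 2) \<le> ((1 + ?a) * (1 + ?b)) powr (- r / 2)"
      using r by (intro powr_mono2') (auto simp: add_pos_nonneg)
    also have "\<dots> = ?g (k $ 1) * ?g (k $ 2)" by (intro powr_mult)
    also have "((1 + freq_sq k)\<^sup>2) powr (- r / 2) = bracket k powr (- p)"
    proof -
      have "((1 + freq_sq k) powr 2) powr (- r / 2) = (1 + freq_sq k) powr (- r)"
        by (subst powr_powr) simp
      moreover have "(1 + freq_sq k) powr (- r) = bracket k powr (- p)"
        using bracket_powr_sq[of k "- r"] by (simp add: r_def)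
      moreover have "(1 + freq_sq k)\<^sup>2 = (1 + freq_sq k) powr 2"
        using freq_sq_nonneg[of k] by simp
      ultimately show ?thesis by metis
    qed
    finally show ?thesis .
  qed
  ultimately show ?thesis
    by (rule summable_on_comparison_test) auto
qed

section \<open>The symbol of the velocity\<close>

text \<open>The scalar product of the frequency \<open>l\<close> with the velocity symbol at \<open>j\<close>: up to a constant factor, the
  rate at which mode \<open>j\<close> of the scalar transports its mode \<open>l\<close>.\<close>

definition advect :: "int^2 \<Rightarrow> int^2 \<Rightarrow> real" where
  "advect l j = real_of_int (l $ 1) * M1_symbol 0 j + real_of_int (l $ 2) * M2_symbol 0 j"

lemma symbol_minus [simp]: "M1_symbol 0 (- j) = M1_symbol 0 j" "M2_symbol 0 (- j) = M2_symbol 0 j"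
  by (simp_all add: M1_symbol_def M2_symbol_def)

lemma symbol_sq_sum: "(M1_symbol 0 j)\<^sup>2 + (M2_symbol 0 j)\<^sup>2 \<le> 1"
proof (cases "freq_sq j = 0")
  case True
  then show ?thesis by (simp add: M1_symbol_def M2_symbol_def)
next
  case False
  let ?a = "real_of_int (j $ 1)" and ?b = "real_of_int (j $ 2)"
  have pos: "freq_sq j > 0" using False freq_sq_nonneg[of j] by linarith
  have "(M1_symbol 0 j)\<^sup>2 + (M2_symbol 0 j)\<^sup>2 = ?a\<^sup>2 * freq_sq j / (freq_sq j)\<^sup>2"
    by (simp add: M1_symbol_def M2_symbol_def power_divide add_divide_distrib[symmetric])
       (simp add: freq_sq_def power2_eq_square power4_eq_xxxx algebra_simps)
  also have "\<dots> = ?a\<^sup>2 / freq_sq j" using pos by (simp add: power2_eq_square)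
  also have "\<dots> \<le> 1" using pos by (simp add: freq_sq_def)
  finally show ?thesis .
qed

lemma symbol_le_1: "\<bar>M1_symbol 0 j\<bar> \<le> 1" "\<bar>M2_symbol 0 j\<bar> \<le> 1"
proof -
  have "(M1_symbol 0 j)\<^sup>2 \<le> 1" "(M2_symbol 0 j)\<^sup>2 \<le> 1"
    using symbol_sq_sum[of j] zero_le_power2[of "M1_symbol 0 j"] zero_le_power2[of "M2_symbol 0 j"]
    by linarith+
  then show "\<bar>M1_symbol 0 j\<bar> \<le> 1" "\<bar>M2_symbol 0 j\<bar> \<le> 1"
    by (simp_all add: abs_square_le_1)
qed

text \<open>The velocity is divergence free. All cancellations below come from this identity.\<close>

lemma advect_self [simp]: "advect j j = 0"
  by (simp add: advect_def M1_symbol_def M2_symbol_def power2_eq_square)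

lemma advect_diff: "advect (k - l) j = advect k j - advect l j"
  by (simp add: advect_def algebra_simps)

lemma advect_minus [simp]: "advect l (- j) = advect l j" "advect (- l) j = - advect l j"
  by (simp_all add: advect_def)

text \<open>By incompressibility the derivative may be read on the output frequency \<open>k\<close> instead of the
  input frequency \<open>l\<close>. This makes the kernel symmetric in \<open>k\<close> and \<open>l\<close>, and it bounds the kernel by either
  of the two brackets.\<close>

lemma advect_shift: "advect l (k - l) = advect k (k - l)"
  using advect_self[of "k - l"] advect_diff[of k l "k - l"] by simp

lemma advect_swap: "advect k (l - k) = advect l (k - l)"
  using advect_minus(1)[of k "l - k"] advect_shift[of l k] by simp

lemma advect_le: "\<bar>advect l j\<bar> \<le> bracket l"
proof -
  let ?a = "real_of_int (l $ 1)" and ?b = "real_of_int (l $ 2)"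
  let ?m = "M1_symbol 0 j" and ?n = "M2_symbol 0 j"
  have "(advect l j)\<^sup>2 \<le> (?a\<^sup>2 + ?b\<^sup>2) * (?m\<^sup>2 + ?n\<^sup>2)"
    using zero_le_power2[of "?a * ?n - ?b * ?m"] unfolding advect_def
    by (simp add: power2_eq_square algebra_simps)
  also have "\<dots> \<le> freq_sq l * 1"
    unfolding freq_sq_def using symbol_sq_sum[of j] by (intro mult_left_mono) auto
  finally have "\<bar>advect l j\<bar> \<le> sqrt (freq_sq l)"
    by (simp add: real_le_rsqrt)
  then show ?thesis using freq_le_bracket[of l] by linarith
qed

lemma advect_le': "\<bar>advect l (k - l)\<bar> \<le> bracket k"
  by (subst advect_shift) (rule advect_le)

section \<open>Sobolev bounds on Fourier coefficients\<close>

text \<open>A bound \<open>M\<close> for the \<open>H\<^sup>s\<close> norm, phrased through finite partial sums: in this form it needs no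
  separate summability statement and passes to pointwise limits of coefficients.\<close>

definition sob_bound :: "real \<Rightarrow> real \<Rightarrow> (int^2 \<Rightarrow> complex) \<Rightarrow> bool" where
  "sob_bound s M c \<longleftrightarrow> 0 \<le> M \<and>
     (\<forall>F. finite F \<longrightarrow> (\<Sum>k\<in>F. (bracket k powr s * cmod (c k))\<^sup>2) \<le> M\<^sup>2)"

text \<open>The Fourier coefficients of real functions.\<close>

definition hermitian :: "(int^2 \<Rightarrow> complex) \<Rightarrow> bool" where
  "hermitian c \<longleftrightarrow> (\<forall>k. c (- k) = cnj (c k))"

text \<open>By Cauchy-Schwarz this is the constant in the bound of the sum of \<open>bracket k * cmod (c k)\<close> over
  \<open>A\<close> by the \<open>H\<^sup>s\<close> norm. For \<open>s > 2\<close> it is the square root of a convergent sum, and over the complement of a large box it is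
  small. It thus expresses at once the embedding of \<open>H\<^sup>s\<close> into \<open>C\<^sup>1\<close> and the uniform smallness of
  the tails.\<close>

definition emb_const :: "real \<Rightarrow> (int^2) set \<Rightarrow> real" where
  "emb_const s A = sqrt (infsum (\<lambda>k. bracket k powr (2 - 2 * s)) A)"

lemma emb_const_nonneg [simp]: "0 \<le> emb_const s A"
  by (simp add: emb_const_def infsum_nonneg)

lemma sob_bound_nonneg: "sob_bound s M c \<Longrightarrow> 0 \<le> M"
  by (simp add: sob_bound_def)

lemma sob_boundD: "sob_bound s M c \<Longrightarrow> finite F \<Longrightarrow> (\<Sum>k\<in>F. (bracket k powr s * cmod (c k))\<^sup>2) \<le> M\<^sup>2"
  by (simp add: sob_bound_def)

lemma sum_mult_le_of_squares:
  fixes a b :: "'a \<Rightarrow> real"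
  assumes "(\<Sum>i\<in>F. (a i)\<^sup>2) \<le> A\<^sup>2" "(\<Sum>i\<in>F. (b i)\<^sup>2) \<le> B\<^sup>2" "0 \<le> A" "0 \<le> B"
  shows "(\<Sum>i\<in>F. a i * b i) \<le> A * B"
proof -
  have "(\<Sum>i\<in>F. a i * b i)\<^sup>2 \<le> (\<Sum>i\<in>F. (a i)\<^sup>2) * (\<Sum>i\<in>F. (b i)\<^sup>2)"
    by (rule Cauchy_Schwarz_ineq_sum)
  also have "\<dots> \<le> A\<^sup>2 * B\<^sup>2"
    using assms by (intro mult_mono) (auto simp: sum_nonneg)
  finally show ?thesis
    using assms by (auto simp: power_mult_distrib intro!: power2_le_imp_le[of "\<Sum>i\<in>F. a i * b i" "A * B", OF _ mult_nonneg_nonneg])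
qed

lemma sob_bound_pointwise:
  assumes "sob_bound s M c"
  shows "bracket k powr s * cmod (c k) \<le> M"
  using sob_boundD[OF assms, of "{k}"] by (intro power2_le_imp_le[OF _ sob_bound_nonneg[OF assms]]) simp

lemma one_le_bracket_powr: "0 \<le> s \<Longrightarrow> 1 \<le> bracket k powr s"
  using powr_mono2[of s 1 "bracket k"] by simp

lemma sob_bound_cmod:
  assumes "sob_bound s M c" "0 \<le> s"
  shows "cmod (c k) \<le> M"
proof -
  have "1 * cmod (c k) \<le> bracket k powr s * cmod (c k)"
    using assms one_le_bracket_powr by (intro mult_right_mono) auto
  then show ?thesis using sob_bound_pointwise[OF assms(1), of k] by simp
qed

lemma sob_bound_l2:
  assumes "sob_bound s M c" "0 \<le> s" "finite F"
  shows "(\<Sum>k\<in>F. (cmod (c k))\<^sup>2) \<le> M\<^sup>2"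
proof -
  have "(cmod (c k))\<^sup>2 \<le> (bracket k powr s * cmod (c k))\<^sup>2" for k
    using mult_right_mono[OF one_le_bracket_powr[of s k], of "cmod (c k)"] assms by (intro power_mono) auto
  then have "(\<Sum>k\<in>F. (cmod (c k))\<^sup>2) \<le> (\<Sum>k\<in>F. (bracket k powr s * cmod (c k))\<^sup>2)"
    by (intro sum_mono) auto
  then show ?thesis using sob_boundD[OF assms(1,3)] by linarith
qed

lemma sob_bound_weighted_l1:
  assumes c: "sob_bound s M c" and s: "2 < s" and F: "finite F" "F \<subseteq> A"
  shows "(\<Sum>k\<in>F. bracket k * cmod (c k)) \<le> emb_const s A * M"
proof -
  have eq: "bracket k * cmod (c k) = bracket k powr (1 - s) * (bracket k powr s * cmod (c k))" for k
    using bracket_pos[of k] by (simp add: powr_diff field_simps)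
  have sq: "(bracket k powr (1 - s))\<^sup>2 = bracket k powr (2 - 2 * s)" for k
    by (simp add: power2_eq_square flip: powr_add)
  have "(\<lambda>k. bracket k powr (2 - 2 * s)) summable_on A"
    using summable_bracket_powr[of "2 * s - 2"] s by (auto intro: summable_on_subset_banach)
  then have "(\<Sum>k\<in>F. bracket k powr (2 - 2 * s)) \<le> infsum (\<lambda>k. bracket k powr (2 - 2 * s)) A"
    using F by (intro finite_sum_le_infsum) auto
  also have "\<dots> = (emb_const s A)\<^sup>2"
    by (simp add: emb_const_def infsum_nonneg)
  finally have "(\<Sum>k\<in>F. (bracket k powr (1 - s))\<^sup>2) \<le> (emb_const s A)\<^sup>2"
    by (simp add: sq)
  then show ?thesis
    unfolding eq using sob_boundD[OF c F(1)] sob_bound_nonneg[OF c]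
    by (intro sum_mult_le_of_squares) auto
qed

lemma sob_bound_weighted_summable:
  assumes "sob_bound s M c" "2 < s"
  shows "(\<lambda>k. bracket k * cmod (c k)) summable_on A"
proof -
  have "(\<lambda>k. bracket k * cmod (c k)) summable_on UNIV"
  proof (rule nonneg_bdd_above_summable_on)
    show "bdd_above (sum (\<lambda>k. bracket k * cmod (c k)) ` {F. F \<subseteq> UNIV \<and> finite F})"
      using sob_bound_weighted_l1[OF assms, of _ UNIV] by (intro bdd_aboveI2) auto
  qed auto
  then show ?thesis by (rule summable_on_subset_banach) auto
qed

lemma sob_bound_weighted_infsum:
  assumes "sob_bound s M c" "2 < s"
  shows "infsum (\<lambda>k. bracket k * cmod (c k)) A \<le> emb_const s A * M"
  using sob_bound_weighted_l1[OF assms]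
  by (intro infsum_le_finite_sums sob_bound_weighted_summable[OF assms]) auto

lemma cmod_le_bracket_mult: "cmod z \<le> bracket k * cmod z"
  using mult_right_mono[OF bracket_ge_1[of k], of "cmod z"] by simp

lemma sob_bound_summable:
  assumes "sob_bound s M c" "2 < s"
  shows "(\<lambda>k. cmod (c k)) summable_on A"
  by (rule summable_on_comparison_test[OF sob_bound_weighted_summable[OF assms]])
     (auto intro: cmod_le_bracket_mult)

lemma sob_bound_infsum:
  assumes "sob_bound s M c" "2 < s"
  shows "infsum (\<lambda>k. cmod (c k)) A \<le> emb_const s A * M"
proof -
  have "infsum (\<lambda>k. cmod (c k)) A \<le> infsum (\<lambda>k. bracket k * cmod (c k)) A"
    by (intro infsum_mono sob_bound_summable[OF assms] sob_bound_weighted_summable[OF assms] cmod_le_bracket_mult)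
  then show ?thesis using sob_bound_weighted_infsum[OF assms, of A] by linarith
qed

lemma emb_const_outside_box: "2 < s \<Longrightarrow> (\<lambda>N. emb_const s (- freq_box N)) \<longlonglongrightarrow> 0"
  unfolding emb_const_def
  using tendsto_real_sqrt[OF infsum_outside_box_tendsto[OF summable_bracket_powr[of "2 * s - 2"]]] by simp

lemma sob_bound_mono: "sob_bound s M c \<Longrightarrow> M \<le> M' \<Longrightarrow> sob_bound s M' c"
  unfolding sob_bound_def by (meson order_trans power_mono)

lemma sob_bound_cong_le:
  assumes "sob_bound s M c" "\<And>k. cmod (d k) \<le> cmod (c k)"
  shows "sob_bound s M d"
  unfolding sob_bound_def
proof safe
  show "0 \<le> M" using assms by (simp add: sob_bound_def)
  fix F :: "(int^2) set" assume "finite F"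
  have "(\<Sum>k\<in>F. (bracket k powr s * cmod (d k))\<^sup>2) \<le> (\<Sum>k\<in>F. (bracket k powr s * cmod (c k))\<^sup>2)"
    by (intro sum_mono power_mono mult_left_mono assms) auto
  also have "\<dots> \<le> M\<^sup>2" using sob_boundD[OF assms(1) \<open>finite F\<close>] .
  finally show "(\<Sum>k\<in>F. (bracket k powr s * cmod (d k))\<^sup>2) \<le> M\<^sup>2" .
qed

lemma sob_bound_diff:
  assumes a: "sob_bound s A a" and b: "sob_bound s B b"
  shows "sob_bound s (2 * (A + B)) (\<lambda>k. a k - b k)"
  unfolding sob_bound_def
proof safe
  have nn: "0 \<le> A" "0 \<le> B" using a b by (auto simp: sob_bound_def)
  show "0 \<le> 2 * (A + B)" using nn by simp
  fix F :: "(int^2) set" assume F: "finite F"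
  have "(bracket k powr s * cmod (a k - b k))\<^sup>2
      \<le> 2 * (bracket k powr s * cmod (a k))\<^sup>2 + 2 * (bracket k powr s * cmod (b k))\<^sup>2" for k
  proof -
    have "(cmod (a k - b k))\<^sup>2 \<le> (cmod (a k) + cmod (b k))\<^sup>2"
      by (intro power_mono norm_triangle_ineq4) auto
    also have "\<dots> \<le> 2 * (cmod (a k))\<^sup>2 + 2 * (cmod (b k))\<^sup>2"
      using sum_squares_bound[of "cmod (a k)" "cmod (b k)"] by (simp add: power2_sum)
    finally have "(bracket k powr s)\<^sup>2 * (cmod (a k - b k))\<^sup>2
       \<le> (bracket k powr s)\<^sup>2 * (2 * (cmod (a k))\<^sup>2 + 2 * (cmod (b k))\<^sup>2)"
      by (intro mult_left_mono) auto
    then show ?thesis by (simp add: power_mult_distrib algebra_simps)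
  qed
  then have "(\<Sum>k\<in>F. (bracket k powr s * cmod (a k - b k))\<^sup>2)
     \<le> (\<Sum>k\<in>F. 2 * (bracket k powr s * cmod (a k))\<^sup>2 + 2 * (bracket k powr s * cmod (b k))\<^sup>2)"
    by (intro sum_mono) auto
  also have "\<dots> \<le> 2 * A\<^sup>2 + 2 * B\<^sup>2"
    using sob_boundD[OF a F] sob_boundD[OF b F] by (simp add: sum.distrib flip: sum_distrib_left)
  also have "\<dots> \<le> (2 * (A + B))\<^sup>2"
    using nn by (simp add: power2_eq_square algebra_simps)
  finally show "(\<Sum>k\<in>F. (bracket k powr s * cmod (a k - b k))\<^sup>2) \<le> (2 * (A + B))\<^sup>2" .
qed

section \<open>Convolution inequalities\<close>

lemma young_l2_l1:
  fixes f g h :: "int^2 \<Rightarrow> real"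
  assumes f: "\<And>F. finite F \<Longrightarrow> (\<Sum>j\<in>F. (f j)\<^sup>2) \<le> A\<^sup>2"
    and g: "(\<Sum>l\<in>L. g l) \<le> G" "\<And>l. 0 \<le> g l"
    and h: "(\<Sum>k\<in>K. (h k)\<^sup>2) \<le> H\<^sup>2"
    and nn: "0 \<le> A" "0 \<le> H" and fin: "finite K"
  shows "(\<Sum>k\<in>K. \<Sum>l\<in>L. f (k - l) * g l * h k) \<le> A * G * H"
proof -
  have *: "(\<Sum>k\<in>K. f (k - l) * h k) \<le> A * H" for l
  proof -
    have "(\<Sum>k\<in>K. (f (k - l))\<^sup>2) = (\<Sum>j\<in>(\<lambda>k. k - l) ` K. (f j)\<^sup>2)"
      by (subst sum.reindex) (auto simp: inj_on_def)
    also have "\<dots> \<le> A\<^sup>2" using fin by (intro f) auto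
    finally show ?thesis using h nn by (intro sum_mult_le_of_squares)
  qed
  have "(\<Sum>k\<in>K. \<Sum>l\<in>L. f (k - l) * g l * h k) = (\<Sum>l\<in>L. g l * (\<Sum>k\<in>K. f (k - l) * h k))"
    by (subst sum.swap) (simp add: sum_distrib_left mult_ac)
  also have "\<dots> \<le> (\<Sum>l\<in>L. g l * (A * H))"
    using g * by (intro sum_mono mult_left_mono) auto
  also have "\<dots> = (\<Sum>l\<in>L. g l) * (A * H)" by (simp add: sum_distrib_right)
  also have "\<dots> \<le> G * (A * H)" using g nn by (intro mult_right_mono) auto
  finally show ?thesis by (simp add: mult_ac)
qed

lemma young_l1_l2:
  fixes f g h :: "int^2 \<Rightarrow> real"
  assumes f: "\<And>F. finite F \<Longrightarrow> (\<Sum>j\<in>F. f j) \<le> A" "\<And>j. 0 \<le> f j"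
    and g: "\<And>F. finite F \<Longrightarrow> (\<Sum>l\<in>F. (g l)\<^sup>2) \<le> G\<^sup>2" "\<And>l. 0 \<le> g l"
    and h: "(\<Sum>k\<in>K. (h k)\<^sup>2) \<le> H\<^sup>2" "\<And>k. 0 \<le> h k"
    and nn: "0 \<le> G" "0 \<le> H" and fin: "finite K" "finite L"
  shows "(\<Sum>k\<in>K. \<Sum>l\<in>L. f (k - l) * g l * h k) \<le> A * G * H"
proof -
  define J where "J = (\<lambda>(k, l). k - l) ` (K \<times> L)"
  have J: "finite J" using fin by (simp add: J_def)
  have "(\<Sum>l\<in>L. f (k - l) * g l * h k) \<le> (\<Sum>j\<in>J. g (k - j) * f j * h k)" if "k \<in> K" for k
  proof -
    have "(\<Sum>l\<in>L. f (k - l) * g l * h k) = (\<Sum>j\<in>(\<lambda>l. k - l) ` L. g (k - j) * f j * h k)"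
      by (subst sum.reindex) (auto simp: inj_on_def mult_ac)
    also have "\<dots> \<le> (\<Sum>j\<in>J. g (k - j) * f j * h k)"
      using that J f g h by (intro sum_mono2) (auto simp: J_def)
    finally show ?thesis .
  qed
  then have "(\<Sum>k\<in>K. \<Sum>l\<in>L. f (k - l) * g l * h k) \<le> (\<Sum>k\<in>K. \<Sum>j\<in>J. g (k - j) * f j * h k)"
    by (intro sum_mono)
  also have "\<dots> \<le> G * A * H"
    using f g h nn fin J by (intro young_l2_l1) auto
  finally show ?thesis by (simp add: mult_ac)
qed

section \<open>The transport term in frequency space\<close>

definition transport_term :: "(int^2 \<Rightarrow> complex) \<Rightarrow> (int^2 \<Rightarrow> complex) \<Rightarrow> int^2 \<Rightarrow> int^2 \<Rightarrow> complex" where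
  "transport_term a b k l = - \<i> * complex_of_real (advect l (k - l)) * a (k - l) * b l"

text \<open>The Fourier coefficients of \<open>- (u \<cdot> \<nabla>) f\<close>, where \<open>u\<close> is the velocity generated by the scalar with
  coefficients \<open>a\<close> and \<open>f\<close> has coefficients \<open>b\<close>. The equation becomes the system
  \<open>c' = transport c c\<close>.\<close>

definition transport :: "(int^2 \<Rightarrow> complex) \<Rightarrow> (int^2 \<Rightarrow> complex) \<Rightarrow> int^2 \<Rightarrow> complex" where
  "transport a b k = (\<Sum>\<^sub>\<infinity>l. transport_term a b k l)"

lemma transport_term_le: "cmod (transport_term a b k l) \<le> cmod (a (k - l)) * (bracket l * cmod (b l))"
proof -
  have "cmod (transport_term a b k l) = cmod (a (k - l)) * (\<bar>advect l (k - l)\<bar> * cmod (b l))"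
    by (simp add: transport_term_def norm_mult)
  also have "\<dots> \<le> cmod (a (k - l)) * (bracket l * cmod (b l))"
    using advect_le by (intro mult_left_mono mult_right_mono) auto
  finally show ?thesis .
qed

lemma transport_term_le': "cmod (transport_term a b k l) \<le> bracket k * (cmod (a (k - l)) * cmod (b l))"
proof -
  have "cmod (transport_term a b k l) = \<bar>advect l (k - l)\<bar> * (cmod (a (k - l)) * cmod (b l))"
    by (simp add: transport_term_def norm_mult)
  also have "\<dots> \<le> bracket k * (cmod (a (k - l)) * cmod (b l))"
    using advect_le' by (intro mult_right_mono) auto
  finally show ?thesis .
qed

text \<open>Exchanging \<open>k\<close> and \<open>l\<close> conjugates the triple product, because \<open>a\<close> is hermitian, and leaves the
  real kernel unchanged, because the flow is incompressible. Only the difference of the weights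
  survives. For constant weights nothing survives: the \<open>L\<^sup>2\<close> norm is conserved.\<close>

lemma energy_antisym:
  fixes W :: "int^2 \<Rightarrow> real"
  assumes "hermitian a"
  shows "Re (\<Sum>k\<in>F. \<Sum>l\<in>F. complex_of_real (W k) * cnj (b k) * transport_term a b k l)
    = (1/2) * (\<Sum>k\<in>F. \<Sum>l\<in>F. (W k - W l) * advect l (k - l) * Im (a (k - l) * b l * cnj (b k)))"
proof -
  define S where "S = Re (\<Sum>k\<in>F. \<Sum>l\<in>F. complex_of_real (W k) * cnj (b k) * transport_term a b k l)"
  define z where "z k l = a (k - l) * b l * cnj (b k)" for k l
  have zc: "z l k = cnj (z k l)" for k l
    using assms[unfolded hermitian_def, rule_format, of "k - l"] by (simp add: z_def)
  have S1: "S = (\<Sum>k\<in>F. \<Sum>l\<in>F. W k * advect l (k - l) * Im (z k l))"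
    unfolding S_def Re_sum
  proof (intro sum.cong refl)
    fix k l
    have "complex_of_real (W k) * cnj (b k) * transport_term a b k l
      = complex_of_real (W k * advect l (k - l)) * (- \<i> * z k l)"
      by (simp add: transport_term_def z_def mult_ac)
    then show "Re (complex_of_real (W k) * cnj (b k) * transport_term a b k l) = W k * advect l (k - l) * Im (z k l)"
      by simp
  qed
  also have "\<dots> = (\<Sum>k\<in>F. \<Sum>l\<in>F. W l * advect k (l - k) * Im (z l k))"
    by (rule sum.swap)
  also have "\<dots> = - (\<Sum>k\<in>F. \<Sum>l\<in>F. W l * advect l (k - l) * Im (z k l))"
    unfolding sum_negf[symmetric] by (intro sum.cong refl) (subst advect_swap, subst zc, simp)
  finally have "2 * S = (\<Sum>k\<in>F. \<Sum>l\<in>F. W k * advect l (k - l) * Im (z k l))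
      - (\<Sum>k\<in>F. \<Sum>l\<in>F. W l * advect l (k - l) * Im (z k l))" using S1 by simp
  also have "\<dots> = (\<Sum>k\<in>F. \<Sum>l\<in>F. (W k - W l) * advect l (k - l) * Im (z k l))"
    by (simp add: sum_subtractf left_diff_distrib)
  finally show ?thesis by (simp add: S_def z_def)
qed

lemma hermitian_cmod: "hermitian a \<Longrightarrow> cmod (a (k - l)) = cmod (a (l - k))"
  unfolding hermitian_def by (metis complex_mod_cnj minus_diff_eq)

definition energy_const :: "real \<Rightarrow> real" where
  "energy_const s = 2 * (s * 2 powr (s - 1)) * emb_const s UNIV"

text \<open>The weight difference costs one bracket at \<open>k - l\<close> and the symbol one bracket at \<open>l\<close>; of the
  resulting products each has \<open>s\<close> derivatives on one factor and one derivative on the other.\<close>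

lemma commutator_estimate:
  assumes s: "1 \<le> s"
  defines "w \<equiv> \<lambda>k. bracket k powr s"
  shows "\<bar>w k - w l\<bar> * w k * \<bar>advect l (k - l)\<bar>
    \<le> (s * 2 powr (s - 1)) * ((w (k - l) * bracket l + bracket (k - l) * w l) * w k)"
proof -
  let ?D = "s * 2 powr (s - 1)"
  have powr1: "bracket j * bracket j powr (s - 1) = w j" for j
    using bracket_pos[of j] by (simp add: powr_diff w_def)
  have "\<bar>w k - w l\<bar> * \<bar>advect l (k - l)\<bar>
     \<le> (?D * bracket (k - l) * (bracket (k - l) powr (s - 1) + bracket l powr (s - 1))) * bracket l"
    unfolding w_def using s bracket_powr_diff_le[OF s, of k l] advect_le by (intro mult_mono) auto
  also have "\<dots> = ?D * ((bracket (k - l) * bracket (k - l) powr (s - 1)) * bracket l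
       + bracket (k - l) * (bracket l * bracket l powr (s - 1)))"
    by (simp add: algebra_simps)
  also have "\<dots> = ?D * (w (k - l) * bracket l + bracket (k - l) * w l)"
    by (simp only: powr1)
  finally have "(\<bar>w k - w l\<bar> * \<bar>advect l (k - l)\<bar>) * w k \<le> (?D * (w (k - l) * bracket l + bracket (k - l) * w l)) * w k"
    by (intro mult_right_mono) (auto simp: w_def)
  then show ?thesis by (simp add: mult_ac)
qed

text \<open>The a priori estimate. In each of the two products of the commutator estimate, one factor
  is controlled in \<open>l\<^sup>2\<close> by the \<open>H\<^sup>s\<close> bound and the other, carrying one derivative, in \<open>l\<^sup>1\<close> by the
  embedding. The bound has degree three in the norms and does not depend on \<open>F\<close>.\<close>

lemma energy_estimate:
  assumes s: "2 < s" and F: "finite F" and herm: "hermitian a"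
    and a: "sob_bound s A a" and b: "sob_bound s M b"
  shows "\<bar>Re (\<Sum>k\<in>F. \<Sum>l\<in>F. complex_of_real ((bracket k powr s)\<^sup>2) * cnj (b k) * transport_term a b k l)\<bar>
    \<le> energy_const s * A * M\<^sup>2"
proof -
  define w where "w = (\<lambda>k. bracket k powr s)"
  define D where "D = s * 2 powr (s - 1)"
  define Q where "Q k l = cmod (a (k - l)) * cmod (b l) * cmod (b k)" for k l
  define T where "T k l = (w (k - l) * bracket l + bracket (k - l) * w l) * w k" for k l
  have Qsym: "Q k l = Q l k" for k l using hermitian_cmod[OF herm, of k l] by (simp add: Q_def)
  have Qnn: "0 \<le> Q k l" for k l by (simp add: Q_def)
  have D: "0 \<le> D" using s by (simp add: D_def)
  have wnn: "0 \<le> w k" for k by (simp add: w_def)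
  have AM: "0 \<le> A" "0 \<le> M" using a b by (auto simp: sob_bound_def)
  have term_le: "\<bar>((w k)\<^sup>2 - (w l)\<^sup>2) * advect l (k - l) * Im (a (k - l) * b l * cnj (b k))\<bar>
     \<le> D * (T k l * Q k l) + D * (T l k * Q l k)" for k l
  proof -
    have 1: "\<bar>w k - w l\<bar> * w k * \<bar>advect l (k - l)\<bar> \<le> D * T k l" for k l
      using commutator_estimate[of s k l] s by (simp add: D_def T_def w_def)
    have 2: "\<bar>w k - w l\<bar> * w l * \<bar>advect l (k - l)\<bar> \<le> D * T l k"
      using 1[of l k] by (simp add: advect_swap abs_minus_commute)
    have "\<bar>(w k)\<^sup>2 - (w l)\<^sup>2\<bar> = \<bar>w k - w l\<bar> * (w k + w l)"
      using wnn[of k] wnn[of l] by (simp add: power2_eq_square square_diff_square_factored abs_mult)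
    then have "\<bar>(w k)\<^sup>2 - (w l)\<^sup>2\<bar> * \<bar>advect l (k - l)\<bar> \<le> D * T k l + D * T l k"
      using 1[of k l] 2 by (simp add: algebra_simps)
    moreover define I where "I = Im (a (k - l) * b l * cnj (b k))"
    moreover have "\<bar>I\<bar> \<le> Q k l"
      unfolding I_def using abs_Im_le_cmod[of "a (k - l) * b l * cnj (b k)"] by (simp add: Q_def norm_mult)
    ultimately have "(\<bar>(w k)\<^sup>2 - (w l)\<^sup>2\<bar> * \<bar>advect l (k - l)\<bar>) * \<bar>I\<bar>
       \<le> (D * T k l + D * T l k) * Q k l"
      by (intro mult_mono) (use 1[of k l] 2 in \<open>auto intro: order_trans[rotated]\<close>)
    then show ?thesis
      unfolding I_def[symmetric] abs_mult using Qsym[of k l] by (simp add: algebra_simps)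
  qed
  have "\<bar>Re (\<Sum>k\<in>F. \<Sum>l\<in>F. complex_of_real ((w k)\<^sup>2) * cnj (b k) * transport_term a b k l)\<bar>
    \<le> (1/2) * (\<Sum>k\<in>F. \<Sum>l\<in>F. D * (T k l * Q k l) + D * (T l k * Q l k))"
  proof -
    have "\<bar>\<Sum>k\<in>F. \<Sum>l\<in>F. ((w k)\<^sup>2 - (w l)\<^sup>2) * advect l (k - l) * Im (a (k - l) * b l * cnj (b k))\<bar>
      \<le> (\<Sum>k\<in>F. \<Sum>l\<in>F. D * (T k l * Q k l) + D * (T l k * Q l k))"
      by (intro order_trans[OF sum_abs] sum_mono term_le)
    then show ?thesis unfolding energy_antisym[OF herm] by simp
  qed
  also have "(\<Sum>k\<in>F. \<Sum>l\<in>F. D * (T k l * Q k l) + D * (T l k * Q l k))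
     = (\<Sum>k\<in>F. \<Sum>l\<in>F. D * (T k l * Q k l)) + (\<Sum>k\<in>F. \<Sum>l\<in>F. D * (T l k * Q l k))"
    by (simp add: sum.distrib)
  also have "(\<Sum>k\<in>F. \<Sum>l\<in>F. D * (T l k * Q l k)) = (\<Sum>k\<in>F. \<Sum>l\<in>F. D * (T k l * Q k l))"
    by (rule sum.swap)
  also have "(\<Sum>k\<in>F. \<Sum>l\<in>F. D * (T k l * Q k l)) = D * ((\<Sum>k\<in>F. \<Sum>l\<in>F. (w (k - l) * cmod (a (k - l))) * (bracket l * cmod (b l)) * (w k * cmod (b k)))
     + (\<Sum>k\<in>F. \<Sum>l\<in>F. (bracket (k - l) * cmod (a (k - l))) * (w l * cmod (b l)) * (w k * cmod (b k))))"
    unfolding sum_distrib_left sum.distrib[symmetric] by (intro sum.cong refl) (simp add: T_def Q_def algebra_simps)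
  also have "(1/2) * (\<dots> + \<dots>) \<le> D * (A * (emb_const s UNIV * M) * M + (emb_const s UNIV * A) * M * M)"
  proof -
    have 1: "(\<Sum>k\<in>F. \<Sum>l\<in>F. (w (k - l) * cmod (a (k - l))) * (bracket l * cmod (b l)) * (w k * cmod (b k)))
        \<le> A * (emb_const s UNIV * M) * M"
      using sob_boundD[OF a] sob_boundD[OF b F] sob_bound_weighted_l1[OF b s F, of UNIV] AM F
      by (intro young_l2_l1) (auto simp: w_def)
    have 2: "(\<Sum>k\<in>F. \<Sum>l\<in>F. (bracket (k - l) * cmod (a (k - l))) * (w l * cmod (b l)) * (w k * cmod (b k)))
        \<le> (emb_const s UNIV * A) * M * M"
      using sob_boundD[OF b] sob_bound_weighted_l1[OF a s, of _ UNIV] AM F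
      by (intro young_l1_l2) (auto simp: w_def)
    have half: "(1/2) * (x + x) \<le> y" if "x \<le> y" for x y :: real using that by simp
    show ?thesis by (rule half, rule mult_left_mono[OF add_mono[OF 1 2] D])
  qed
  also have "\<dots> = energy_const s * A * M\<^sup>2"
    by (simp add: energy_const_def D_def power2_eq_square algebra_simps)
  finally show ?thesis by (simp add: w_def)
qed

lemma transport_term_le_const:
  assumes a: "sob_bound s A a" and s: "0 \<le> s"
  shows "cmod (transport_term a b k l) \<le> A * (bracket l * cmod (b l))"
  by (rule order_trans[OF transport_term_le mult_right_mono[OF sob_bound_cmod[OF a s]]]) simp

lemma transport_term_abs_summable:
  assumes a: "sob_bound s A a" and b: "sob_bound s B b" and s: "2 < s"
  shows "(\<lambda>l. cmod (transport_term a b k l)) summable_on X"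
proof (rule Infinite_Sum.abs_summable_on_comparison_test')
  show "(\<lambda>l. A * (bracket l * cmod (b l))) summable_on X"
    by (intro summable_on_cmult_right sob_bound_weighted_summable[OF b s])
  show "cmod (transport_term a b k l) \<le> A * (bracket l * cmod (b l))" for l
    using transport_term_le_const[OF a] s by simp
qed

lemma transport_term_summable:
  assumes "sob_bound s A a" "sob_bound s B b" "2 < s"
  shows "transport_term a b k summable_on X"
  using transport_term_abs_summable[OF assms] by (rule abs_summable_summable)

lemma cmod_trans_le:
  assumes a: "sob_bound s A a" and b: "sob_bound s B b" and s: "2 < s"
  shows "cmod (transport a b k) \<le> A * (emb_const s UNIV * B)"
proof -
  have "cmod (transport a b k) \<le> (\<Sum>\<^sub>\<infinity>l. A * (bracket l * cmod (b l)))"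
    unfolding transport_def
  proof (rule norm_infsum_le)
    show "(transport_term a b k has_sum (\<Sum>\<^sub>\<infinity>l. transport_term a b k l)) UNIV"
      using transport_term_summable[OF assms] by simp
    show "((\<lambda>l. A * (bracket l * cmod (b l))) has_sum (\<Sum>\<^sub>\<infinity>l. A * (bracket l * cmod (b l)))) UNIV"
      by (intro has_sum_infsum summable_on_cmult_right sob_bound_weighted_summable[OF b s])
    show "cmod (transport_term a b k l) \<le> A * (bracket l * cmod (b l))" for l
      using transport_term_le_const[OF a] s by simp
  qed
  also have "\<dots> = A * (\<Sum>\<^sub>\<infinity>l. bracket l * cmod (b l))" by (rule infsum_cmult_right')
  also have "\<dots> \<le> A * (emb_const s UNIV * B)"
    using sob_bound_weighted_infsum[OF b s] sob_bound_nonneg[OF a] by (intro mult_left_mono) auto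
  finally show ?thesis .
qed

lemma bij_diff: "bij_betw (\<lambda>l::int^2. k - l) UNIV UNIV"
  by (rule bij_betwI[where g = "\<lambda>l. k - l"]) auto

text \<open>For a fixed output frequency the transport term is Lipschitz even in the supremum norm of
  the coefficients, since the derivative can be put on that frequency and one factor of
  each product is bounded in \<open>l\<^sup>1\<close>.\<close>

lemma transport_diff_le:
  assumes a: "sob_bound s A a" and b: "sob_bound s B b" and s: "2 < s"
    and eta: "\<And>j. cmod (a j - b j) \<le> \<eta>"
  shows "cmod (transport a a k - transport b b k) \<le> bracket k * \<eta> * emb_const s UNIV * (A + B)"
proof -
  let ?d = "\<lambda>j. a j - b j"
  let ?g = "\<lambda>l. bracket k * \<eta> * (cmod (a l) + cmod (b (k - l)))"
  have sb: "(\<lambda>l. cmod (b (k - l))) summable_on UNIV"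
    using sob_bound_summable[OF b s] summable_on_reindex_bij_betw[OF bij_diff, of "\<lambda>l. cmod (b l)" k] by simp
  have ib: "(\<Sum>\<^sub>\<infinity>l. cmod (b (k - l))) = (\<Sum>\<^sub>\<infinity>l. cmod (b l))"
    by (rule infsum_reindex_bij_betw[OF bij_diff])
  have eta0: "0 \<le> \<eta>" using eta[of 0] norm_ge_zero order_trans by blast
  have "cmod (transport a a k - transport b b k) \<le> infsum ?g UNIV"
  proof (rule norm_infsum_le)
    show "((\<lambda>l. transport_term a a k l - transport_term b b k l) has_sum (transport a a k - transport b b k)) UNIV"
      unfolding transport_def
      using has_sum_add[OF has_sum_infsum[OF transport_term_summable[OF a a s, of k UNIV]]
          has_sum_uminusI[OF has_sum_infsum[OF transport_term_summable[OF b b s, of k UNIV]]]] by simp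
    show "(?g has_sum infsum ?g UNIV) UNIV"
      by (intro has_sum_infsum summable_on_cmult_right summable_on_add sb sob_bound_summable[OF a s])
    fix l
    have "transport_term a a k l - transport_term b b k l = transport_term ?d a k l + transport_term b ?d k l"
      by (simp add: transport_term_def algebra_simps)
    also have "cmod \<dots> \<le> cmod (transport_term ?d a k l) + cmod (transport_term b ?d k l)"
      by (rule norm_triangle_ineq)
    also have "\<dots> \<le> bracket k * (cmod (?d (k - l)) * cmod (a l)) + bracket k * (cmod (b (k - l)) * cmod (?d l))"
      by (intro add_mono transport_term_le')
    also have "\<dots> \<le> bracket k * (\<eta> * cmod (a l)) + bracket k * (cmod (b (k - l)) * \<eta>)"
      by (intro add_mono mult_left_mono mult_right_mono eta) auto
    finally show "cmod (transport_term a a k l - transport_term b b k l) \<le> ?g l"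
      by (simp add: algebra_simps)
  qed
  also have "infsum ?g UNIV = bracket k * \<eta> * ((\<Sum>\<^sub>\<infinity>l. cmod (a l)) + (\<Sum>\<^sub>\<infinity>l. cmod (b l)))"
    using sob_bound_summable[OF a s] sb by (simp add: infsum_cmult_right' infsum_add ib)
  also have "\<dots> \<le> bracket k * \<eta> * (emb_const s UNIV * A + emb_const s UNIV * B)"
    using sob_bound_infsum[OF a s] sob_bound_infsum[OF b s] eta0
    by (intro mult_left_mono add_mono) auto
  finally show ?thesis by (simp add: algebra_simps)
qed

lemma transport_finite_support:
  assumes "finite F" "\<And>l. l \<notin> F \<Longrightarrow> b l = 0"
  shows "transport a b k = (\<Sum>l\<in>F. transport_term a b k l)"
proof -
  have "transport a b k = infsum (transport_term a b k) F"
    unfolding transport_def using assms by (intro infsum_cong_neutral) (auto simp: transport_term_def)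
  then show ?thesis using assms by simp
qed

lemma bij_uminus_freq: "bij_betw (uminus :: int^2 \<Rightarrow> int^2) UNIV UNIV"
  by (rule bij_betwI[where g = uminus]) auto

lemma transport_hermitian:
  assumes "hermitian a" "hermitian b"
  shows "hermitian (transport a b)"
  unfolding hermitian_def
proof
  fix k
  have eq: "transport_term a b (- k) (- l) = cnj (transport_term a b k l)" for l
  proof -
    have "a (- k - - l) = cnj (a (k - l))" "b (- l) = cnj (b l)"
      using assms by (auto simp: hermitian_def) (metis minus_diff_eq minus_diff_commute)
    moreover have "advect (- l) (- k - - l) = - advect l (k - l)"
      using advect_minus(1)[of l "k - l"] by simp
    ultimately show ?thesis by (simp add: transport_term_def)
  qed
  have "transport a b (- k) = (\<Sum>\<^sub>\<infinity>l. transport_term a b (- k) (- l))"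
    unfolding transport_def by (rule infsum_reindex_bij_betw[OF bij_uminus_freq, symmetric])
  also have "\<dots> = cnj (transport a b k)" by (simp add: eq transport_def)
  finally show "transport a b (- k) = cnj (transport a b k)" .
qed

lemma transport_zero: "transport a b 0 = 0"
  by (simp add: transport_def transport_term_def)

section \<open>Truncated Euler scheme\<close>

definition trunc :: "nat \<Rightarrow> (int^2 \<Rightarrow> complex) \<Rightarrow> int^2 \<Rightarrow> complex" where
  "trunc N c k = (if k \<in> freq_box N then c k else 0)"

text \<open>The explicit Euler method with step \<open>h\<close> for the system truncated to the box \<open>N\<close>. Discretising time and
  frequency simultaneously gives approximate solutions without solving any differential equation.\<close>

primrec euler :: "nat \<Rightarrow> real \<Rightarrow> (int^2 \<Rightarrow> complex) \<Rightarrow> nat \<Rightarrow> int^2 \<Rightarrow> complex" where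
  "euler N h c 0 = trunc N c"
| "euler N h c (Suc m) = trunc N (\<lambda>k. euler N h c m k + complex_of_real h * transport (euler N h c m) (euler N h c m) k)"

lemma euler_outside: "k \<notin> freq_box N \<Longrightarrow> euler N h c m k = 0"
  by (cases m) (auto simp: trunc_def)

lemma zero_in_freq_box [simp]: "0 \<in> freq_box N"
  by (simp add: freq_box_def)

lemma euler_zero: "euler N h c m 0 = c 0"
  by (induction m) (auto simp: trunc_def transport_zero)

lemma trunc_hermitian: "hermitian c \<Longrightarrow> hermitian (trunc N c)"
  by (auto simp: hermitian_def trunc_def)

lemma euler_hermitian: "hermitian c \<Longrightarrow> hermitian (euler N h c m)"
proof (induction m)
  case 0 then show ?case by (simp add: trunc_hermitian)
next
  case (Suc m)
  then have "hermitian (\<lambda>k. euler N h c m k + complex_of_real h * transport (euler N h c m) (euler N h c m) k)"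
    using transport_hermitian[of "euler N h c m" "euler N h c m"] by (simp add: hermitian_def)
  then show ?case by (simp add: trunc_hermitian)
qed

lemma trunc_sob_bound: "sob_bound s M c \<Longrightarrow> sob_bound s M (trunc N c)"
  by (erule sob_bound_cong_le) (auto simp: trunc_def)

definition box_energy :: "real \<Rightarrow> nat \<Rightarrow> (int^2 \<Rightarrow> complex) \<Rightarrow> real" where
  "box_energy s N c = (\<Sum>k\<in>freq_box N. (bracket k powr s * cmod (c k))\<^sup>2)"

lemma sob_bound_box_energy:
  assumes "\<And>k. k \<notin> freq_box N \<Longrightarrow> c k = 0" "box_energy s N c \<le> M\<^sup>2" "0 \<le> M"
  shows "sob_bound s M c"
  unfolding sob_bound_def
proof safe
  fix F :: "(int^2) set" assume "finite F"
  then have "(\<Sum>k\<in>F. (bracket k powr s * cmod (c k))\<^sup>2) = (\<Sum>k\<in>F \<inter> freq_box N. (bracket k powr s * cmod (c k))\<^sup>2)"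
    using assms(1) by (intro sum.mono_neutral_right) auto
  also have "\<dots> \<le> box_energy s N c"
    unfolding box_energy_def by (intro sum_mono2) auto
  finally show "(\<Sum>k\<in>F. (bracket k powr s * cmod (c k))\<^sup>2) \<le> M\<^sup>2" using assms(2) by linarith
qed fact

definition box_weight :: "real \<Rightarrow> nat \<Rightarrow> real" where
  "box_weight s N = (\<Sum>k\<in>freq_box N. (bracket k powr s)\<^sup>2)"

lemma box_weight_nonneg [simp]: "0 \<le> box_weight s N"
  by (simp add: box_weight_def sum_nonneg)

lemma cmod_add_sq:
  "(cmod (x + complex_of_real h * y))\<^sup>2 = (cmod x)\<^sup>2 + 2 * h * Re (cnj x * y) + h\<^sup>2 * (cmod y)\<^sup>2"
  unfolding cmod_power2 by (simp add: power2_eq_square algebra_simps)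

text \<open>The first-order term is the one in the a priori estimate. The second-order term of the
  explicit method has no cancellation and is bounded crudely, at the price of the total weight of
  the box.\<close>

lemma euler_step_energy:
  assumes s: "2 < s" and x: "sob_bound s R x" "hermitian x" "\<And>k. k \<notin> freq_box N \<Longrightarrow> x k = 0" and h: "0 \<le> h"
  shows "box_energy s N (\<lambda>k. x k + complex_of_real h * transport x x k)
    \<le> box_energy s N x + 2 * h * (energy_const s * R * R\<^sup>2)
       + h\<^sup>2 * ((R * (emb_const s UNIV * R))\<^sup>2 * box_weight s N)"
proof -
  define w where "w = (\<lambda>k. (bracket k powr s)\<^sup>2)"
  have eq: "(bracket k powr s * cmod (x k + complex_of_real h * transport x x k))\<^sup>2
     = (bracket k powr s * cmod (x k))\<^sup>2 + 2 * h * (w k * Re (cnj (x k) * transport x x k)) + h\<^sup>2 * (w k * (cmod (transport x x k))\<^sup>2)" for k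
    by (simp only: power_mult_distrib cmod_add_sq w_def distrib_left mult_ac)
  have "box_energy s N (\<lambda>k. x k + complex_of_real h * transport x x k)
    = box_energy s N x + 2 * h * (\<Sum>k\<in>freq_box N. w k * Re (cnj (x k) * transport x x k))
       + h\<^sup>2 * (\<Sum>k\<in>freq_box N. w k * (cmod (transport x x k))\<^sup>2)"
    unfolding box_energy_def eq by (simp only: sum.distrib sum_distrib_left)
  moreover have "(\<Sum>k\<in>freq_box N. w k * Re (cnj (x k) * transport x x k)) \<le> energy_const s * R * R\<^sup>2"
  proof -
    have "w k * Re (cnj (x k) * transport x x k)
       = Re (\<Sum>l\<in>freq_box N. complex_of_real ((bracket k powr s)\<^sup>2) * cnj (x k) * transport_term x x k l)" for k
    proof -
      have "(\<Sum>l\<in>freq_box N. complex_of_real ((bracket k powr s)\<^sup>2) * cnj (x k) * transport_term x x k l)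
        = complex_of_real (w k) * (cnj (x k) * transport x x k)"
        by (subst transport_finite_support[of "freq_box N" x x k, OF finite_freq_box x(3)])
           (simp_all add: w_def sum_distrib_left mult.assoc)
      then show ?thesis by simp
    qed
    then show ?thesis
      using energy_estimate[OF s finite_freq_box x(2,1,1), of N] unfolding Re_sum by simp
  qed
  moreover have "(\<Sum>k\<in>freq_box N. w k * (cmod (transport x x k))\<^sup>2) \<le> (R * (emb_const s UNIV * R))\<^sup>2 * box_weight s N"
  proof -
    have "(\<Sum>k\<in>freq_box N. w k * (cmod (transport x x k))\<^sup>2) \<le> (\<Sum>k\<in>freq_box N. w k * (R * (emb_const s UNIV * R))\<^sup>2)"
      by (intro sum_mono mult_left_mono power_mono cmod_trans_le x s) (auto simp: w_def)
    then show ?thesis by (simp add: box_weight_def w_def sum_distrib_left mult_ac)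
  qed
  ultimately show ?thesis
    using h by (simp add: mult_left_mono add_mono)
qed

context
  fixes s A :: real and c :: "int^2 \<Rightarrow> complex"
  assumes s: "2 < s" and c: "sob_bound s A c" "hermitian c"
begin

text \<open>The squared norm starts below \<open>A\<^sup>2\<close> and grows at rate at most \<open>growth\<close> while it stays below
  \<open>radius\<^sup>2 = A\<^sup>2 + 1\<close>; hence it stays there up to time \<open>lifespan\<close>. The time step \<open>mesh n\<close> is
  small enough for the second-order error of the \<open>n\<close>-th scheme to contribute at most 1 to \<open>growth\<close>.\<close>

definition "radius = sqrt (A\<^sup>2 + 1)"
definition "speed = radius * (emb_const s UNIV * radius)"
definition "growth = 2 * (energy_const s * radius * radius\<^sup>2) + 1"
definition "lifespan = 1 / growth"
definition "mesh n = 1 / ((real n + 1) * (1 + speed\<^sup>2 * box_weight s n))"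

lemma radius: "0 < radius" "radius\<^sup>2 = A\<^sup>2 + 1"
  by (auto simp: radius_def add_nonneg_pos)

lemma speed_nonneg: "0 \<le> speed"
  using radius by (simp add: speed_def)

lemma growth_pos: "0 < growth"
  using radius s by (simp add: growth_def energy_const_def add_nonneg_pos)

lemma lifespan_pos: "0 < lifespan"
  using growth_pos by (simp add: lifespan_def)

lemma mesh_aux: "1 \<le> 1 + speed\<^sup>2 * box_weight s n"
  by simp

lemma mesh_pos: "0 < mesh n"
  unfolding mesh_def using mesh_aux[of n] by (intro divide_pos_pos mult_pos_pos) linarith+

lemma mesh_le: "mesh n \<le> 1 / (real n + 1)"
  unfolding mesh_def using mult_left_mono[OF mesh_aux[of n], of "real n + 1"] by (intro frac_le) auto

lemma mesh_tendsto: "mesh \<longlonglongrightarrow> 0"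
proof (rule tendsto_sandwich[OF _ _ tendsto_const])
  show "(\<lambda>n. 1 / (real n + 1)) \<longlonglongrightarrow> 0"
    using LIMSEQ_inverse_real_of_nat by (simp add: inverse_eq_divide add.commute)
qed (auto intro!: always_eventually mesh_le less_imp_le[OF mesh_pos])

lemma mesh_small: "mesh n * (speed\<^sup>2 * box_weight s n) \<le> 1"
proof -
  let ?q = "speed\<^sup>2 * box_weight s n"
  have "?q \<le> (real n + 1) * (1 + ?q)"
    using mesh_aux[of n] mult_right_mono[of 1 "real n + 1" "1 + ?q"] by simp
  moreover have "0 < (real n + 1) * (1 + ?q)"
    using mesh_aux[of n] by (intro mult_pos_pos) linarith+
  ultimately have "?q / ((real n + 1) * (1 + ?q)) \<le> 1"
    by (simp only: divide_le_eq_1_pos)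
  then show ?thesis by (simp add: mesh_def)
qed

text \<open>Induction closes because, as long as the elapsed time is within \<open>lifespan\<close>, the bound for the
  current step keeps the coefficients inside \<open>radius\<close>, where the one-step estimate is available.\<close>

lemma euler_energy:
  assumes "real m * mesh n \<le> lifespan"
  shows "box_energy s n (euler n (mesh n) c m) \<le> A\<^sup>2 + real m * mesh n * growth"
  using assms
proof (induction m)
  case 0
  show ?case
    using sob_boundD[OF trunc_sob_bound[OF c(1), of n] finite_freq_box[of n]] by (simp add: box_energy_def)
next
  case (Suc m)
  let ?x = "euler n (mesh n) c m" and ?h = "mesh n"
  have m: "real m * ?h \<le> lifespan"
    using Suc.prems mesh_pos[of n] by (simp add: algebra_simps)
  then have IH: "box_energy s n ?x \<le> A\<^sup>2 + real m * ?h * growth" by (rule Suc.IH)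
  have "real m * ?h * growth \<le> 1"
    using m growth_pos by (simp add: lifespan_def field_simps)
  then have x: "sob_bound s radius ?x"
    using IH radius by (intro sob_bound_box_energy[where N = n]) (auto simp: euler_outside)
  have "box_energy s n (euler n ?h c (Suc m)) = box_energy s n (\<lambda>k. ?x k + complex_of_real ?h * transport ?x ?x k)"
    by (simp add: box_energy_def trunc_def)
  also have "\<dots> \<le> box_energy s n ?x + 2 * ?h * (energy_const s * radius * radius\<^sup>2) + ?h\<^sup>2 * (speed\<^sup>2 * box_weight s n)"
    unfolding speed_def using mesh_pos[of n]
    by (intro euler_step_energy s x euler_hermitian c) (auto simp: euler_outside)
  also have "?h\<^sup>2 * (speed\<^sup>2 * box_weight s n) = ?h * (?h * (speed\<^sup>2 * box_weight s n))"
    by (simp add: power2_eq_square)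
  also have "\<dots> \<le> ?h * 1"
    using mesh_small[of n] mesh_pos[of n] by (intro mult_left_mono) auto
  finally show ?case using IH by (simp add: growth_def algebra_simps)
qed

lemma euler_sob_bound:
  assumes "real m * mesh n \<le> lifespan"
  shows "sob_bound s radius (euler n (mesh n) c m)"
proof -
  have "real m * mesh n * growth \<le> 1"
    using assms growth_pos by (simp add: lifespan_def field_simps)
  then show ?thesis
    using euler_energy[OF assms] radius by (intro sob_bound_box_energy[where N = n]) (auto simp: euler_outside)
qed

lemma euler_diff_le:
  assumes "m \<le> m'" "real m' * mesh n \<le> lifespan"
  shows "cmod (euler n (mesh n) c m' k - euler n (mesh n) c m k) \<le> real (m' - m) * mesh n * speed"
  using assms
proof (induction m' rule: dec_induct)
  case base
  then show ?case by simp
next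
  case (step i)
  let ?x = "euler n (mesh n) c"
  have h: "0 < mesh n" by (rule mesh_pos)
  have i: "real i * mesh n \<le> lifespan"
    using step.prems h by (simp add: algebra_simps)
  have "cmod (?x (Suc i) k - ?x i k) \<le> mesh n * speed"
  proof (cases "k \<in> freq_box n")
    case True
    then have "cmod (?x (Suc i) k - ?x i k) = mesh n * cmod (transport (?x i) (?x i) k)"
      using h by (simp add: trunc_def norm_mult)
    also have "\<dots> \<le> mesh n * speed"
      unfolding speed_def using h
      by (intro mult_left_mono cmod_trans_le euler_sob_bound i s) auto
    finally show ?thesis .
  next
    case False
    then show ?thesis using h speed_nonneg by (simp add: euler_outside trunc_def)
  qed
  moreover have "cmod (?x i k - ?x m k) \<le> real (i - m) * mesh n * speed"
    using step.IH i by simp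
  ultimately have "cmod (?x (Suc i) k - ?x m k) \<le> mesh n * speed + real (i - m) * mesh n * speed"
    using norm_triangle_ineq[of "?x (Suc i) k - ?x i k" "?x i k - ?x m k"] by simp
  also have "\<dots> = real (Suc i - m) * mesh n * speed"
    using step.hyps by (simp add: Suc_diff_le algebra_simps)
  finally show ?case .
qed

text \<open>The increments of \<open>x\<close> between steps \<open>m\<close> and \<open>m'\<close> are transport terms at intermediate steps; each
  is close to the one at step \<open>m\<close> by the Lipschitz estimate. The quadratic remainder survives the limit and is what
  identifies the derivative there.\<close>

lemma euler_taylor:
  assumes "m \<le> m'" "real m' * mesh n \<le> lifespan" "k \<in> freq_box n"
  defines "x \<equiv> euler n (mesh n) c" and "d \<equiv> real (m' - m) * mesh n"
  shows "cmod (x m' k - x m k - complex_of_real d * transport (x m) (x m) k)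
     \<le> d * (bracket k * (d * speed) * emb_const s UNIV * (radius + radius))"
proof -
  let ?h = "mesh n"
  have h: "0 < ?h" by (rule mesh_pos)
  define B where "B = bracket k * (d * speed) * emb_const s UNIV * (radius + radius)"
  have "cmod (x i k - x m k - complex_of_real (real (i - m) * ?h) * transport (x m) (x m) k) \<le> real (i - m) * ?h * B"
    if "m \<le> i" "i \<le> m'" for i
    using that
  proof (induction i rule: dec_induct)
    case base
    then show ?case by simp
  next
    case (step i)
    let ?h = "mesh n"
    have T: "real j * ?h \<le> lifespan" if "j \<le> m'" for j
      using that assms(2) h by (meson of_nat_le_iff mult_right_mono order_trans less_imp_le)
    have "cmod (transport (x i) (x i) k - transport (x m) (x m) k) \<le> B"
      unfolding B_def x_def
    proof (intro transport_diff_le euler_sob_bound T s)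
      fix j
      have "cmod (euler n ?h c i j - euler n ?h c m j) \<le> real (i - m) * ?h * speed"
        using step.hyps step.prems by (intro euler_diff_le T) auto
      also have "\<dots> \<le> d * speed"
        unfolding d_def using step.prems h speed_nonneg by (intro mult_right_mono) auto
      finally show "cmod (euler n ?h c i j - euler n ?h c m j) \<le> d * speed" .
    qed (use step assms in auto)
    then have 1: "cmod (complex_of_real ?h * (transport (x i) (x i) k - transport (x m) (x m) k)) \<le> ?h * B"
      unfolding norm_mult using h by (intro mult_mono) auto
    have 2: "cmod (x i k - x m k - complex_of_real (real (i - m) * ?h) * transport (x m) (x m) k) \<le> real (i - m) * ?h * B"
      using step.IH step.prems by simp
    have 3: "x (Suc i) k - x m k - complex_of_real (real (Suc i - m) * ?h) * transport (x m) (x m) k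
      = (x i k - x m k - complex_of_real (real (i - m) * ?h) * transport (x m) (x m) k)
        + complex_of_real ?h * (transport (x i) (x i) k - transport (x m) (x m) k)"
      using assms(3) step.hyps by (simp add: x_def trunc_def Suc_diff_le algebra_simps)
    have "cmod (x (Suc i) k - x m k - complex_of_real (real (Suc i - m) * ?h) * transport (x m) (x m) k)
      \<le> real (i - m) * ?h * B + ?h * B"
      unfolding 3 by (rule order_trans[OF norm_triangle_ineq add_mono[OF 2 1]])
    also have "\<dots> = real (Suc i - m) * ?h * B"
      using step.hyps by (simp add: Suc_diff_le algebra_simps)
    finally show ?case .
  qed
  from this[of m'] assms(1) show ?thesis by (simp add: d_def B_def)
qed

definition "approx n t = euler n (mesh n) c (nat \<lfloor>t / mesh n\<rfloor>)"

lemma floor_time: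
  assumes "0 \<le> t"
  shows "real (nat \<lfloor>t / mesh n\<rfloor>) * mesh n \<le> t" "t - mesh n \<le> real (nat \<lfloor>t / mesh n\<rfloor>) * mesh n"
proof -
  let ?m = "real (nat \<lfloor>t / mesh n\<rfloor>)"
  have h: "0 < mesh n" by (rule mesh_pos)
  have m: "?m = real_of_int \<lfloor>t / mesh n\<rfloor>" using assms h by simp
  have "?m \<le> t / mesh n" "t / mesh n < ?m + 1" unfolding m by linarith+
  then show "?m * mesh n \<le> t" "t - mesh n \<le> ?m * mesh n" using h by (auto simp: field_simps)
qed

lemma approx_sob_bound: "t \<in> {0..lifespan} \<Longrightarrow> sob_bound s radius (approx n t)"
  unfolding approx_def using floor_time(1)[of t n] by (intro euler_sob_bound) auto

lemma approx_time:
  fixes n :: nat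
  assumes "0 \<le> t" "t \<le> t'" "t' \<le> lifespan"
  defines "d \<equiv> real (nat \<lfloor>t' / mesh n\<rfloor> - nat \<lfloor>t / mesh n\<rfloor>) * mesh n"
  shows "cmod (approx n t' k - approx n t k) \<le> d * speed"
    and "k \<in> freq_box n \<Longrightarrow> cmod (approx n t' k - approx n t k - complex_of_real d * transport (approx n t) (approx n t) k)
     \<le> d * (bracket k * (d * speed) * emb_const s UNIV * (radius + radius))"
    and "\<bar>d - (t' - t)\<bar> \<le> mesh n" "0 \<le> d"
proof -
  have le: "nat \<lfloor>t / mesh n\<rfloor> \<le> nat \<lfloor>t' / mesh n\<rfloor>"
    using assms mesh_pos[of n] by (intro nat_mono floor_mono divide_right_mono) auto
  have T: "real (nat \<lfloor>t' / mesh n\<rfloor>) * mesh n \<le> lifespan"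
    using floor_time(1)[of t' n] assms by simp
  show "cmod (approx n t' k - approx n t k) \<le> d * speed"
    unfolding approx_def d_def by (rule euler_diff_le[OF le T])
  show "k \<in> freq_box n \<Longrightarrow> cmod (approx n t' k - approx n t k - complex_of_real d * transport (approx n t) (approx n t) k)
     \<le> d * (bracket k * (d * speed) * emb_const s UNIV * (radius + radius))"
    unfolding approx_def d_def by (rule euler_taylor[OF le T])
  have "d = real (nat \<lfloor>t' / mesh n\<rfloor>) * mesh n - real (nat \<lfloor>t / mesh n\<rfloor>) * mesh n"
    unfolding d_def using le by (simp add: of_nat_diff left_diff_distrib)
  then show "\<bar>d - (t' - t)\<bar> \<le> mesh n"
    using floor_time[of t n] floor_time[of t' n] assms by simp
  show "0 \<le> d" unfolding d_def using mesh_pos[of n] by simp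
qed

lemma approx_equicont:
  assumes "t \<in> {0..lifespan}" "t' \<in> {0..lifespan}"
  shows "cmod (approx n t' k - approx n t k) \<le> (\<bar>t' - t\<bar> + mesh n) * speed"
proof -
  have *: "cmod (approx n t' k - approx n t k) \<le> (\<bar>t' - t\<bar> + mesh n) * speed"
    if "0 \<le> t" "t \<le> t'" "t' \<le> lifespan" for t t'
  proof -
    let ?d = "real (nat \<lfloor>t' / mesh n\<rfloor> - nat \<lfloor>t / mesh n\<rfloor>) * mesh n"
    have "cmod (approx n t' k - approx n t k) \<le> ?d * speed" by (rule approx_time(1)[OF that])
    also have "?d \<le> \<bar>t' - t\<bar> + mesh n" using approx_time(3)[OF that, of n] that by linarith
    then have "?d * speed \<le> (\<bar>t' - t\<bar> + mesh n) * speed" by (rule mult_right_mono[OF _ speed_nonneg])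
    finally show ?thesis .
  qed
  show ?thesis
    using *[of t t'] *[of t' t] assms by (cases "t \<le> t'") (auto simp: abs_minus_commute norm_minus_commute)
qed

text \<open>A diagonal sequence converges at the countably many pairs of a rational time and a
  frequency. The approximations are equicontinuous in time up to an error of size \<open>mesh n\<close>, so they converge at
  all times.\<close>

lemma approx_subsequence:
  obtains r :: "nat \<Rightarrow> nat" where "strict_mono r"
    "\<And>t k. t \<in> {0..lifespan} \<Longrightarrow> convergent (\<lambda>n. approx (r n) t k)"
proof -
  let ?S = "(\<rat> \<inter> {0..lifespan}) \<times> (UNIV :: (int^2) set)"
  have cnt: "countable (UNIV :: (int^2) set)"
    using countable_image[of "UNIV :: (int \<times> int) set" "\<lambda>(a, b). vector [a, b] :: int^2"] vec2_bij
    by (simp add: bij_betw_def)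
  have "countable ?S"
    by (intro countable_SIGMA cnt countable_subset[OF _ countable_rat]) auto
  moreover have "norm (case x of (t, k) \<Rightarrow> approx n t k) \<le> radius" if "x \<in> ?S" for n x
    using that sob_bound_cmod[OF approx_sob_bound] s by auto
  ultimately obtain r :: "nat \<Rightarrow> nat" where r: "strict_mono r"
    and lim: "\<And>x. x \<in> ?S \<Longrightarrow> \<exists>l. (\<lambda>n. case x of (t, k) \<Rightarrow> approx (r n) t k) \<longlonglongrightarrow> l"
    by (rule function_convergent_subsequence[where f = "\<lambda>n x. case x of (t, k) \<Rightarrow> approx n t k"])
       (assumption | rule that)+
  have "convergent (\<lambda>n. approx (r n) t k)" if t: "t \<in> {0..lifespan}" for t k
  proof -
    have "Cauchy (\<lambda>n. approx (r n) t k)"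
    proof (rule metric_CauchyI)
      fix e :: real assume e: "0 < e"
      \<comment> \<open>Half of it is spent on the distance to a rational time, half on the mesh; the 1 only avoids division by zero.\<close>
      define \<delta> where "\<delta> = e / (4 * (speed + 1))"
      have \<delta>: "0 < \<delta>" "\<delta> * speed \<le> e / 4"
        using e speed_nonneg by (auto simp: \<delta>_def field_simps)
      obtain q where q: "q \<in> \<rat>" "q \<in> {0..lifespan}" "\<bar>t - q\<bar> \<le> \<delta> / 2"
      proof (cases "t = 0")
        case True
        then show ?thesis using that[of 0] \<delta> t by auto
      next
        case False
        then have "max 0 (t - \<delta> / 2) < t" using t \<delta> by auto
        then obtain q where "q \<in> \<rat>" "max 0 (t - \<delta> / 2) < q" "q < t"
          using Rats_dense_in_real by blast
        then show ?thesis using that[of q] t by auto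
      qed
      have "\<exists>l. (\<lambda>n. approx (r n) q k) \<longlonglongrightarrow> l" using lim[of "(q, k)"] q by auto
      then have "Cauchy (\<lambda>n. approx (r n) q k)" using LIMSEQ_imp_Cauchy by blast
      then obtain M where M: "\<And>m n. m \<ge> M \<Longrightarrow> n \<ge> M \<Longrightarrow> dist (approx (r m) q k) (approx (r n) q k) < e / 4"
        using e metric_CauchyD[of _ "e / 4"] by (metis zero_less_divide_iff zero_less_numeral)
      have "\<forall>\<^sub>F n in sequentially. mesh (r n) < \<delta> / 2"
        using LIMSEQ_subseq_LIMSEQ[OF mesh_tendsto r] \<delta>(1) unfolding o_def
        by (rule order_tendstoD(2)[OF _ half_gt_zero])
      then obtain M' where M': "\<And>n. n \<ge> M' \<Longrightarrow> mesh (r n) < \<delta> / 2"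
        by (auto simp: eventually_sequentially)
      have near: "dist (approx (r n) t k) (approx (r n) q k) \<le> e / 4" if "n \<ge> M'" for n
      proof -
        have "dist (approx (r n) t k) (approx (r n) q k) \<le> (\<bar>t - q\<bar> + mesh (r n)) * speed"
          using approx_equicont[OF q(2) t] by (simp add: dist_norm)
        also have "\<dots> \<le> \<delta> * speed"
          using q M'[OF that] speed_nonneg by (intro mult_right_mono) auto
        finally show ?thesis using \<delta> by linarith
      qed
      have "dist (approx (r m) t k) (approx (r n) t k) < e" if "m \<ge> max M M'" "n \<ge> max M M'" for m n
        using near[of m] near[of n] M[of m n] that e
          dist_triangle[of "approx (r m) t k" "approx (r n) t k" "approx (r m) q k"]
          dist_triangle[of "approx (r m) q k" "approx (r n) t k" "approx (r n) q k"]
        by (simp add: dist_commute)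
      then show "\<exists>M. \<forall>m\<ge>M. \<forall>n\<ge>M. dist (approx (r m) t k) (approx (r n) t k) < e" by blast
    qed
    then show ?thesis by (rule Cauchy_convergent)
  qed
  with r show ?thesis by (rule that)
qed

end

section \<open>Passage to the limit\<close>

lemma sob_bound_limit:
  assumes "\<And>n. sob_bound s R (x n)" "\<And>k. (\<lambda>n. x n k) \<longlonglongrightarrow> y k"
  shows "sob_bound s R y"
  unfolding sob_bound_def
proof safe
  show "0 \<le> R" using assms(1) sob_bound_nonneg by blast
  fix F :: "(int^2) set" assume F: "finite F"
  have "(\<lambda>n. \<Sum>k\<in>F. (bracket k powr s * cmod (x n k))\<^sup>2) \<longlonglongrightarrow> (\<Sum>k\<in>F. (bracket k powr s * cmod (y k))\<^sup>2)"
    by (intro tendsto_intros assms)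
  then show "(\<Sum>k\<in>F. (bracket k powr s * cmod (y k))\<^sup>2) \<le> R\<^sup>2"
    by (rule LIMSEQ_le_const2) (use sob_boundD[OF assms(1) F] in auto)
qed

text \<open>High frequencies are uniformly small by the common \<open>H\<^sup>s\<close> bound, and only finitely many low
  ones remain.\<close>

lemma sob_bound_uniform_convergence:
  assumes s: "0 < s" and x: "\<And>n. sob_bound s R (x n)" and lim: "\<And>k. (\<lambda>n. x n k) \<longlonglongrightarrow> y k" and e: "0 < e"
  shows "\<forall>\<^sub>F n in sequentially. \<forall>k. cmod (x n k - y k) \<le> e"
proof -
  have y: "sob_bound s R y" using sob_bound_limit[OF x lim] .
  have "((\<lambda>t::real. 2 * R * t powr (- s)) \<longlongrightarrow> 2 * R * 0) at_top"
    using s by (intro tendsto_intros tendsto_neg_powr filterlim_ident) auto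
  then have "\<forall>\<^sub>F t::real in at_top. 2 * R * t powr (- s) < e"
    using e by (intro order_tendstoD(2)) auto
  then obtain N0 where N0: "\<And>t. t \<ge> N0 \<Longrightarrow> 2 * R * t powr (- s) < e"
    unfolding eventually_at_top_linorder by blast
  define N where "N = nat \<lceil>N0\<rceil>"
  have outside: "cmod (x n k - y k) \<le> e" if "k \<notin> freq_box N" for n k
  proof -
    have "bracket k \<ge> N0"
    proof -
      obtain i where i: "\<bar>k $ i\<bar> > int N" using \<open>k \<notin> freq_box N\<close> by (auto simp: freq_box_def not_le)
      have "real N \<le> \<bar>real_of_int (k $ i)\<bar>" using i by linarith
      also have "\<dots> \<le> sqrt (freq_sq k)"
      proof -
        have "(real_of_int (k $ i))\<^sup>2 \<le> freq_sq k"
          using exhaust_2[of i] by (auto simp: freq_sq_def)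
        then show ?thesis by (intro real_le_rsqrt) simp
      qed
      also have "\<dots> \<le> bracket k" by (rule freq_le_bracket)
      finally show ?thesis unfolding N_def by linarith
    qed
    then have small: "2 * R * bracket k powr (- s) < e" by (rule N0)
    have le: "cmod (z k) \<le> R * bracket k powr (- s)" if "sob_bound s R z" for z
      using sob_bound_pointwise[OF that, of k] bracket_pos[of k]
      by (simp add: powr_minus_divide pos_le_divide_eq mult.commute)
    have "cmod (x n k - y k) \<le> cmod (x n k) + cmod (y k)" by (rule norm_triangle_ineq4)
    then show ?thesis using le[OF x[of n]] le[OF y] small by linarith
  qed
  have "\<forall>\<^sub>F n in sequentially. \<forall>k\<in>freq_box N. cmod (x n k - y k) \<le> e"
  proof (intro eventually_ball_finite finite_freq_box ballI)
    fix k
    show "\<forall>\<^sub>F n in sequentially. cmod (x n k - y k) \<le> e"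
      using tendstoD[OF lim[of k] e] by (auto simp: dist_norm elim: eventually_mono)
  qed
  then show ?thesis by eventually_elim (use outside in blast)
qed

lemma transport_tendsto:
  assumes s: "2 < s" and x: "\<And>n. sob_bound s R (x n)" and lim: "\<And>k. (\<lambda>n. x n k) \<longlonglongrightarrow> y k"
  shows "(\<lambda>n. transport (x n) (x n) k) \<longlonglongrightarrow> transport y y k"
proof (rule tendstoI)
  fix e :: real assume e: "0 < e"
  have y: "sob_bound s R y" using sob_bound_limit[OF x lim] .
  define C where "C = bracket k * emb_const s UNIV * (R + R) + 1"
  have "0 \<le> R" using x sob_bound_nonneg by blast
  then have C: "0 < C" by (simp add: C_def add_nonneg_pos)
  have "\<forall>\<^sub>F n in sequentially. \<forall>j. cmod (x n j - y j) \<le> e / (2 * C)"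
    using s e C by (intro sob_bound_uniform_convergence[OF _ x lim]) auto
  then show "\<forall>\<^sub>F n in sequentially. dist (transport (x n) (x n) k) (transport y y k) < e"
  proof eventually_elim
    case (elim n)
    have "dist (transport (x n) (x n) k) (transport y y k) \<le> bracket k * (e / (2 * C)) * emb_const s UNIV * (R + R)"
      unfolding dist_norm using elim by (intro transport_diff_le x y s) auto
    also have "\<dots> = (e / (2 * C)) * (C - 1)" by (simp add: C_def)
    also have "\<dots> \<le> (e / (2 * C)) * C" using e C by (intro mult_left_mono) auto
    also have "\<dots> < e" using e C by simp
    finally show ?case .
  qed
qed

lemma quadratic_remainder_imp_derivative:
  fixes f :: "real \<Rightarrow> complex"
  assumes "\<And>t'. t' \<in> S \<Longrightarrow> cmod (f t' - f t - complex_of_real (t' - t) * D) \<le> C * (t' - t)\<^sup>2"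
  shows "(f has_vector_derivative D) (at t within S)"
  unfolding has_vector_derivative_def has_derivative_within_alt
proof (intro conjI allI impI)
  show "bounded_linear (\<lambda>h. h *\<^sub>R D)" by (rule bounded_linear_scaleR_left)
  fix e :: real assume e: "0 < e"
  define C' where "C' = \<bar>C\<bar> + 1"
  show "\<exists>d>0. \<forall>y\<in>S. norm (y - t) < d \<longrightarrow> norm (f y - f t - (y - t) *\<^sub>R D) \<le> e * norm (y - t)"
  proof (intro exI[of _ "e / C'"] conjI ballI impI)
    show "0 < e / C'" using e by (simp add: C'_def)
    fix y assume y: "y \<in> S" "norm (y - t) < e / C'"
    have "norm (f y - f t - (y - t) *\<^sub>R D) \<le> C * (y - t)\<^sup>2"
      using assms[OF y(1)] by (simp add: scaleR_conv_of_real)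
    also have "\<dots> \<le> C' * (y - t)\<^sup>2" by (intro mult_right_mono) (auto simp: C'_def)
    also have "\<dots> = (C' * \<bar>y - t\<bar>) * \<bar>y - t\<bar>" by (simp add: power2_eq_square)
    also have "\<dots> \<le> e * \<bar>y - t\<bar>"
      using y by (intro mult_right_mono) (auto simp: C'_def field_simps)
    finally show "norm (f y - f t - (y - t) *\<^sub>R D) \<le> e * norm (y - t)" by simp
  qed
qed

text \<open>Local existence for the system of Fourier coefficients: every bound of the Euler scheme
  passes to the pointwise limit, and the quadratic remainder shows that the limit is differentiable in time.\<close>

theorem fourier_transport_local_solution:
  assumes s: "2 < s" and c0: "sob_bound s A c0" "hermitian c0" "c0 0 = 0"
  obtains T R L and c :: "real \<Rightarrow> int^2 \<Rightarrow> complex" where "0 < T" "c 0 = c0"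
    "\<And>t. t \<in> {0..T} \<Longrightarrow> sob_bound s R (c t)"
    "\<And>t. t \<in> {0..T} \<Longrightarrow> hermitian (c t)"
    "\<And>t. t \<in> {0..T} \<Longrightarrow> c t 0 = 0"
    "\<And>t t' k. t \<in> {0..T} \<Longrightarrow> t' \<in> {0..T} \<Longrightarrow> cmod (c t' k - c t k) \<le> L * \<bar>t' - t\<bar>"
    "\<And>t k. t \<in> {0..T} \<Longrightarrow> ((\<lambda>\<tau>. c \<tau> k) has_vector_derivative transport (c t) (c t) k) (at t within {0..T})"
proof -
  note c = c0(1,2)
  define T where "T = lifespan s A"
  define R where "R = radius A"
  define L where "L = speed s A"
  obtain r :: "nat \<Rightarrow> nat" where r: "strict_mono r"
    and conv: "\<And>t k. t \<in> {0..T} \<Longrightarrow> convergent (\<lambda>n. approx s A c0 (r n) t k)"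
    unfolding T_def using approx_subsequence[OF s c] by blast
  define x where "x n t = approx s A c0 (r n) t" for n t
  define c where "c t k = lim (\<lambda>n. x n t k)" for t k
  have lim: "(\<lambda>n. x n t k) \<longlonglongrightarrow> c t k" if "t \<in> {0..T}" for t k
    using conv[OF that] unfolding c_def x_def by (simp add: convergent_LIMSEQ_iff)
  have x: "sob_bound s R (x n t)" if "t \<in> {0..T}" for n t
    using approx_sob_bound[OF s c0(1,2)] that by (simp add: x_def R_def T_def)
  have T: "0 < T" using lifespan_pos[OF s c0(1,2)] by (simp add: T_def)
  have L: "0 \<le> L" using speed_nonneg[OF s c0(1,2)] by (simp add: L_def)
  have cb: "sob_bound s R (c t)" if "t \<in> {0..T}" for t
    using sob_bound_limit[OF x[OF that] lim[OF that]] .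
  have step0: "(\<lambda>n. mesh s A (r n)) \<longlonglongrightarrow> 0"
    using LIMSEQ_subseq_LIMSEQ[OF mesh_tendsto[OF s c0(1,2)] r] by (simp add: o_def)
  have lip: "cmod (c t' k - c t k) \<le> L * \<bar>t' - t\<bar>" if t: "t \<in> {0..T}" "t' \<in> {0..T}" for t t' k
  proof (rule tendsto_le)
    show "(\<lambda>n. cmod (x n t' k - x n t k)) \<longlonglongrightarrow> cmod (c t' k - c t k)"
      by (intro tendsto_intros lim t)
    show "(\<lambda>n. (\<bar>t' - t\<bar> + mesh s A (r n)) * L) \<longlonglongrightarrow> L * \<bar>t' - t\<bar>"
      by (rule tendsto_eq_intros step0 refl)+ simp
    show "\<forall>\<^sub>F n in sequentially. cmod (x n t' k - x n t k) \<le> (\<bar>t' - t\<bar> + mesh s A (r n)) * L"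
      using approx_equicont[OF s c0(1,2)] t by (auto simp: x_def L_def T_def)
  qed simp
  define G where "G k = bracket k * L * emb_const s UNIV * (R + R)" for k
  have taylor: "cmod (c t' k - c t k - complex_of_real (t' - t) * transport (c t) (c t) k) \<le> G k * (t' - t)\<^sup>2"
    if t: "0 \<le> t" "t \<le> t'" "t' \<le> T" for t t' k
  proof -
    define d where "d n = real (nat \<lfloor>t' / mesh s A (r n)\<rfloor> - nat \<lfloor>t / mesh s A (r n)\<rfloor>) * mesh s A (r n)" for n
    have d: "d \<longlonglongrightarrow> t' - t"
    proof -
      have "(\<lambda>n. d n - (t' - t)) \<longlonglongrightarrow> 0"
        by (rule Lim_null_comparison[OF _ step0])
           (use approx_time(3)[OF s c0(1,2) t[unfolded T_def]] in \<open>auto simp: d_def\<close>)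
      then show ?thesis by (simp add: LIM_zero_iff)
    qed
    have tt: "t \<in> {0..T}" "t' \<in> {0..T}" using t by auto
    show ?thesis
    proof (rule tendsto_le)
      show "(\<lambda>n. cmod (x n t' k - x n t k - complex_of_real (d n) * transport (x n t) (x n t) k))
          \<longlonglongrightarrow> cmod (c t' k - c t k - complex_of_real (t' - t) * transport (c t) (c t) k)"
        by (intro tendsto_intros lim tt d transport_tendsto[OF s x[OF tt(1)] lim[OF tt(1)]])
      show "(\<lambda>n. d n * (bracket k * (d n * L) * emb_const s UNIV * (R + R))) \<longlonglongrightarrow> G k * (t' - t)\<^sup>2"
        by (rule tendsto_eq_intros d refl)+ (simp add: G_def power2_eq_square)
      have "\<forall>\<^sub>F n in sequentially. k \<in> freq_box (r n)"
        using eventually_compose_filterlim[OF freq_box_eventually filterlim_subseq[OF r]] .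
      then show "\<forall>\<^sub>F n in sequentially. cmod (x n t' k - x n t k - complex_of_real (d n) * transport (x n t) (x n t) k)
          \<le> d n * (bracket k * (d n * L) * emb_const s UNIV * (R + R))"
        by eventually_elim
           (use approx_time(2)[OF s c0(1,2) t[unfolded T_def]] in \<open>auto simp: d_def x_def L_def R_def\<close>)
    qed simp
  qed
  have deriv: "((\<lambda>\<tau>. c \<tau> k) has_vector_derivative transport (c t) (c t) k) (at t within {0..T})" if t: "t \<in> {0..T}" for t k
  proof (rule quadratic_remainder_imp_derivative[where C = "2 * G k"])
    fix t' assume t': "t' \<in> {0..T}"
    have G: "0 \<le> G k" using L sob_bound_nonneg[OF cb[OF t]] by (simp add: G_def)
    show "cmod (c t' k - c t k - complex_of_real (t' - t) * transport (c t) (c t) k) \<le> 2 * G k * (t' - t)\<^sup>2"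
    proof (cases "t \<le> t'")
      case True
      then show ?thesis using taylor[of t t' k] t t' G zero_le_power2[of "t' - t"]
        by (smt (verit) atLeastAtMost_iff mult_right_mono)
    next
      case False
      have 1: "cmod (c t k - c t' k - complex_of_real (t - t') * transport (c t') (c t') k) \<le> G k * (t - t')\<^sup>2"
        using False t t' by (intro taylor) auto
      have "cmod (transport (c t') (c t') k - transport (c t) (c t) k) \<le> bracket k * (L * \<bar>t' - t\<bar>) * emb_const s UNIV * (R + R)"
        by (intro transport_diff_le cb t t' s lip)
      also have "\<dots> = G k * \<bar>t' - t\<bar>" by (simp add: G_def)
      finally have 0: "cmod (transport (c t') (c t') k - transport (c t) (c t) k) \<le> G k * \<bar>t' - t\<bar>" .
      have 2: "cmod (complex_of_real (t - t') * (transport (c t') (c t') k - transport (c t) (c t) k)) \<le> G k * (t - t')\<^sup>2"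
      proof -
        have "cmod (complex_of_real (t - t') * (transport (c t') (c t') k - transport (c t) (c t) k))
            \<le> \<bar>t - t'\<bar> * (G k * \<bar>t' - t\<bar>)"
          unfolding norm_mult norm_of_real by (rule mult_left_mono[OF 0]) simp
        also have "\<dots> = G k * (\<bar>t - t'\<bar> * \<bar>t - t'\<bar>)" by (simp only: abs_minus_commute[of t' t] mult_ac)
        also have "\<dots> = G k * (t - t')\<^sup>2" by (simp only: abs_mult_self_eq power2_eq_square)
        finally show ?thesis .
      qed
      have "c t' k - c t k - complex_of_real (t' - t) * transport (c t) (c t) k
        = - ((c t k - c t' k - complex_of_real (t - t') * transport (c t') (c t') k)
            + complex_of_real (t - t') * (transport (c t') (c t') k - transport (c t) (c t) k))"
        by (simp add: algebra_simps)
      then have "cmod (c t' k - c t k - complex_of_real (t' - t) * transport (c t) (c t) k)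
         \<le> G k * (t - t')\<^sup>2 + G k * (t - t')\<^sup>2"
        using norm_triangle_ineq 1 2 by (smt (verit) norm_minus_cancel)
      then show ?thesis by (simp add: power2_commute)
    qed
  qed
  have init: "c 0 = c0"
  proof
    fix k
    have "\<forall>\<^sub>F n in sequentially. k \<in> freq_box (r n)"
      using eventually_compose_filterlim[OF freq_box_eventually filterlim_subseq[OF r]] .
    then have "\<forall>\<^sub>F n in sequentially. x n 0 k = c0 k"
      by eventually_elim (simp add: x_def approx_def[OF s c0(1,2)] trunc_def)
    then have "(\<lambda>n. x n 0 k) \<longlonglongrightarrow> c0 k" by (rule tendsto_eventually)
    then show "c 0 k = c0 k" using lim[of 0 k] T LIMSEQ_unique by auto
  qed
  have herm: "hermitian (c t)" if t: "t \<in> {0..T}" for t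
    unfolding hermitian_def
  proof
    fix k
    have "x n t (- k) = cnj (x n t k)" for n
      using euler_hermitian[OF c0(2)] by (simp add: x_def approx_def[OF s c0(1,2)] hermitian_def)
    then have "(\<lambda>n. cnj (x n t k)) \<longlonglongrightarrow> c t (- k)" using lim[OF t, of "- k"] by simp
    moreover have "(\<lambda>n. cnj (x n t k)) \<longlonglongrightarrow> cnj (c t k)" by (intro tendsto_intros lim t)
    ultimately show "c t (- k) = cnj (c t k)" by (rule LIMSEQ_unique)
  qed
  have zero: "c t 0 = 0" if t: "t \<in> {0..T}" for t
  proof -
    have "x n t 0 = 0" for n by (simp add: x_def approx_def[OF s c0(1,2)] euler_zero c0)
    then show ?thesis using lim[OF t, of 0] by (simp add: LIMSEQ_const_iff)
  qed
  show ?thesis using that[OF T init cb herm zero lip deriv] .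
qed

section \<open>Plane waves on the torus\<close>

definition phase :: "int^2 \<Rightarrow> real^2 \<Rightarrow> real" where
  "phase k x = (\<Sum>i\<in>UNIV. real_of_int (k $ i) * x $ i)"

definition wave :: "int^2 \<Rightarrow> real^2 \<Rightarrow> complex" where
  "wave k x = cis (phase k x)"

lemma phase_add: "phase (k + l) x = phase k x + phase l x"
  by (simp add: phase_def distrib_right sum.distrib)

lemma phase_add_right: "phase k (x + y) = phase k x + phase k y"
  by (simp add: phase_def distrib_left sum.distrib)

lemma phase_minus: "phase (- k) x = - phase k x"
  by (simp add: phase_def sum_negf)

lemma phase_axis: "phase k (axis i a) = real_of_int (k $ i) * a"
  using exhaust_2[of i] by (auto simp: phase_def sum_2 axis_def)

lemma bounded_linear_phase: "bounded_linear (phase k)"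
  unfolding phase_def by (intro bounded_linear_sum bounded_linear_const_mult bounded_linear_vec_nth)

lemma wave_add: "wave (k + l) x = wave k x * wave l x"
  by (simp add: wave_def phase_add cis_mult)

lemma wave_0 [simp]: "wave 0 x = 1"
  by (simp add: wave_def phase_def)

lemma wave_minus: "wave (- k) x = cnj (wave k x)"
  by (simp add: wave_def phase_minus cis_cnj)

lemma wave_diff: "wave (k - l) x = wave k x * cnj (wave l x)"
  using wave_add[of k "- l" x] by (simp add: wave_minus)

lemma norm_wave [simp]: "cmod (wave k x) = 1"
  by (simp add: wave_def)

lemma wave_periodic: "wave k (x + axis i (2 * pi)) = wave k x"
proof -
  have "cis (real_of_int (k $ i) * (2 * pi)) = 1"
    using cis_multiple_2pi[of "real_of_int (k $ i)"] by (simp add: mult_ac)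
  then show ?thesis by (simp add: wave_def phase_add_right phase_axis flip: cis_mult)
qed

lemma continuous_on_wave [continuous_intros]:
  assumes "continuous_on S f"
  shows "continuous_on S (\<lambda>x. wave k (f x))"
  unfolding wave_def
  by (intro continuous_intros bounded_linear.continuous_on[OF bounded_linear_phase] assms)

lemma has_derivative_wave:
  "((\<lambda>x. wave k x) has_derivative (\<lambda>\<xi>. complex_of_real (phase k \<xi>) * (\<i> * wave k x))) (at x within S)"
proof -
  have "(phase k has_derivative phase k) (at x within S)"
    by (rule bounded_linear_imp_has_derivative[OF bounded_linear_phase])
  from has_derivative_cis[OF this] show ?thesis
    unfolding wave_def by (rule has_derivative_eq_rhs) (auto simp: fun_eq_iff scaleR_conv_of_real mult_ac)
qed

text \<open>Fubini for products of functions of single coordinates, obtained by viewing Lebesgue measure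
  on a Euclidean space as a finite product measure.\<close>

lemma lborel_integral_prod_coordinates:
  fixes g :: "'a::euclidean_space \<Rightarrow> real \<Rightarrow> complex"
  assumes g: "\<And>b. b \<in> Basis \<Longrightarrow> integrable lborel (g b)"
  shows "(\<integral>x. (\<Prod>b\<in>Basis. g b (x \<bullet> b)) \<partial>lborel) = (\<Prod>b\<in>Basis. \<integral>t. g b t \<partial>lborel)"
proof -
  interpret product_sigma_finite "\<lambda>_::'a. lborel :: real measure"
    by standard
  have [measurable]: "g b \<in> borel_measurable borel" if "b \<in> Basis" for b
    using borel_measurable_integrable[OF g[OF that]] by simp
  have "(\<integral>x. (\<Prod>b\<in>Basis. g b (x \<bullet> b)) \<partial>lborel)
     = (\<integral>f. (\<Prod>b\<in>Basis. g b ((\<Sum>b\<in>Basis. f b *\<^sub>R b) \<bullet> b)) \<partial>(\<Pi>\<^sub>M b\<in>(Basis::'a set). lborel))"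
    by (subst lborel_eq, subst integral_distr) (auto intro!: borel_measurable_prod)
  also have "\<dots> = (\<integral>f. (\<Prod>b\<in>Basis. g b (f b)) \<partial>(\<Pi>\<^sub>M b\<in>(Basis::'a set). lborel))"
    by (intro Bochner_Integration.integral_cong refl prod.cong) simp
  also have "\<dots> = (\<Prod>b\<in>Basis. \<integral>t. g b t \<partial>lborel)"
    by (intro product_integral_prod g) auto
  finally show ?thesis .
qed

lemma cis_integral:
  fixes n :: int
  shows "set_integrable lborel {0..2 * pi} (\<lambda>t. cis (real_of_int n * t))"
    and "(LINT t:{0..2 * pi}|lborel. cis (real_of_int n * t)) = (if n = 0 then complex_of_real (2 * pi) else 0)"
proof -
  show int: "set_integrable lborel {0..2 * pi} (\<lambda>t. cis (real_of_int n * t))"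
    by (intro borel_integrable_atLeastAtMost' continuous_intros)
  have "((\<lambda>t. cis (real_of_int n * t)) has_integral (if n = 0 then complex_of_real (2 * pi) else 0)) {0..2 * pi}"
  proof (cases "n = 0")
    case True
    then show ?thesis using has_integral_const_real[of "1::complex" 0 "2 * pi"] by (simp add: scaleR_conv_of_real)
  next
    case False
    have "((\<lambda>t. cis (real_of_int n * t)) has_integral
        cis (real_of_int n * (2 * pi)) / (\<i> * of_int n) - cis (real_of_int n * 0) / (\<i> * of_int n)) {0..2 * pi}"
    proof (rule fundamental_theorem_of_calculus)
      fix t :: real
      have "((\<lambda>t. cis (real_of_int n * t)) has_derivative (\<lambda>h. (real_of_int n * h) *\<^sub>R (\<i> * cis (real_of_int n * t)))) (at t within {0..2 * pi})"
        by (intro has_derivative_cis) (auto intro!: derivative_eq_intros)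
      then have "((\<lambda>t. cis (real_of_int n * t) / (\<i> * of_int n)) has_derivative
          (\<lambda>h. ((real_of_int n * h) *\<^sub>R (\<i> * cis (real_of_int n * t))) / (\<i> * of_int n))) (at t within {0..2 * pi})"
        by (rule bounded_linear.has_derivative[OF bounded_linear_divide])
      then show "((\<lambda>t. cis (real_of_int n * t) / (\<i> * of_int n)) has_vector_derivative cis (real_of_int n * t)) (at t within {0..2 * pi})"
        unfolding has_vector_derivative_def
        by (rule has_derivative_eq_rhs) (use False in \<open>auto simp: fun_eq_iff scaleR_conv_of_real field_simps\<close>)
    qed simp
    moreover have "cis (real_of_int n * (2 * pi)) = 1"
      using cis_multiple_2pi[of "real_of_int n"] by (simp add: mult_ac)
    ultimately show ?thesis using False by simp
  qed
  then show "(LINT t:{0..2 * pi}|lborel. cis (real_of_int n * t)) = (if n = 0 then complex_of_real (2 * pi) else 0)"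
    using set_borel_integral_eq_integral(2)[OF int] by (simp add: integral_unique)
qed

lemma prod_Basis_vec2: "(\<Prod>b\<in>(Basis :: (real^2) set). f b) = f (axis 1 1) * f (axis 2 1)"
proof -
  have B: "(Basis :: (real^2) set) = {axis 1 1, axis 2 1}"
    by (auto simp: Basis_vec_def UNIV_2)
  have "(axis 1 1 :: real^2) \<noteq> axis 2 1"
    by (simp add: axis_eq_axis)
  then show ?thesis unfolding B by (subst prod.insert) simp_all
qed

lemma mem_torus_cell: "x \<in> torus_cell \<longleftrightarrow> (0 \<le> x $ 1 \<and> x $ 1 \<le> 2 * pi) \<and> (0 \<le> x $ 2 \<and> x $ 2 \<le> 2 * pi)"
  by (auto simp: torus_cell_def mem_box_cart forall_2)

lemma wave_has_integral:
  "(wave k has_integral (if k = 0 then complex_of_real ((2 * pi)\<^sup>2) else 0)) torus_cell"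
proof -
  define g :: "real^2 \<Rightarrow> real \<Rightarrow> complex" where
    "g b t = indicator {0..2 * pi} t *\<^sub>R cis (real_of_int (k $ axis_index b) * t)" for b t
  have int: "set_integrable lborel torus_cell (wave k)"
    unfolding set_integrable_def torus_cell_def
    by (intro borel_integrable_compact continuous_intros continuous_on_id) auto
  have "(LINT x:torus_cell|lborel. wave k x) = (\<integral>x. (\<Prod>b\<in>Basis. g b (x \<bullet> b)) \<partial>lborel)"
    unfolding set_lebesgue_integral_def
  proof (intro Bochner_Integration.integral_cong refl)
    fix x :: "real^2"
    show "indicat_real torus_cell x *\<^sub>R wave k x = (\<Prod>b\<in>Basis. g b (x \<bullet> b))"
      unfolding prod_Basis_vec2 g_def
      by (auto simp: indicator_def mem_torus_cell wave_def phase_def sum_2 cis_mult inner_axis)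
  qed
  also have "\<dots> = (\<Prod>b\<in>Basis. \<integral>t. g b t \<partial>lborel)"
    using cis_integral(1) by (intro lborel_integral_prod_coordinates) (auto simp: g_def set_integrable_def)
  also have "\<dots> = (if k $ 1 = 0 then complex_of_real (2 * pi) else 0) * (if k $ 2 = 0 then complex_of_real (2 * pi) else 0)"
    unfolding prod_Basis_vec2 g_def axis_index_axis using cis_integral(2) by (simp add: set_lebesgue_integral_def)
  also have "\<dots> = (if k = 0 then complex_of_real ((2 * pi)\<^sup>2) else 0)"
    by (auto simp: vec_eq_iff forall_2 power2_eq_square)
  finally show ?thesis
    using set_borel_integral_eq_integral[OF int] by (metis has_integral_integral)
qed

section \<open>Fourier series\<close>

definition synth :: "(int^2 \<Rightarrow> complex) \<Rightarrow> real^2 \<Rightarrow> complex" where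
  "synth c x = (\<Sum>\<^sub>\<infinity>k. c k * wave k x)"

definition partial_synth :: "nat \<Rightarrow> (int^2 \<Rightarrow> complex) \<Rightarrow> real^2 \<Rightarrow> complex" where
  "partial_synth N c x = (\<Sum>k\<in>freq_box N. c k * wave k x)"

abbreviation l1 :: "(int^2 \<Rightarrow> complex) \<Rightarrow> bool" where
  "l1 c \<equiv> (\<lambda>k. cmod (c k)) summable_on UNIV"

lemma synth_has_sum: "l1 c \<Longrightarrow> ((\<lambda>k. c k * wave k x) has_sum synth c x) UNIV"
  unfolding synth_def by (rule has_sum_infsum, rule abs_summable_summable) (simp add: norm_mult)

lemma partial_synth_tendsto: "l1 c \<Longrightarrow> (\<lambda>N. partial_synth N c x) \<longlonglongrightarrow> synth c x"
  unfolding partial_synth_def by (intro has_sum_freq_box synth_has_sum)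

lemma synth_minus_partial:
  assumes "l1 c"
  shows "cmod (synth c x - partial_synth N c x) \<le> (\<Sum>\<^sub>\<infinity>k\<in>- freq_box N. cmod (c k))"
proof -
  have "((\<lambda>k. c k * wave k x) has_sum (synth c x - partial_synth N c x)) (UNIV - freq_box N)"
    unfolding partial_synth_def
    by (rule has_sum_Diff[OF synth_has_sum[OF assms]]) (auto intro: has_sum_finiteI)
  moreover have "((\<lambda>k. cmod (c k)) has_sum (\<Sum>\<^sub>\<infinity>k\<in>- freq_box N. cmod (c k))) (UNIV - freq_box N)"
    unfolding Compl_eq_Diff_UNIV by (intro has_sum_infsum summable_on_subset_banach[OF assms]) auto
  ultimately show ?thesis by (rule norm_infsum_le) (simp add: norm_mult)
qed

lemma cmod_partial_synth_le:
  assumes "l1 c"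
  shows "cmod (partial_synth N c x) \<le> (\<Sum>\<^sub>\<infinity>k. cmod (c k))"
proof -
  have "cmod (partial_synth N c x) \<le> (\<Sum>k\<in>freq_box N. cmod (c k))"
    unfolding partial_synth_def by (intro order_trans[OF norm_sum]) (simp add: norm_mult)
  also have "\<dots> \<le> (\<Sum>\<^sub>\<infinity>k. cmod (c k))" by (intro finite_sum_le_infsum assms) auto
  finally show ?thesis .
qed

text \<open>Uniformly small tails make the partial sums converge uniformly, jointly in the parameter and
  in space.\<close>

lemma continuous_on_synth_family:
  fixes c :: "'a::topological_space \<Rightarrow> int^2 \<Rightarrow> complex" and \<xi> :: "'a \<Rightarrow> real^2"
  assumes c: "\<And>k. continuous_on S (\<lambda>p. c p k)" and \<xi>: "continuous_on S \<xi>"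
    and l1: "\<And>p. p \<in> S \<Longrightarrow> l1 (c p)"
    and tail: "\<And>p N. p \<in> S \<Longrightarrow> (\<Sum>\<^sub>\<infinity>k\<in>- freq_box N. cmod (c p k)) \<le> \<epsilon> N" and eps: "\<epsilon> \<longlonglongrightarrow> 0"
  shows "continuous_on S (\<lambda>p. synth (c p) (\<xi> p))"
proof (rule uniform_limit_theorem)
  show "\<forall>\<^sub>F N in sequentially. continuous_on S (\<lambda>p. partial_synth N (c p) (\<xi> p))"
    unfolding partial_synth_def by (intro always_eventually allI continuous_intros c \<xi>)
  show "uniform_limit S (\<lambda>N p. partial_synth N (c p) (\<xi> p)) (\<lambda>p. synth (c p) (\<xi> p)) sequentially"
  proof (rule uniform_limitI)
    fix e :: real assume "0 < e"
    with eps have "\<forall>\<^sub>F N in sequentially. \<epsilon> N < e" by (rule order_tendstoD)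
    then show "\<forall>\<^sub>F N in sequentially. \<forall>p\<in>S. dist (partial_synth N (c p) (\<xi> p)) (synth (c p) (\<xi> p)) < e"
    proof eventually_elim
      case (elim N)
      show ?case
      proof
        fix p assume p: "p \<in> S"
        show "dist (partial_synth N (c p) (\<xi> p)) (synth (c p) (\<xi> p)) < e"
          using synth_minus_partial[OF l1[OF p], of "\<xi> p" N] tail[OF p, of N] elim
          by (simp add: dist_norm norm_minus_commute)
      qed
    qed
  qed
qed simp

lemma uniform_limit_synth:
  assumes "l1 c"
  shows "uniform_limit S (\<lambda>N. partial_synth N c) (synth c) sequentially"
proof (rule uniform_limitI)
  fix e :: real assume "0 < e"
  with infsum_outside_box_tendsto[OF assms] have "\<forall>\<^sub>F N in sequentially. (\<Sum>\<^sub>\<infinity>k\<in>- freq_box N. cmod (c k)) < e"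
    by (rule order_tendstoD)
  then show "\<forall>\<^sub>F N in sequentially. \<forall>x\<in>S. dist (partial_synth N c x) (synth c x) < e"
    by eventually_elim
       (use synth_minus_partial[OF assms] in \<open>auto simp: dist_norm norm_minus_commute intro: le_less_trans\<close>)
qed

lemma continuous_on_synth: "l1 c \<Longrightarrow> continuous_on S (synth c)"
  by (rule uniform_limit_theorem[OF _ uniform_limit_synth])
     (auto simp: partial_synth_def intro!: always_eventually continuous_intros continuous_on_id)

lemma synth_periodic: "synth c (x + axis i (2 * pi)) = synth c x"
  by (simp add: synth_def wave_periodic)

definition fcoef :: "(real^2 \<Rightarrow> complex) \<Rightarrow> int^2 \<Rightarrow> complex" where
  "fcoef f k = (1 / (2 * pi)\<^sup>2) *\<^sub>R (LINT x:torus_cell|lebesgue. f x * cnj (wave k x))"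

lemma fourier_coeff_eq_fcoef: "fourier_coeff f = fcoef (\<lambda>x. complex_of_real (f x))"
  by (simp add: fourier_coeff_def fcoef_def fun_eq_iff wave_def phase_def cis_cnj)

lemma fcoef_has_integral:
  assumes "continuous_on torus_cell f"
  shows "fcoef f k = (1 / (2 * pi)\<^sup>2) *\<^sub>R integral torus_cell (\<lambda>x. f x * cnj (wave k x))"
proof -
  have "(\<lambda>x. f x * cnj (wave k x)) absolutely_integrable_on torus_cell"
    using assms unfolding torus_cell_def
    by (intro absolutely_integrable_continuous continuous_intros continuous_on_id)
  then show ?thesis unfolding fcoef_def by (simp add: set_lebesgue_integral_eq_integral(2))
qed

lemma fcoef_synth:
  assumes c: "l1 c"
  shows "fcoef (synth c) k = c k"
proof -
  have "uniform_limit torus_cell (\<lambda>N x. partial_synth N c x * cnj (wave k x)) (\<lambda>x. synth c x * cnj (wave k x)) sequentially"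
  proof (rule uniform_limitI)
    fix e :: real assume "0 < e"
    then have "\<forall>\<^sub>F N in sequentially. \<forall>x\<in>torus_cell. dist (partial_synth N c x) (synth c x) < e"
      using uniform_limit_synth[OF c] by (auto simp: uniform_limit_iff)
    then show "\<forall>\<^sub>F N in sequentially. \<forall>x\<in>torus_cell. dist (partial_synth N c x * cnj (wave k x)) (synth c x * cnj (wave k x)) < e"
      by eventually_elim (simp add: dist_norm norm_mult flip: left_diff_distrib)
  qed
  moreover have "continuous_on torus_cell (\<lambda>x. partial_synth N c x * cnj (wave k x))" for N
    unfolding partial_synth_def by (intro continuous_intros continuous_on_id)
  ultimately obtain I J where
      I: "\<And>N. ((\<lambda>x. partial_synth N c x * cnj (wave k x)) has_integral I N) torus_cell"
    and J: "((\<lambda>x. synth c x * cnj (wave k x)) has_integral J) torus_cell" and IJ: "I \<longlonglongrightarrow> J"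
    unfolding torus_cell_def by (rule uniform_limit_integral_cbox) auto
  have "I N = (\<Sum>l\<in>freq_box N. c l * (if l = k then complex_of_real ((2 * pi)\<^sup>2) else 0))" for N
  proof (rule has_integral_unique[OF I])
    have "((\<lambda>x. \<Sum>l\<in>freq_box N. c l * wave (l - k) x) has_integral
        (\<Sum>l\<in>freq_box N. c l * (if l - k = 0 then complex_of_real ((2 * pi)\<^sup>2) else 0))) torus_cell"
      by (intro has_integral_sum has_integral_mult_right wave_has_integral) auto
    then show "((\<lambda>x. partial_synth N c x * cnj (wave k x)) has_integral
        (\<Sum>l\<in>freq_box N. c l * (if l = k then complex_of_real ((2 * pi)\<^sup>2) else 0))) torus_cell"
      by (simp add: partial_synth_def wave_diff sum_distrib_right mult.assoc)
  qed
  then have "I N = c k * complex_of_real ((2 * pi)\<^sup>2)" if "k \<in> freq_box N" for N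
    using that by (simp add: if_distrib[of "\<lambda>x. _ * x"] sum.delta cong: if_cong)
  then have "\<forall>\<^sub>F N in sequentially. I N = c k * complex_of_real ((2 * pi)\<^sup>2)"
    using freq_box_eventually[of k] by (auto elim: eventually_mono)
  then have "J = c k * complex_of_real ((2 * pi)\<^sup>2)"
    using IJ LIMSEQ_unique tendsto_eventually by blast
  then show ?thesis
    using J continuous_on_synth[OF c] by (simp add: fcoef_has_integral integral_unique scaleR_conv_of_real)
qed

lemma synth_hermitian:
  assumes "hermitian c"
  shows "complex_of_real (Re (synth c x)) = synth c x"
proof -
  have "synth c x = (\<Sum>\<^sub>\<infinity>k. c (- k) * wave (- k) x)"
    unfolding synth_def by (rule infsum_reindex_bij_betw[OF bij_uminus_freq, symmetric])
  also have "\<dots> = cnj (synth c x)"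
    using assms by (simp add: synth_def hermitian_def wave_minus flip: infsum_cnj)
  finally have "Im (synth c x) = 0"
    by (metis Reals_cnj_iff complex_is_Real_iff)
  then show ?thesis by (simp add: complex_eq_iff)
qed

lemma fourier_coeff_synth:
  assumes "l1 c" "hermitian c"
  shows "fourier_coeff (\<lambda>x. Re (synth c x)) = c"
  using assms by (simp add: fourier_coeff_eq_fcoef synth_hermitian fcoef_synth fun_eq_iff)

lemma hermitian_fourier_coeff: "hermitian (fourier_coeff f)"
  unfolding hermitian_def
proof
  fix k
  have "(LINT x:torus_cell|lebesgue. complex_of_real (f x) * cnj (wave (- k) x))
     = cnj (LINT x:torus_cell|lebesgue. complex_of_real (f x) * cnj (wave k x))"
    unfolding set_lebesgue_integral_def by (subst Bochner_Integration.integral_cnj[symmetric]) (simp add: wave_minus)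
  then show "fourier_coeff f (- k) = cnj (fourier_coeff f k)"
    by (simp add: fourier_coeff_eq_fcoef fcoef_def)
qed

section \<open>Products and derivatives of Fourier series\<close>

definition conv :: "(int^2 \<Rightarrow> complex) \<Rightarrow> (int^2 \<Rightarrow> complex) \<Rightarrow> int^2 \<Rightarrow> complex" where
  "conv a b k = (\<Sum>\<^sub>\<infinity>l. a (k - l) * b l)"

lemma abs_summable_mult_prod:
  assumes "l1 a" "l1 b"
  shows "(\<lambda>p. cmod (a (fst p) * b (snd p))) summable_on UNIV"
proof -
  have "(\<lambda>p. norm ((\<lambda>(j, l). a j * b l) p)) summable_on (UNIV \<times> UNIV)"
    apply (subst Infinite_Sum.abs_summable_on_Sigma_iff)
    using assms by (auto simp: norm_mult infsum_cmult_right' abs_mult infsum_nonneg intro!: summable_on_cmult_right summable_on_cmult_left)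
  then show ?thesis by (simp add: case_prod_unfold)
qed

lemma bij_shear: "bij_betw (\<lambda>(k, l). (k - l, l)) (UNIV :: ((int^2) \<times> (int^2)) set) UNIV"
  by (rule bij_betwI[where g = "\<lambda>(j, l). (j + l, l)"]) auto

lemma l1_mult_wave [simp]: "l1 (\<lambda>k. c k * wave k x) = l1 c"
  by (simp add: norm_mult)

lemma conv_aux:
  assumes "l1 a" "l1 b"
  shows "(\<lambda>(k, l). cmod (a (k - l) * b l)) summable_on UNIV \<times> UNIV"
  using abs_summable_mult_prod[OF assms]
    summable_on_reindex_bij_betw[OF bij_shear, of "\<lambda>p. cmod (a (fst p) * b (snd p))"]
  by (simp add: case_prod_unfold)

lemma conv_summable:
  assumes "l1 a" "l1 b"
  shows "(\<lambda>l. a (k - l) * b l) summable_on UNIV"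
  by (rule abs_summable_summable, rule summable_on_SigmaD1[OF conv_aux[OF assms]]) simp

lemma l1_conv:
  assumes "l1 a" "l1 b"
  shows "l1 (conv a b)"
proof (rule summable_on_comparison_test)
  show "(\<lambda>k. \<Sum>\<^sub>\<infinity>l. cmod (a (k - l) * b l)) summable_on UNIV"
    by (rule summable_on_Sigma_banach[OF conv_aux[OF assms]])
  show "cmod (conv a b k) \<le> (\<Sum>\<^sub>\<infinity>l. cmod (a (k - l) * b l))" for k
    unfolding conv_def by (rule norm_infsum_bound, rule summable_on_SigmaD1[OF conv_aux[OF assms]]) simp
qed simp

lemma infsum_conv_le:
  assumes a: "l1 a" and b: "l1 b"
  shows "(\<Sum>\<^sub>\<infinity>k. cmod (conv a b k)) \<le> (\<Sum>\<^sub>\<infinity>k. cmod (a k)) * (\<Sum>\<^sub>\<infinity>k. cmod (b k))"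
proof -
  let ?p = "\<lambda>p. cmod (a (fst p) * b (snd p))"
  have "(\<Sum>\<^sub>\<infinity>k. cmod (conv a b k)) \<le> (\<Sum>\<^sub>\<infinity>k. \<Sum>\<^sub>\<infinity>l. cmod (a (k - l) * b l))"
  proof (rule infsum_mono[OF l1_conv[OF assms]])
    show "(\<lambda>k. \<Sum>\<^sub>\<infinity>l. cmod (a (k - l) * b l)) summable_on UNIV"
      by (rule summable_on_Sigma_banach[OF conv_aux[OF assms]])
    show "cmod (conv a b k) \<le> (\<Sum>\<^sub>\<infinity>l. cmod (a (k - l) * b l))" for k
      unfolding conv_def by (rule norm_infsum_bound, rule summable_on_SigmaD1[OF conv_aux[OF assms]]) simp
  qed
  also have "\<dots> = infsum (\<lambda>(k, l). cmod (a (k - l) * b l)) (UNIV \<times> UNIV)"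
    by (rule infsum_Sigma'_banach[OF conv_aux[OF assms]])
  also have "\<dots> = infsum ?p UNIV"
    using infsum_reindex_bij_betw[OF bij_shear, of ?p] by (simp add: case_prod_unfold)
  also have "\<dots> = infsum (\<lambda>(j, l). cmod (a j * b l)) (UNIV \<times> UNIV)"
    by (simp add: case_prod_unfold)
  also have "\<dots> = (\<Sum>\<^sub>\<infinity>j. \<Sum>\<^sub>\<infinity>l. cmod (a j * b l))"
    using abs_summable_mult_prod[OF assms]
    by (intro infsum_Sigma'_banach[symmetric]) (simp add: case_prod_unfold)
  also have "\<dots> = (\<Sum>\<^sub>\<infinity>k. cmod (a k)) * (\<Sum>\<^sub>\<infinity>k. cmod (b k))"
    by (simp add: norm_mult infsum_cmult_right' infsum_cmult_left')
  finally show ?thesis .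
qed

text \<open>The Cauchy product of absolutely convergent Fourier series, reindexed by the shear
  \<open>(k, l) \<mapsto> (k - l, l)\<close>.\<close>

lemma synth_conv:
  assumes "l1 a" "l1 b"
  shows "synth (conv a b) x = synth a x * synth b x"
proof -
  let ?a = "\<lambda>k. a k * wave k x" and ?b = "\<lambda>k. b k * wave k x"
  have l1: "l1 ?a" "l1 ?b" using assms by auto
  have "((\<lambda>l. ?a (k - l) * ?b l) has_sum conv a b k * wave k x) UNIV" for k
  proof -
    have eq: "?a (k - l) * ?b l = (a (k - l) * b l) * wave k x" for l
      using wave_add[of "k - l" l x] by simp
    show ?thesis unfolding eq conv_def
      by (intro has_sum_cmult_left has_sum_infsum conv_summable assms)
  qed
  then have conv: "infsum (\<lambda>l. ?a (k - l) * ?b l) UNIV = conv a b k * wave k x" for k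
    by (rule infsumI)
  have S: "(\<lambda>(k, l). ?a (k - l) * ?b l) summable_on UNIV \<times> UNIV"
    by (rule abs_summable_summable) (use conv_aux[OF l1] in \<open>simp add: case_prod_unfold\<close>)
  have P: "(\<lambda>(j, l). ?a j * ?b l) summable_on UNIV \<times> UNIV"
    by (rule abs_summable_summable) (use abs_summable_mult_prod[OF l1] in \<open>simp add: case_prod_unfold\<close>)
  have "synth (conv a b) x = (\<Sum>\<^sub>\<infinity>k. \<Sum>\<^sub>\<infinity>l. ?a (k - l) * ?b l)"
    by (simp add: synth_def conv)
  also have "\<dots> = infsum (\<lambda>(k, l). ?a (k - l) * ?b l) (UNIV \<times> UNIV)"
    by (rule infsum_Sigma'_banach[OF S])
  also have "\<dots> = infsum (\<lambda>(j, l). ?a j * ?b l) (UNIV \<times> UNIV)"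
    using infsum_reindex_bij_betw[OF bij_shear, of "\<lambda>(j, l). ?a j * ?b l"] by (simp add: case_prod_unfold)
  also have "\<dots> = (\<Sum>\<^sub>\<infinity>j. \<Sum>\<^sub>\<infinity>l. ?a j * ?b l)"
    by (rule infsum_Sigma'_banach[OF P, symmetric])
  also have "\<dots> = synth a x * synth b x"
    by (simp add: infsum_cmult_right' infsum_cmult_left' flip: synth_def)
  finally show ?thesis .
qed

definition deriv_coeff :: "2 \<Rightarrow> (int^2 \<Rightarrow> complex) \<Rightarrow> int^2 \<Rightarrow> complex" where
  "deriv_coeff i c k = \<i> * of_int (k $ i) * c k"

lemma abs_component_le_bracket: "\<bar>real_of_int (k $ i)\<bar> \<le> bracket k"
proof -
  have "(real_of_int (k $ i))\<^sup>2 \<le> freq_sq k"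
    using exhaust_2[of i] by (auto simp: freq_sq_def)
  then have "\<bar>real_of_int (k $ i)\<bar> \<le> sqrt (freq_sq k)" by (intro real_le_rsqrt) simp
  then show ?thesis using freq_le_bracket[of k] by linarith
qed

lemma cmod_deriv_coeff_le: "cmod (deriv_coeff i c k) \<le> bracket k * cmod (c k)"
  using abs_component_le_bracket[of k i] by (simp add: deriv_coeff_def norm_mult mult_right_mono)

lemma l1_deriv_coeff:
  assumes "(\<lambda>k. bracket k * cmod (c k)) summable_on UNIV"
  shows "l1 (deriv_coeff i c)"
  by (rule summable_on_comparison_test[OF assms]) (auto intro: cmod_deriv_coeff_le)

lemma synth_has_derivative:
  assumes c: "(\<lambda>k. bracket k * cmod (c k)) summable_on UNIV"
  shows "(synth c has_derivative (\<lambda>\<xi>. \<Sum>i\<in>UNIV. complex_of_real (\<xi> $ i) * synth (deriv_coeff i c) x)) (at x)"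
proof -
  have l1: "l1 c"
    by (rule summable_on_comparison_test[OF c]) (auto intro: cmod_le_bracket_mult)
  note l1d = l1_deriv_coeff[OF c]
  let ?f' = "\<lambda>N x \<xi>. \<Sum>i\<in>UNIV. complex_of_real (\<xi> $ i) * partial_synth N (deriv_coeff i c) x"
  let ?g' = "\<lambda>x \<xi>. \<Sum>i\<in>UNIV. complex_of_real (\<xi> $ i) * synth (deriv_coeff i c) x"
  have "\<exists>g. \<forall>x\<in>UNIV. (\<lambda>N. partial_synth N c x) \<longlonglongrightarrow> g x \<and> (g has_derivative ?g' x) (at x within UNIV)"
  proof (rule has_derivative_sequence[where f' = ?f' and f = "\<lambda>N. partial_synth N c", OF convex_UNIV _ _ UNIV_I partial_synth_tendsto[OF l1, of 0]])
    fix N and x :: "real^2"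
    have "(partial_synth N c has_derivative (\<lambda>\<xi>. \<Sum>k\<in>freq_box N. c k * (complex_of_real (phase k \<xi>) * (\<i> * wave k x)))) (at x)"
      unfolding partial_synth_def[abs_def]
      by (intro has_derivative_sum has_derivative_mult_right has_derivative_wave)
    also have "(\<lambda>\<xi>. \<Sum>k\<in>freq_box N. c k * (complex_of_real (phase k \<xi>) * (\<i> * wave k x))) = ?f' N x"
      by (auto simp: fun_eq_iff partial_synth_def deriv_coeff_def phase_def sum_2 sum_distrib_left
          sum.distrib[symmetric] algebra_simps intro!: sum.cong)
    finally show "(partial_synth N c has_derivative ?f' N x) (at x within UNIV)" .
  next
    fix e :: real assume e: "0 < e"
    have "\<forall>\<^sub>F N in sequentially. \<forall>i\<in>(UNIV::2 set). \<forall>x\<in>UNIV. dist (partial_synth N (deriv_coeff i c) x) (synth (deriv_coeff i c) x) < e / 2"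
    proof (rule eventually_ball_finite)
      show "\<forall>i\<in>UNIV::2 set. \<forall>\<^sub>F N in sequentially. \<forall>x\<in>UNIV. dist (partial_synth N (deriv_coeff i c) x) (synth (deriv_coeff i c) x) < e / 2"
        by (intro ballI uniform_limitD[OF uniform_limit_synth[OF l1d]] half_gt_zero e)
    qed simp
    then show "\<forall>\<^sub>F N in sequentially. \<forall>x\<in>UNIV. \<forall>\<xi>. norm (?f' N x \<xi> - ?g' x \<xi>) \<le> e * norm \<xi>"
    proof eventually_elim
      case (elim N)
      show ?case
      proof (intro ballI allI)
        fix x \<xi> :: "real^2"
        have "?f' N x \<xi> - ?g' x \<xi>
          = (\<Sum>i\<in>UNIV. complex_of_real (\<xi> $ i) * (partial_synth N (deriv_coeff i c) x - synth (deriv_coeff i c) x))"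
          by (simp add: sum_subtractf right_diff_distrib)
        also have "norm \<dots> \<le> (\<Sum>i\<in>(UNIV::2 set). norm \<xi> * (e / 2))"
        proof (intro order_trans[OF norm_sum] sum_mono)
          fix i :: 2
          have "dist (partial_synth N (deriv_coeff i c) x) (synth (deriv_coeff i c) x) < e / 2"
            using elim by blast
          then show "norm (complex_of_real (\<xi> $ i) * (partial_synth N (deriv_coeff i c) x - synth (deriv_coeff i c) x)) \<le> norm \<xi> * (e / 2)"
            unfolding norm_mult norm_of_real dist_norm
            by (intro mult_mono component_le_norm_cart) auto
        qed
        also have "\<dots> = e * norm \<xi>" by simp
        finally show "norm (?f' N x \<xi> - ?g' x \<xi>) \<le> e * norm \<xi>" .
      qed
    qed
  qed
  then obtain g where g: "\<And>x. (\<lambda>N. partial_synth N c x) \<longlonglongrightarrow> g x" "\<And>x. (g has_derivative ?g' x) (at x)"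
    by auto
  have "g = synth c"
    using LIMSEQ_unique[OF g(1) partial_synth_tendsto[OF l1]] by (simp add: fun_eq_iff)
  then show ?thesis using g(2) by simp
qed

section \<open>The transport term in physical space\<close>

definition velocity_coeff :: "2 \<Rightarrow> (int^2 \<Rightarrow> complex) \<Rightarrow> int^2 \<Rightarrow> complex" where
  "velocity_coeff i c k = complex_of_real (if i = 1 then M1_symbol 0 k else M2_symbol 0 k) * c k"

lemma cmod_velocity_coeff_le: "cmod (velocity_coeff i c k) \<le> cmod (c k)"
  using symbol_le_1[of k] by (simp add: velocity_coeff_def norm_mult mult_left_le_one_le)

lemma l1_velocity_coeff: "l1 c \<Longrightarrow> l1 (velocity_coeff i c)"
  by (erule summable_on_comparison_test) (auto intro: cmod_velocity_coeff_le)

lemma hermitian_velocity_coeff: "hermitian c \<Longrightarrow> hermitian (velocity_coeff i c)"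
  by (simp add: hermitian_def velocity_coeff_def)

lemma transport_eq_conv:
  assumes s: "2 < s" and c: "sob_bound s R c"
  shows "transport c c k = - (\<Sum>i\<in>UNIV. conv (velocity_coeff i c) (deriv_coeff i c) k)"
proof -
  have l1v: "l1 (velocity_coeff i c)" for i using l1_velocity_coeff[OF sob_bound_summable[OF c s]] .
  have l1d: "l1 (deriv_coeff i c)" for i using l1_deriv_coeff[OF sob_bound_weighted_summable[OF c s]] .
  have "((\<lambda>l. - (velocity_coeff 1 c (k - l) * deriv_coeff 1 c l + velocity_coeff 2 c (k - l) * deriv_coeff 2 c l))
      has_sum - (conv (velocity_coeff 1 c) (deriv_coeff 1 c) k + conv (velocity_coeff 2 c) (deriv_coeff 2 c) k)) UNIV"
    unfolding conv_def by (intro has_sum_uminusI has_sum_add has_sum_infsum conv_summable l1v l1d)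
  moreover have "- (velocity_coeff 1 c (k - l) * deriv_coeff 1 c l + velocity_coeff 2 c (k - l) * deriv_coeff 2 c l)
      = transport_term c c k l" for l
    by (simp add: velocity_coeff_def deriv_coeff_def transport_term_def advect_def algebra_simps)
  ultimately show ?thesis unfolding transport_def by (simp add: infsumI sum_2)
qed

text \<open>The system of coefficients is the differential equation: summing the transport term against
  the waves gives the product of velocity and gradient.\<close>

lemma l1_transport:
  assumes s: "2 < s" and c: "sob_bound s R c"
  shows "l1 (transport c c)"
    and "synth (transport c c) x = - (\<Sum>i\<in>UNIV. synth (velocity_coeff i c) x * synth (deriv_coeff i c) x)"
proof -
  have l1: "l1 c" using sob_bound_summable[OF c s] .
  have l1v: "l1 (velocity_coeff i c)" for i using l1_velocity_coeff[OF l1] .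
  have l1d: "l1 (deriv_coeff i c)" for i using l1_deriv_coeff[OF sob_bound_weighted_summable[OF c s]] .
  let ?V = "\<lambda>i k. conv (velocity_coeff i c) (deriv_coeff i c) k"
  have eq: "transport c c k = - (?V 1 k + ?V 2 k)" for k
    by (simp add: transport_eq_conv[OF s c] sum_2)
  have lV: "l1 (?V i)" for i by (rule l1_conv[OF l1v l1d])
  show "l1 (transport c c)"
    by (rule summable_on_comparison_test[OF summable_on_add[OF lV[of 1] lV[of 2]]])
       (auto simp: eq norm_triangle_ineq simp flip: minus_add_distrib)
  have "synth (transport c c) x = - (synth (?V 1) x + synth (?V 2) x)"
  proof -
    have "((\<lambda>k. - (?V 1 k * wave k x + ?V 2 k * wave k x)) has_sum - (synth (?V 1) x + synth (?V 2) x)) UNIV"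
      by (intro has_sum_uminusI has_sum_add synth_has_sum lV)
    then show ?thesis unfolding synth_def[of "transport c c"] by (intro infsumI) (simp add: eq algebra_simps)
  qed
  then show "synth (transport c c) x = - (\<Sum>i\<in>UNIV. synth (velocity_coeff i c) x * synth (deriv_coeff i c) x)"
    by (simp add: synth_conv[OF l1v l1d] sum_2)
qed

section \<open>Fourier coefficients determine integrable functions\<close>

definition circle_map :: "real^2 \<Rightarrow> complex \<times> complex" where
  "circle_map x = (cis (x $ 1), cis (x $ 2))"

text \<open>A Borel inverse of \<open>cis\<close> on the unit circle with values in \<open>[0, 2\<pi>)\<close>. The argument of \<open>arccos\<close> is
  clipped so that both branches are continuous, hence measurable, on the whole plane.\<close>

definition angle :: "complex \<Rightarrow> real" where
  "angle z = (if 0 \<le> Im z then arccos (max (-1) (min 1 (Re z))) else 2 * pi - arccos (max (-1) (min 1 (Re z))))"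

lemma angle_cis:
  assumes "0 \<le> t" "t < 2 * pi"
  shows "angle (cis t) = t"
proof (cases "t \<le> pi")
  case True
  then have "0 \<le> sin t" using assms by (simp add: sin_ge_zero)
  then show ?thesis using True assms by (simp add: angle_def arccos_cos)
next
  case False
  then have "sin t < 0" using assms sin_lt_zero by simp
  moreover have "arccos (cos t) = 2 * pi - t"
    using arccos_cos[of "2 * pi - t"] False assms by (simp add: cos_diff)
  ultimately show ?thesis by (simp add: angle_def)
qed

lemma angle_measurable [measurable]: "angle \<in> borel_measurable borel"
proof -
  have "continuous_on UNIV (\<lambda>z. arccos (max (-1) (min 1 (Re z))))"
    by (intro continuous_intros) auto
  then have [measurable]: "(\<lambda>z. arccos (max (-1) (min 1 (Re z)))) \<in> borel_measurable borel"
    by (rule borel_measurable_continuous_onI)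
  have [measurable]: "Im \<in> borel_measurable borel"
    by (intro borel_measurable_continuous_onI continuous_intros)
  show ?thesis unfolding angle_def[abs_def] by measurable
qed

lemma continuous_on_circle_map: "continuous_on S circle_map"
  unfolding circle_map_def[abs_def] by (intro continuous_intros)

lemma circle_map_measurable [measurable]: "circle_map \<in> borel_measurable borel"
  by (intro borel_measurable_continuous_onI continuous_on_circle_map)

text \<open>Trigonometric polynomials are the polynomial functions of a point on the product of two
  circles, which brings them within reach of the Stone-Weierstrass theorem.\<close>

inductive trig_poly :: "(real^2 \<Rightarrow> complex) \<Rightarrow> bool" where
  wave: "trig_poly (\<lambda>x. a * wave k x)"
| add: "trig_poly p \<Longrightarrow> trig_poly q \<Longrightarrow> trig_poly (\<lambda>x. p x + q x)"

lemma trig_poly_mult: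
  assumes "trig_poly p" "trig_poly q"
  shows "trig_poly (\<lambda>x. p x * q x)"
  using assms
proof (induction p)
  case (wave a k)
  from wave.prems show ?case
  proof (induction q)
    case (wave b l)
    have "(\<lambda>x. a * wave k x * (b * wave l x)) = (\<lambda>x. (a * b) * wave (k + l) x)"
      by (simp add: wave_add mult_ac)
    then show ?case by (simp add: trig_poly.wave)
  next
    case (add p q)
    then show ?case using trig_poly.add[OF add.IH] by (simp add: distrib_left)
  qed
next
  case (add p q)
  then show ?case using trig_poly.add[OF add.IH] by (simp add: distrib_right)
qed

lemma trig_poly_cis:
  fixes u :: real
  shows "trig_poly (\<lambda>x. of_real (Re (cis (x $ i)) * u))" "trig_poly (\<lambda>x. of_real (Im (cis (x $ i)) * u))"
proof -
  have w: "wave (axis i n) x = cis (of_int n * x $ i)" for n x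
    using exhaust_2[of i] by (auto simp: wave_def phase_def sum_2 axis_def)
  have "trig_poly (\<lambda>x. (u / 2) * wave (axis i 1) x + (u / 2) * wave (axis i (-1)) x)"
    by (intro trig_poly.intros)
  also have "(\<lambda>x. (u / 2) * wave (axis i 1) x + (u / 2) * wave (axis i (-1)) x) = (\<lambda>x. complex_of_real (Re (cis (x $ i)) * u))"
    by (auto simp: w fun_eq_iff complex_eq_iff)
  finally show "trig_poly (\<lambda>x. of_real (Re (cis (x $ i)) * u))" .
  have "trig_poly (\<lambda>x. (- \<i> * u / 2) * wave (axis i 1) x + (\<i> * u / 2) * wave (axis i (-1)) x)"
    by (intro trig_poly.intros)
  also have "(\<lambda>x. (- \<i> * u / 2) * wave (axis i 1) x + (\<i> * u / 2) * wave (axis i (-1)) x) = (\<lambda>x. complex_of_real (Im (cis (x $ i)) * u))"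
    by (auto simp: w fun_eq_iff complex_eq_iff)
  finally show "trig_poly (\<lambda>x. of_real (Im (cis (x $ i)) * u))" .
qed

lemma trig_poly_polynomial:
  assumes "real_polynomial_function p"
  shows "trig_poly (\<lambda>x. complex_of_real (p (circle_map x)))"
  using assms
proof induction
  case (linear h)
  then interpret bounded_linear h .
  have hzw: "h (z, w) = Re z * h (1, 0) + Im z * h (\<i>, 0) + (Re w * h (0, 1) + Im w * h (0, \<i>))" for z w
  proof -
    have "(z, w) = Re z *\<^sub>R (1, 0) + Im z *\<^sub>R (\<i>, 0) + (Re w *\<^sub>R (0, 1) + Im w *\<^sub>R (0, \<i>))"
      by (simp add: complex_eq_iff)
    then have "h (z, w) = h (Re z *\<^sub>R (1, 0) + Im z *\<^sub>R (\<i>, 0) + (Re w *\<^sub>R (0, 1) + Im w *\<^sub>R (0, \<i>)))"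
      by (rule arg_cong)
    then show ?thesis by (simp only: add scaleR real_scaleR_def)
  qed
  have eq: "complex_of_real (h (circle_map x)) = of_real (Re (cis (x $ 1)) * h (1, 0)) + of_real (Im (cis (x $ 1)) * h (\<i>, 0))
      + (of_real (Re (cis (x $ 2)) * h (0, 1)) + of_real (Im (cis (x $ 2)) * h (0, \<i>)))" for x
    unfolding circle_map_def by (subst hzw) simp
  show ?case unfolding eq by (intro trig_poly.add trig_poly_cis)
next
  case (const c)
  have "trig_poly (\<lambda>x. complex_of_real c * wave 0 x)" by (rule trig_poly.wave)
  then show ?case by simp
next
  case (add f g)
  then show ?case by (simp add: trig_poly.add)
next
  case (mult f g)
  then show ?case by (simp add: trig_poly_mult)
qed

context
  fixes g :: "real^2 \<Rightarrow> real"
  assumes g: "integrable lborel g" and supp: "\<And>x. x \<notin> torus_cell \<Longrightarrow> g x = 0"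
    and orth: "\<And>k. (\<integral>x. complex_of_real (g x) * wave k x \<partial>lborel) = 0"
begin

lemma g_measurable [measurable]: "g \<in> borel_measurable borel"
  using borel_measurable_integrable[OF g] by simp

lemma integrable_mult_bounded:
  fixes \<phi> :: "real^2 \<Rightarrow> 'a::{real_normed_field, second_countable_topology, banach}"
  assumes [measurable]: "\<phi> \<in> borel_measurable borel" and C: "\<And>x. norm (\<phi> x) \<le> C"
  shows "integrable lborel (\<lambda>x. of_real (g x) * \<phi> x)"
proof (rule Bochner_Integration.integrable_bound)
  show "integrable lborel (\<lambda>x. C * \<bar>g x\<bar>)" using g by auto
  show "AE x in lborel. norm (of_real (g x) * \<phi> x) \<le> norm (C * \<bar>g x\<bar>)"
  proof (intro AE_I2)
    fix x
    have "0 \<le> C" using C[of x] norm_ge_zero order_trans by blast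
    moreover have "\<bar>g x\<bar> * norm (\<phi> x) \<le> \<bar>g x\<bar> * C" by (intro mult_left_mono C) auto
    ultimately show "norm (of_real (g x) * \<phi> x) \<le> norm (C * \<bar>g x\<bar>)" by (simp add: norm_mult mult.commute)
  qed
qed simp

lemma trig_poly_orth:
  assumes "trig_poly p"
  shows "integrable lborel (\<lambda>x. complex_of_real (g x) * p x) \<and> (\<integral>x. complex_of_real (g x) * p x \<partial>lborel) = 0"
  using assms
proof induction
  case (wave a k)
  have "integrable lborel (\<lambda>x. complex_of_real (g x) * wave k x)"
    by (rule integrable_mult_bounded[where C = 1])
       (auto intro!: borel_measurable_continuous_onI continuous_intros continuous_on_id)
  then have "integrable lborel (\<lambda>x. a * (complex_of_real (g x) * wave k x))"
    by simp
  moreover have "(\<integral>x. a * (complex_of_real (g x) * wave k x) \<partial>lborel) = 0"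
    by (simp add: orth)
  ultimately show ?case by (simp add: mult.left_commute)
next
  case (add p q)
  then show ?case by (simp add: distrib_left)
qed

text \<open>On the image of the cell, \<open>h\<close> is a uniform limit of polynomials, and polynomials pull back to
  trigonometric polynomials.\<close>

lemma continuous_orth:
  assumes h: "continuous_on UNIV (h :: complex \<times> complex \<Rightarrow> real)" and C: "\<And>y. \<bar>h y\<bar> \<le> C"
  shows "(\<integral>x. g x * h (circle_map x) \<partial>lborel) = 0"
proof -
  have [measurable]: "h \<in> borel_measurable borel" using h by (rule borel_measurable_continuous_onI)
  have int: "integrable lborel (\<lambda>x. g x * h (circle_map x))"
    using integrable_mult_bounded[of "\<lambda>x. h (circle_map x)" C] C by simp
  define I where "I = (\<integral>x. \<bar>g x\<bar> \<partial>lborel)"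
  have "\<bar>\<integral>x. g x * h (circle_map x) \<partial>lborel\<bar> \<le> e * I" if e: "0 < e" for e
  proof -
    have "compact (circle_map ` torus_cell)"
      unfolding torus_cell_def by (intro compact_continuous_image continuous_on_circle_map compact_cbox)
    then obtain p where p: "real_polynomial_function p" "\<And>y. y \<in> circle_map ` torus_cell \<Longrightarrow> \<bar>h y - p y\<bar> < e"
      using Stone_Weierstrass_real_polynomial_function[of "circle_map ` torus_cell" h e] h e continuous_on_subset by blast
    have "integrable lborel (\<lambda>x. complex_of_real (g x * p (circle_map x)))"
         "(\<integral>x. complex_of_real (g x * p (circle_map x)) \<partial>lborel) = 0"
      using trig_poly_orth[OF trig_poly_polynomial[OF p(1)]] by auto
    then have ip: "integrable lborel (\<lambda>x. g x * p (circle_map x))" and "(\<integral>x. g x * p (circle_map x) \<partial>lborel) = 0"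
      by (simp_all only: complex_of_real_integrable_eq integral_complex_of_real of_real_eq_0_iff)
    then have "(\<integral>x. g x * h (circle_map x) \<partial>lborel) = (\<integral>x. g x * h (circle_map x) - g x * p (circle_map x) \<partial>lborel)"
      using int by (subst Bochner_Integration.integral_diff) auto
    also have "\<bar>\<dots>\<bar> \<le> (\<integral>x. e * \<bar>g x\<bar> \<partial>lborel)"
    proof (rule integral_abs_bound_integral)
      show "integrable lborel (\<lambda>x. g x * h (circle_map x) - g x * p (circle_map x))" using int ip by auto
      show "integrable lborel (\<lambda>x. e * \<bar>g x\<bar>)" using g by auto
      fix x
      show "\<bar>g x * h (circle_map x) - g x * p (circle_map x)\<bar> \<le> e * \<bar>g x\<bar>"
      proof (cases "x \<in> torus_cell")
        case True
        then have "\<bar>h (circle_map x) - p (circle_map x)\<bar> \<le> e" using p(2)[OF imageI[OF True]] by simp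
        then have "\<bar>g x\<bar> * \<bar>h (circle_map x) - p (circle_map x)\<bar> \<le> \<bar>g x\<bar> * e" by (intro mult_left_mono) auto
        then show ?thesis by (simp add: abs_mult right_diff_distrib[symmetric] mult.commute)
      qed (simp add: supp)
    qed
    finally show ?thesis by (simp add: I_def)
  qed
  note le = this
  have I: "0 \<le> I" by (simp add: I_def)
  show ?thesis
  proof (rule ccontr)
    assume "(\<integral>x. g x * h (circle_map x) \<partial>lborel) \<noteq> 0"
    then have pos: "0 < \<bar>\<integral>x. g x * h (circle_map x) \<partial>lborel\<bar>" (is "0 < ?J") by simp
    \<comment> \<open>The accuracy is chosen to make the bound at most half of what it bounds.\<close>
    have "?J \<le> ?J / (2 * (I + 1)) * I" using pos I by (intro le) auto
    also have "\<dots> < ?J" using pos I by (simp add: field_simps add_strict_increasing)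
    finally show False by simp
  qed
qed

text \<open>The indicator of a closed set is a bounded pointwise limit of continuous functions of the
  distance to it.\<close>

lemma closed_orth:
  assumes K: "closed K"
  shows "(\<integral>x. g x * indicator K (circle_map x) \<partial>lborel) = 0"
proof (cases "K = {}")
  case False
  have [measurable]: "K \<in> sets borel" using K by simp
  define h where "h n y = max 0 (1 - real n * infdist y K)" for n y
  have hc: "continuous_on UNIV (h n)" for n unfolding h_def by (intro continuous_intros)
  have [measurable]: "h n \<in> borel_measurable borel" for n using hc by (rule borel_measurable_continuous_onI)
  have hb: "\<bar>h n y\<bar> \<le> 1" for n y by (auto simp: h_def infdist_nonneg)
  have hlim: "(\<lambda>n. h n y) \<longlonglongrightarrow> indicator K y" for y
  proof (cases "y \<in> K")
    case True
    then show ?thesis by (simp add: h_def)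
  next
    case False
    then have d: "0 < infdist y K" using infdist_pos_not_in_closed[OF K] \<open>K \<noteq> {}\<close> by simp
    have "\<forall>\<^sub>F n in sequentially. h n y = 0"
      using eventually_ge_at_top[of "nat \<lceil>1 / infdist y K\<rceil>"]
    proof eventually_elim
      case (elim n)
      then have "1 / infdist y K \<le> real n" by linarith
      then show ?case using d by (simp add: h_def field_simps)
    qed
    then show ?thesis using False by (simp add: tendsto_eventually)
  qed
  have "(\<lambda>n. \<integral>x. g x * h n (circle_map x) \<partial>lborel) \<longlonglongrightarrow> (\<integral>x. g x * indicator K (circle_map x) \<partial>lborel)"
  proof (rule integral_dominated_convergence[where w = "\<lambda>x. \<bar>g x\<bar>"])
    show "AE x in lborel. (\<lambda>n. g x * h n (circle_map x)) \<longlonglongrightarrow> g x * indicator K (circle_map x)"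
      by (intro AE_I2 tendsto_intros hlim)
    show "AE x in lborel. norm (g x * h n (circle_map x)) \<le> \<bar>g x\<bar>" for n
      using hb by (intro AE_I2) (simp add: abs_mult mult_left_le)
  qed (use g in auto)
  then show ?thesis using continuous_orth[OF hc hb] by (simp add: LIMSEQ_const_iff)
qed simp

text \<open>Closed sets are stable under intersection and generate the Borel sets.\<close>

lemma borel_orth:
  assumes B: "B \<in> sets borel"
  shows "(\<integral>x. g x * indicator B (circle_map x) \<partial>lborel) = 0"
proof -
  have gen: "B \<in> sigma_sets UNIV (Collect closed)" "Int_stable (Collect closed)" "Collect closed \<subseteq> Pow UNIV"
    using B by (auto simp: borel_eq_closed Int_stable_def)
  have ind: "integrable lborel (\<lambda>x. g x * indicator B (circle_map x))" if [measurable]: "B \<in> sets borel" for B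
    using integrable_mult_bounded[of "\<lambda>x. indicator B (circle_map x) :: real" 1] by (simp add: indicator_def)
  have borel: "B \<in> sets borel" if "B \<in> sigma_sets UNIV (Collect closed)" for B
    using that by (simp add: borel_eq_closed)
  from gen(2,3,1) show ?thesis
  proof (induction B rule: sigma_sets_induct_disjoint)
    case (basic A)
    then show ?case by (intro closed_orth) simp
  next
    case empty
    show ?case by simp
  next
    case (compl A)
    have "(\<integral>x. g x * indicator (UNIV - A) (circle_map x) \<partial>lborel)
       = (\<integral>x. g x * indicator UNIV (circle_map x) - g x * indicator A (circle_map x) \<partial>lborel)"
      by (intro Bochner_Integration.integral_cong) (auto simp: indicator_def)
    also have "\<dots> = 0"
      using closed_orth[of UNIV] compl.IH ind[OF borel[OF compl.hyps]] g
      by (subst Bochner_Integration.integral_diff) auto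
    finally show ?case .
  next
    case (union A)
    have [measurable]: "A i \<in> sets borel" for i using union.hyps(2) borel by blast
    then have [measurable]: "(\<Union>i. A i) \<in> sets borel" by auto
    have "(\<lambda>n. \<integral>x. g x * (\<Sum>i<n. indicator (A i) (circle_map x)) \<partial>lborel)
       \<longlonglongrightarrow> (\<integral>x. g x * indicator (\<Union>i. A i) (circle_map x) \<partial>lborel)"
    proof (rule integral_dominated_convergence[where w = "\<lambda>x. \<bar>g x\<bar>"])
      have sums: "(\<lambda>i. indicator (A i) y) sums (indicator (\<Union>i. A i) y :: real)" for y
      proof (cases "y \<in> (\<Union>i. A i)")
        case True
        then obtain j where j: "y \<in> A j" by blast
        then have "(\<lambda>i. indicator (A i) y) = (\<lambda>i. if i = j then 1 else 0 :: real)"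
          using union.hyps(1) by (auto simp: fun_eq_iff indicator_def disjoint_family_on_def)
        then show ?thesis using True sums_single[of j "\<lambda>_. 1 :: real"] by simp
      qed (auto simp: indicator_def)
      show "AE x in lborel. (\<lambda>n. g x * (\<Sum>i<n. indicator (A i) (circle_map x))) \<longlonglongrightarrow> g x * indicator (\<Union>i. A i) (circle_map x)"
        using sums unfolding sums_def by (intro AE_I2 tendsto_intros)
      fix n
      have "\<bar>\<Sum>i<n. indicator (A i) y\<bar> \<le> (1::real)" for y
      proof -
        have "(\<Sum>i<n. indicator (A i) y) \<le> (indicator (\<Union>i. A i) y :: real)"
          using sums[of y] sum_le_suminf[of "\<lambda>i. indicator (A i) y :: real" "{..<n}"] by (simp add: sums_iff)
        also have "\<dots> \<le> 1" by (simp add: indicator_def)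
        finally show ?thesis by (simp add: sum_nonneg)
      qed
      then show "AE x in lborel. norm (g x * (\<Sum>i<n. indicator (A i) (circle_map x))) \<le> \<bar>g x\<bar>"
        by (intro AE_I2) (simp add: abs_mult mult_left_le)
    qed (use g in auto)
    moreover have "(\<integral>x. g x * (\<Sum>i<n. indicator (A i) (circle_map x)) \<partial>lborel) = 0" for n
    proof -
      have "(\<integral>x. g x * (\<Sum>i<n. indicator (A i) (circle_map x)) \<partial>lborel)
          = (\<integral>x. (\<Sum>i<n. g x * indicator (A i) (circle_map x)) \<partial>lborel)"
        by (simp only: sum_distrib_left)
      also have "\<dots> = (\<Sum>i<n. \<integral>x. g x * indicator (A i) (circle_map x) \<partial>lborel)"
        by (rule Bochner_Integration.integral_sum) (rule ind, measurable)
      also have "\<dots> = 0" by (simp only: union.IH sum.neutral_const)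
      finally show ?thesis .
    qed
    ultimately show ?case by (simp add: LIMSEQ_const_iff)
  qed
qed

text \<open>Away from the upper edges of the cell, \<open>angle\<close> inverts the map to the circles, so every Borel set of
  the plane has, up to a null set, the same trace on the cell as the preimage of a Borel set of the
  product of circles. Testing against the sets where \<open>g\<close> is positive or negative gives the claim.\<close>

lemma AE_zero_if_orth: "AE x in lborel. g x = 0"
proof -
  define r :: "complex \<times> complex \<Rightarrow> real^2" where "r y = (\<chi> i. angle (if i = 1 then fst y else snd y))" for y :: "complex \<times> complex"
  have [measurable]: "(\<lambda>y. r y $ i) \<in> borel_measurable borel" for i
    unfolding r_def by (cases "i = 1") (simp_all add: borel_prod[symmetric])
  have [measurable]: "r \<in> borel_measurable borel"
    by (subst borel_measurable_euclidean_space) (auto simp: Basis_vec_def inner_axis)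
  have null: "AE x in (lborel :: (real^2) measure). x $ 1 \<noteq> 2 * pi \<and> x $ 2 \<noteq> (2 * pi :: real)" 
  proof -
    have "AE x in (lborel :: (real^2) measure). x $ i \<noteq> 2 * pi" for i :: 2
    proof -
      have "negligible {x::real^2. x $ i = 2 * pi}"
        using negligible_standard_hyperplane[of "axis i (1::real)" "2 * pi"] by (simp add: inner_axis axis_in_Basis_iff)
      then have "{x::real^2. x $ i = 2 * pi} \<in> null_sets lebesgue"
        by (simp add: negligible_iff_null_sets)
      then have "AE x in lebesgue. x \<notin> {x::real^2. x $ i = 2 * pi}" by (rule AE_not_in)
      then show ?thesis by (simp add: AE_completion_iff)
    qed
    from this[of 1] this[of 2] show ?thesis by (rule AE_conjI)
  qed
  have key: "(\<integral>x. g x * indicator A x \<partial>lborel) = 0" if [measurable]: "A \<in> sets borel" for A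
  proof -
    have [measurable]: "r -` A \<in> sets borel"
      using measurable_sets[of r borel borel A] by simp
    have "(\<integral>x. g x * indicator A x \<partial>lborel) = (\<integral>x. g x * indicator (r -` A) (circle_map x) \<partial>lborel)"
    proof (rule integral_cong_AE)
      show "AE x in lborel. g x * indicator A x = g x * indicator (r -` A) (circle_map x)"
        using null
      proof eventually_elim
        case (elim x)
        show ?case
        proof (cases "x \<in> torus_cell")
          case True
          then have "r (circle_map x) = x"
            using elim by (auto simp: vec_eq_iff forall_2 r_def circle_map_def mem_torus_cell angle_cis)
          then show ?thesis by (simp add: indicator_def)
        qed (simp add: supp)
      qed
    qed measurable
    also have "\<dots> = 0" by (rule borel_orth) simp
    finally show ?thesis .
  qed
  have pos: "AE x in lborel. \<not> 0 < sg * g x" if "\<bar>sg\<bar> = 1" for sg :: real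
  proof -
    let ?A = "{x. 0 < sg * g x}"
    have [measurable]: "?A \<in> sets borel" by measurable
    have int: "integrable lborel (\<lambda>x. sg * (g x * indicator ?A x))"
      using integrable_mult_bounded[of "indicator ?A :: real^2 \<Rightarrow> real" 1] by (auto simp: indicator_def)
    have "(\<integral>x. sg * (g x * indicator ?A x) \<partial>lborel) = 0"
      using key[of ?A] by simp
    then have "AE x in lborel. sg * (g x * indicator ?A x) = 0"
      using int by (subst (asm) integral_nonneg_eq_0_iff_AE) (auto simp: indicator_def)
    then show ?thesis by eventually_elim (auto simp: indicator_def split: if_splits)
  qed
  have "AE x in lborel. \<not> 0 < 1 * g x" "AE x in lborel. \<not> 0 < - 1 * g x"
    by (rule pos, simp)+
  then show ?thesis by eventually_elim auto
qed

end

text \<open>Uniqueness of Fourier coefficients. A Lebesgue measurable function is first replaced by a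
  Borel function that agrees with it almost everywhere.\<close>

theorem fourier_coeff_eq_0_imp_AE_0:
  assumes f: "set_integrable lebesgue torus_cell f" and coef: "\<And>k. fourier_coeff f k = 0"
  shows "AE x in lebesgue. x \<in> torus_cell \<longrightarrow> f x = 0"
proof -
  define F where "F x = indicator torus_cell x * f x" for x
  have F: "integrable lebesgue F" using f by (simp add: set_integrable_def F_def[abs_def])
  then obtain g' where g': "g' \<in> borel_measurable lborel" "AE x in lborel. F x = g' x"
    using completion_ex_borel_measurable_real[of F lborel] borel_measurable_integrable by blast
  define g where "g x = indicator torus_cell x * g' x" for x
  have cell [measurable]: "torus_cell \<in> sets borel" by (simp add: torus_cell_def)
  have [measurable]: "g \<in> borel_measurable borel" using g'(1) unfolding g_def[abs_def] by measurable
  have Fg: "AE x in lborel. F x = g x"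
    using g'(2) by eventually_elim (auto simp: F_def g_def indicator_def)
  have FgL: "AE x in lebesgue. F x = g x" using Fg by (rule AE_completion)
  have gL: "integrable lebesgue g"
    using F by (rule integrable_cong_AE_imp) (use FgL in \<open>auto intro: measurable_completion\<close>)
  have "AE x in lborel. g x = 0"
  proof (rule AE_zero_if_orth)
    show "integrable lborel g" using gL by (subst (asm) integrable_completion) auto
    show "g x = 0" if "x \<notin> torus_cell" for x using that by (simp add: g_def)
    fix k
    have [measurable]: "wave k \<in> borel_measurable borel"
      by (intro borel_measurable_continuous_onI continuous_intros continuous_on_id)
    have "(\<integral>x. complex_of_real (g x) * wave k x \<partial>lborel) = (\<integral>x. complex_of_real (g x) * wave k x \<partial>lebesgue)"
      by (subst integral_completion) auto
    also have "\<dots> = (\<integral>x. complex_of_real (F x) * wave k x \<partial>lebesgue)"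
    proof (rule integral_cong_AE)
      show "(\<lambda>x. complex_of_real (F x) * wave k x) \<in> borel_measurable lebesgue"
        using borel_measurable_integrable[OF F] measurable_completion[of "wave k" lborel borel]
        by (intro borel_measurable_times borel_measurable_of_real) auto
      show "(\<lambda>x. complex_of_real (g x) * wave k x) \<in> borel_measurable lebesgue"
        by (rule measurable_completion) simp
    qed (use FgL in \<open>auto\<close>)
    also have "\<dots> = (LINT x:torus_cell|lebesgue. complex_of_real (f x) * cnj (wave (- k) x))"
      unfolding set_lebesgue_integral_def
      by (intro Bochner_Integration.integral_cong refl) (auto simp: F_def wave_minus indicator_def)
    also have "\<dots> = 0"
      using coef[of "- k"] by (simp add: fourier_coeff_eq_fcoef fcoef_def)
    finally show "(\<integral>x. complex_of_real (g x) * wave k x \<partial>lborel) = 0" .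
  qed
  then have "AE x in lebesgue. g x = 0" by (rule AE_completion)
  with FgL show ?thesis by eventually_elim (auto simp: F_def indicator_def split: if_splits)
qed

section \<open>Sobolev functions and their Fourier series\<close>

lemma AE_lebesgue_iff_negligible:
  fixes P :: "'a::euclidean_space \<Rightarrow> bool"
  shows "(AE x in lebesgue. P x) \<longleftrightarrow> negligible {x. \<not> P x}"
proof
  assume "AE x in lebesgue. P x"
  then obtain N where "{x. \<not> P x} \<subseteq> N" "N \<in> null_sets lebesgue"
    by (auto simp: eventually_ae_filter)
  then show "negligible {x. \<not> P x}"
    by (meson negligible_iff_null_sets negligible_subset)
next
  assume "negligible {x. \<not> P x}"
  then have "{x. \<not> P x} \<in> null_sets lebesgue" by (simp add: negligible_iff_null_sets)
  then have "AE x in lebesgue. x \<notin> {x. \<not> P x}" by (rule AE_not_in)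
  then show "AE x in lebesgue. P x" by simp
qed

lemma AE_continuous_eq:
  fixes f g :: "'a::euclidean_space \<Rightarrow> 'b::metric_space"
  assumes "continuous_on UNIV f" "continuous_on UNIV g" "AE x in lebesgue. f x = g x"
  shows "f = g"
proof -
  have "open {x. f x \<noteq> g x}"
    by (rule open_Collect_neq[OF assms(1,2)])
  moreover have "negligible {x. f x \<noteq> g x}"
    using assms(3) by (simp add: AE_lebesgue_iff_negligible)
  ultimately have "{x. f x \<noteq> g x} = {}" using open_not_negligible by blast
  then show ?thesis by auto
qed

lemma torus_periodic_int:
  assumes "torus_periodic f"
  shows "f (x + axis i (2 * pi * of_int n)) = f x"
proof (induction n arbitrary: x rule: int_induct[where k = 0])
  case base
  have "x + axis i (2 * pi * of_int 0) = x" by (simp add: axis_def vec_eq_iff)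
  then show ?case by (rule arg_cong)
next
  case (step1 n)
  have "x + axis i (2 * pi * of_int (n + 1)) = (x + axis i (2 * pi * of_int n)) + axis i (2 * pi)"
    by (simp add: axis_def vec_eq_iff algebra_simps)
  then show ?case using assms step1(2) unfolding torus_periodic_def by metis
next
  case (step2 n)
  have "x + axis i (2 * pi * of_int n) = (x + axis i (2 * pi * of_int (n - 1))) + axis i (2 * pi)"
    by (simp add: axis_def vec_eq_iff algebra_simps)
  then show ?case using assms step2(2) unfolding torus_periodic_def by metis
qed

text \<open>The exceptional set is covered by countably many translates of its part in the period cell.\<close>

lemma AE_torus_cell_imp_AE:
  assumes f: "torus_periodic f" and g: "torus_periodic g"
    and ae: "AE x in lebesgue. x \<in> torus_cell \<longrightarrow> f x = g x"
  shows "AE x in lebesgue. f x = g x"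
proof -
  define N where "N = {x \<in> torus_cell. f x \<noteq> g x}"
  define v :: "int \<times> int \<Rightarrow> real^2" where "v p = axis 1 (2 * pi * of_int (fst p)) + axis 2 (2 * pi * of_int (snd p))" for p
  have N: "negligible N"
  proof -
    have "{x. \<not> (x \<in> torus_cell \<longrightarrow> f x = g x)} = N" by (auto simp: N_def)
    then show ?thesis using ae by (simp add: AE_lebesgue_iff_negligible)
  qed
  have "{x. f x \<noteq> g x} \<subseteq> (\<Union>p. (+) (v p) ` N)"
  proof
    fix x assume x: "x \<in> {x. f x \<noteq> g x}"
    define p where "p = (\<lfloor>x $ 1 / (2 * pi)\<rfloor>, \<lfloor>x $ 2 / (2 * pi)\<rfloor>)"
    define y where "y = x - v p"
    have fl: "0 \<le> t - 2 * pi * of_int \<lfloor>t / (2 * pi)\<rfloor>" "t - 2 * pi * of_int \<lfloor>t / (2 * pi)\<rfloor> \<le> 2 * pi" for t :: real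
    proof -
      have 1: "of_int \<lfloor>t / (2 * pi)\<rfloor> * (2 * pi) \<le> t" "t < (of_int \<lfloor>t / (2 * pi)\<rfloor> + 1) * (2 * pi)"
        by (rule floor_divide_lower, simp) (rule floor_divide_upper, simp)
      show "0 \<le> t - 2 * pi * of_int \<lfloor>t / (2 * pi)\<rfloor>" "t - 2 * pi * of_int \<lfloor>t / (2 * pi)\<rfloor> \<le> 2 * pi"
        using 1 by (simp_all add: algebra_simps)
    qed
    have "y \<in> torus_cell"
      using fl[of "x $ 1"] fl[of "x $ 2"] by (simp add: mem_torus_cell y_def v_def p_def axis_def)
    moreover have per: "h x = h y" if "torus_periodic h" for h :: "real^2 \<Rightarrow> 'a"
    proof -
      have "x = (y + axis 1 (2 * pi * of_int (fst p))) + axis 2 (2 * pi * of_int (snd p))"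
        by (simp add: y_def v_def algebra_simps)
      then show ?thesis using torus_periodic_int[OF that] by metis
    qed
    ultimately have "y \<in> N" using x per[OF f] per[OF g] by (simp add: N_def)
    moreover have "x = v p + y" by (simp add: y_def)
    ultimately show "x \<in> (\<Union>p. (+) (v p) ` N)" by blast
  qed
  moreover have "negligible (\<Union>p. (+) (v p) ` N)"
    by (rule negligible_countable_Union) (auto intro: negligible_translation N)
  ultimately show ?thesis
    unfolding AE_lebesgue_iff_negligible by (rule negligible_subset[rotated])
qed

lemma torus_cell_lmeasurable [simp, intro]: "torus_cell \<in> lmeasurable"
  by (simp add: torus_cell_def)

lemma torus_cell_sets [simp]: "torus_cell \<in> sets lebesgue"
  by (simp add: fmeasurableD)

lemma torus_L2_integrable:
  assumes "f \<in> torus_L2"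
  shows "set_integrable lebesgue torus_cell f"
proof (rule set_integrable_bound)
  have "set_integrable lebesgue torus_cell (\<lambda>x. 1 :: real)"
    using absolutely_integrable_on_const[of torus_cell "1::real"] by simp
  then show "set_integrable lebesgue torus_cell (\<lambda>x. 1 + (f x)\<^sup>2)"
    using assms by (intro set_integral_add(1)) (auto simp: torus_L2_def)
  show "set_borel_measurable lebesgue torus_cell f" using assms by (simp add: torus_L2_def)
  have "\<bar>f x\<bar> \<le> 1 + (f x)\<^sup>2" for x
  proof -
    have "\<bar>f x\<bar> * 2 \<le> 1 + \<bar>f x\<bar>\<^sup>2" using sum_squares_bound[of "\<bar>f x\<bar>" 1] by simp
    then show ?thesis by simp
  qed
  then show "AE x in lebesgue. x \<in> torus_cell \<longrightarrow> norm (f x) \<le> norm (1 + (f x)\<^sup>2)"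
    by (intro AE_I2) (simp add: abs_of_nonneg add_nonneg_nonneg)
qed

lemma set_integrable_complex_mult_wave:
  assumes "set_integrable lebesgue torus_cell f"
  shows "set_integrable lebesgue torus_cell (\<lambda>x. complex_of_real (f x) * cnj (wave k x))"
proof (rule set_integrable_bound[OF assms])
  have "(\<lambda>x. indicat_real torus_cell x *\<^sub>R f x) \<in> borel_measurable lebesgue"
    using assms unfolding set_integrable_def by (rule borel_measurable_integrable)
  then have f: "(\<lambda>x. complex_of_real (indicat_real torus_cell x *\<^sub>R f x)) \<in> borel_measurable lebesgue"
    by (rule measurable_compose) simp
  have "(\<lambda>x. cnj (wave k x)) \<in> borel_measurable lborel"
    by (auto intro!: borel_measurable_continuous_onI continuous_intros continuous_on_id)
  then have "(\<lambda>x. cnj (wave k x)) \<in> borel_measurable lebesgue" by (rule measurable_completion)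
  then have "(\<lambda>x. complex_of_real (indicat_real torus_cell x *\<^sub>R f x) * cnj (wave k x)) \<in> borel_measurable lebesgue"
    by (rule borel_measurable_times[OF f])
  then show "set_borel_measurable lebesgue torus_cell (\<lambda>x. complex_of_real (f x) * cnj (wave k x))"
    unfolding set_borel_measurable_def by (simp add: scaleR_conv_of_real mult.assoc)
qed (simp add: norm_mult)

lemma fourier_coeff_diff:
  assumes "set_integrable lebesgue torus_cell f" "set_integrable lebesgue torus_cell g"
  shows "fourier_coeff (\<lambda>x. f x - g x) k = fourier_coeff f k - fourier_coeff g k"
  unfolding fourier_coeff_eq_fcoef fcoef_def
  using set_integral_diff(2)[OF set_integrable_complex_mult_wave[OF assms(1), of k] set_integrable_complex_mult_wave[OF assms(2), of k]]
  by (simp add: left_diff_distrib scaleR_diff_right)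

lemma continuous_periodic_torus_L2:
  assumes "continuous_on UNIV f" "torus_periodic f"
  shows "f \<in> torus_L2"
proof -
  have "continuous_on torus_cell f" using assms(1) continuous_on_subset by blast
  then have "f absolutely_integrable_on torus_cell" "(\<lambda>x. (f x)\<^sup>2) absolutely_integrable_on torus_cell"
    unfolding torus_cell_def by (intro absolutely_integrable_continuous continuous_intros; assumption)+
  then show ?thesis
    using assms(2) unfolding torus_L2_def set_integrable_def set_borel_measurable_def
    by (auto intro: borel_measurable_integrable)
qed

lemma Re_synth_continuous: "l1 c \<Longrightarrow> continuous_on S (\<lambda>x. Re (synth c x))"
  by (intro continuous_intros continuous_on_synth)

lemma Re_synth_periodic: "torus_periodic (\<lambda>x. Re (synth c x))"
  by (simp add: torus_periodic_def synth_periodic)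

lemma Re_synth_torus_L2: "l1 c \<Longrightarrow> (\<lambda>x. Re (synth c x)) \<in> torus_L2"
  by (intro continuous_periodic_torus_L2 Re_synth_continuous Re_synth_periodic)

lemma torus_L2_AE_eq_synth:
  assumes f: "f \<in> torus_L2" and l1: "l1 (fourier_coeff f)"
  shows "AE x in lebesgue. f x = Re (synth (fourier_coeff f) x)"
proof (rule AE_torus_cell_imp_AE)
  show "torus_periodic f" using f by (simp add: torus_L2_def)
  let ?g = "\<lambda>x. Re (synth (fourier_coeff f) x)"
  have int: "set_integrable lebesgue torus_cell f" "set_integrable lebesgue torus_cell ?g"
    using f Re_synth_torus_L2[OF l1] by (auto intro: torus_L2_integrable)
  have "AE x in lebesgue. x \<in> torus_cell \<longrightarrow> f x - ?g x = 0"
  proof (rule fourier_coeff_eq_0_imp_AE_0)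
    show "set_integrable lebesgue torus_cell (\<lambda>x. f x - ?g x)"
      by (rule set_integral_diff(1)[OF int])
    show "fourier_coeff (\<lambda>x. f x - ?g x) k = 0" for k
      by (simp add: fourier_coeff_diff[OF int] fourier_coeff_synth[OF l1 hermitian_fourier_coeff])
  qed
  then show "AE x in lebesgue. x \<in> torus_cell \<longrightarrow> f x = ?g x" by eventually_elim auto
qed (rule Re_synth_periodic)

lemma continuous_eq_synth:
  assumes "f \<in> torus_L2" "continuous_on UNIV f" "l1 (fourier_coeff f)"
  shows "f = (\<lambda>x. Re (synth (fourier_coeff f) x))"
  using torus_L2_AE_eq_synth[OF assms(1,3)] assms
  by (intro AE_continuous_eq Re_synth_continuous)

lemma weight_square: "(1 + freq_sq k) powr s * (cmod z)\<^sup>2 = (bracket k powr s * cmod z)\<^sup>2"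
proof -
  have "(bracket k powr s)\<^sup>2 = bracket k powr (2 * s)" by (simp add: power2_eq_square flip: powr_add)
  then show ?thesis by (simp add: power_mult_distrib bracket_powr_sq)
qed

lemma sob_bound_summable_sq:
  assumes "sob_bound s M c"
  shows "(\<lambda>k. (bracket k powr s * cmod (c k))\<^sup>2) summable_on UNIV"
    and "(\<Sum>\<^sub>\<infinity>k. (bracket k powr s * cmod (c k))\<^sup>2) \<le> M\<^sup>2"
proof -
  show s: "(\<lambda>k. (bracket k powr s * cmod (c k))\<^sup>2) summable_on UNIV"
    using sob_boundD[OF assms] by (intro nonneg_bdd_above_summable_on bdd_aboveI2) auto
  show "(\<Sum>\<^sub>\<infinity>k. (bracket k powr s * cmod (c k))\<^sup>2) \<le> M\<^sup>2"
    using sob_boundD[OF assms] by (intro infsum_le_finite_sums s) auto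
qed

text \<open>Sobolev membership and \<open>H\<^sup>s\<close> bounds on coefficients, the link between the function spaces and the
  frequency-side estimates.\<close>

lemma sobolev_iff:
  "f \<in> sobolev s \<longleftrightarrow> f \<in> torus_L2 \<and> (\<exists>M. sob_bound s M (fourier_coeff f))"
proof -
  let ?q = "\<lambda>k. (bracket k powr s * cmod (fourier_coeff f k))\<^sup>2"
  have "sob_bound s (sqrt (infsum ?q UNIV)) (fourier_coeff f)" if "?q summable_on UNIV"
    using that by (auto simp: sob_bound_def infsum_nonneg intro!: finite_sum_le_infsum)
  then show ?thesis
    unfolding sobolev_def weight_square using sob_bound_summable_sq(1) by blast
qed

lemma sobolev_norm_eq: "sobolev_norm s f = sqrt (\<Sum>\<^sub>\<infinity>k. (bracket k powr s * cmod (fourier_coeff f k))\<^sup>2)"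
  by (simp add: sobolev_norm_def weight_square)

lemma sobolev_sob_bound:
  assumes "f \<in> sobolev s" "sobolev_norm s f \<le> M"
  shows "sob_bound s M (fourier_coeff f)"
proof -
  let ?q = "\<lambda>k. (bracket k powr s * cmod (fourier_coeff f k))\<^sup>2"
  have s: "?q summable_on UNIV" using assms(1) by (simp add: sobolev_def weight_square)
  have nn: "0 \<le> sobolev_norm s f" by (simp add: sobolev_norm_eq infsum_nonneg)
  have eq: "infsum ?q UNIV = (sobolev_norm s f)\<^sup>2" by (simp add: sobolev_norm_eq infsum_nonneg)
  show ?thesis
    unfolding sob_bound_def
  proof (intro conjI allI impI)
    show "0 \<le> M" using nn assms(2) by linarith
    fix F :: "(int^2) set" assume "finite F"
    then have "(\<Sum>k\<in>F. ?q k) \<le> infsum ?q UNIV" using s by (intro finite_sum_le_infsum) auto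
    then show "(\<Sum>k\<in>F. ?q k) \<le> M\<^sup>2" unfolding eq using power_mono[OF assms(2) nn, of 2] by linarith
  qed
qed

lemma synth_sobolev:
  assumes c: "sob_bound s M c" "hermitian c" and s: "2 < s"
  shows "(\<lambda>x. Re (synth c x)) \<in> sobolev s" "sobolev_norm s (\<lambda>x. Re (synth c x)) \<le> M"
proof -
  have l1: "l1 c" using sob_bound_summable[OF c(1) s] .
  show "(\<lambda>x. Re (synth c x)) \<in> sobolev s"
    unfolding sobolev_iff using Re_synth_torus_L2[OF l1] c by (auto simp: fourier_coeff_synth[OF l1 c(2)])
  show "sobolev_norm s (\<lambda>x. Re (synth c x)) \<le> M"
    unfolding sobolev_norm_eq fourier_coeff_synth[OF l1 c(2)]
    using sob_bound_summable_sq(2)[OF c(1)] sob_bound_nonneg[OF c(1)] real_le_lsqrt by (simp add: infsum_nonneg real_le_lsqrt)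
qed

lemma zero_mean_iff:
  "zero_mean f \<longleftrightarrow> fourier_coeff f 0 = 0"
  by (simp add: zero_mean_def fourier_coeff_eq_fcoef fcoef_def set_integral_complex_of_real)

section \<open>The classical solution\<close>

lemma infsum_transport_le:
  assumes s: "2 < s" and c: "sob_bound s R c"
  shows "(\<Sum>\<^sub>\<infinity>k. cmod (transport c c k)) \<le> 2 * (emb_const s UNIV * R)\<^sup>2"
proof -
  let ?K = "emb_const s UNIV * R"
  have l1c: "l1 c" using sob_bound_summable[OF c s] .
  have wc: "(\<lambda>k. bracket k * cmod (c k)) summable_on UNIV" using sob_bound_weighted_summable[OF c s] .
  have l1v: "l1 (velocity_coeff i c)" for i using l1_velocity_coeff[OF l1c] .
  have l1d: "l1 (deriv_coeff i c)" for i using l1_deriv_coeff[OF wc] .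
  have K: "0 \<le> ?K" using sob_bound_nonneg[OF c] by simp
  let ?V = "\<lambda>i. conv (velocity_coeff i c) (deriv_coeff i c)"
  have V: "(\<Sum>\<^sub>\<infinity>k. cmod (?V i k)) \<le> ?K\<^sup>2" for i
  proof -
    have "(\<Sum>\<^sub>\<infinity>k. cmod (velocity_coeff i c k)) \<le> (\<Sum>\<^sub>\<infinity>k. cmod (c k))"
      by (intro infsum_mono l1v l1c cmod_velocity_coeff_le)
    then have v: "(\<Sum>\<^sub>\<infinity>k. cmod (velocity_coeff i c k)) \<le> ?K" using sob_bound_infsum[OF c s, of UNIV] by linarith
    have "(\<Sum>\<^sub>\<infinity>k. cmod (deriv_coeff i c k)) \<le> (\<Sum>\<^sub>\<infinity>k. bracket k * cmod (c k))"
      by (intro infsum_mono l1d wc cmod_deriv_coeff_le)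
    then have d: "(\<Sum>\<^sub>\<infinity>k. cmod (deriv_coeff i c k)) \<le> ?K" using sob_bound_weighted_infsum[OF c s, of UNIV] by linarith
    have "(\<Sum>\<^sub>\<infinity>k. cmod (?V i k)) \<le> (\<Sum>\<^sub>\<infinity>k. cmod (velocity_coeff i c k)) * (\<Sum>\<^sub>\<infinity>k. cmod (deriv_coeff i c k))"
      by (rule infsum_conv_le[OF l1v l1d])
    also have "\<dots> \<le> ?K * ?K" using v d K by (intro mult_mono) (auto simp: infsum_nonneg)
    finally show ?thesis by (simp add: power2_eq_square)
  qed
  have l1V: "l1 (?V i)" for i by (rule l1_conv[OF l1v l1d])
  have "(\<Sum>\<^sub>\<infinity>k. cmod (transport c c k)) \<le> (\<Sum>\<^sub>\<infinity>k. cmod (?V 1 k) + cmod (?V 2 k))"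
  proof (rule infsum_mono[OF l1_transport(1)[OF s c]])
    show "(\<lambda>k. cmod (?V 1 k) + cmod (?V 2 k)) summable_on UNIV" by (intro summable_on_add l1V)
    show "cmod (transport c c k) \<le> cmod (?V 1 k) + cmod (?V 2 k)" for k
      unfolding transport_eq_conv[OF s c] sum_2 norm_minus_cancel by (rule norm_triangle_ineq)
  qed
  also have "\<dots> = (\<Sum>\<^sub>\<infinity>k. cmod (?V 1 k)) + (\<Sum>\<^sub>\<infinity>k. cmod (?V 2 k))" by (intro infsum_add l1V)
  also have "\<dots> \<le> 2 * ?K\<^sup>2" using V[of 1] V[of 2] by linarith
  finally show ?thesis .
qed

lemma continuous_on_synth_sob_bound:
  fixes b c :: "real \<Rightarrow> int^2 \<Rightarrow> complex"
  assumes s: "2 < s" and c: "\<And>t. t \<in> S \<Longrightarrow> sob_bound s R (c t)"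
    and le: "\<And>t k. cmod (b t k) \<le> bracket k * cmod (c t k)"
    and cont: "\<And>k. continuous_on S (\<lambda>t. b t k)"
  shows "continuous_on (S \<times> UNIV) (\<lambda>p. synth (b (fst p)) (snd p))"
proof (rule continuous_on_synth_family)
  show "continuous_on (S \<times> UNIV) (\<lambda>p. b (fst p) k)" for k
    by (rule continuous_on_compose2[OF cont]) (auto intro!: continuous_intros)
  show "continuous_on (S \<times> UNIV) (snd :: real \<times> (real^2) \<Rightarrow> real^2)" by (intro continuous_intros)
  have sum: "(\<lambda>k. cmod (b t k)) summable_on X" if "t \<in> S" for t X
    by (rule summable_on_comparison_test[OF sob_bound_weighted_summable[OF c[OF that] s]]) (use le in auto)
  show "l1 (b (fst p))" if "p \<in> S \<times> UNIV" for p :: "real \<times> (real^2)" using sum that by auto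
  show "(\<Sum>\<^sub>\<infinity>k\<in>- freq_box N. cmod (b (fst p) k)) \<le> emb_const s (- freq_box N) * R"
    if p: "p \<in> S \<times> UNIV" for p :: "real \<times> (real^2)" and N
  proof -
    have t: "fst p \<in> S" using p by auto
    have "(\<Sum>\<^sub>\<infinity>k\<in>- freq_box N. cmod (b (fst p) k)) \<le> (\<Sum>\<^sub>\<infinity>k\<in>- freq_box N. bracket k * cmod (c (fst p) k))"
      by (intro infsum_mono sum t le sob_bound_weighted_summable[OF c[OF t] s])
    also have "\<dots> \<le> emb_const s (- freq_box N) * R" by (rule sob_bound_weighted_infsum[OF c[OF t] s])
    finally show ?thesis .
  qed
  show "(\<lambda>N. emb_const s (- freq_box N) * R) \<longlonglongrightarrow> 0"
    by (rule tendsto_eq_intros emb_const_outside_box[OF s] refl)+ simp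
qed

lemma Re_synth_transport:
  assumes "2 < s" "sob_bound s R c" "hermitian c"
  shows "Re (synth (transport c c) x)
    = - (\<Sum>i\<in>UNIV. Re (synth (velocity_coeff i c) x) * Re (synth (deriv_coeff i c) x))"
proof -
  have "Im (synth (velocity_coeff i c) x) = 0" for i
    using synth_hermitian[OF hermitian_velocity_coeff[OF assms(3)], of i x] by (metis Im_complex_of_real)
  then show ?thesis
    unfolding l1_transport(2)[OF assms(1,2)] by (simp add: sum_2)
qed

lemma Re_synth_has_derivative:
  assumes "2 < s" "sob_bound s R c"
  shows "((\<lambda>x. Re (synth c x)) has_derivative (\<lambda>\<xi>. (\<chi> i. Re (synth (deriv_coeff i c) x)) \<bullet> \<xi>)) (at x)"
proof -
  have "(synth c has_derivative (\<lambda>\<xi>. \<Sum>i\<in>UNIV. complex_of_real (\<xi> $ i) * synth (deriv_coeff i c) x)) (at x)"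
    by (rule synth_has_derivative[OF sob_bound_weighted_summable[OF assms(2,1)]])
  from bounded_linear.has_derivative[OF bounded_linear_Re this]
  show ?thesis
    by (rule has_derivative_eq_rhs) (simp add: fun_eq_iff inner_vec_def mult.commute)
qed

context
  fixes s R T :: real and c :: "real \<Rightarrow> int^2 \<Rightarrow> complex"
  assumes s: "2 < s" and T: "0 < T"
    and c: "\<And>t. t \<in> {0..T} \<Longrightarrow> sob_bound s R (c t)"
    and herm: "\<And>t. t \<in> {0..T} \<Longrightarrow> hermitian (c t)"
    and ode: "\<And>t k. t \<in> {0..T} \<Longrightarrow> ((\<lambda>\<tau>. c \<tau> k) has_vector_derivative transport (c t) (c t) k) (at t within {0..T})"
begin

lemma coeff_continuous: "continuous_on {0..T} (\<lambda>t. c t k)"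
  by (auto simp: continuous_on_eq_continuous_within intro: has_vector_derivative_continuous[OF ode])

lemma synth_deriv_continuous: "continuous_on ({0..T} \<times> UNIV) (\<lambda>p. synth (deriv_coeff i (c (fst p))) (snd p))"
proof (rule continuous_on_synth_sob_bound[OF s c])
  show "cmod (deriv_coeff i (c t) k) \<le> bracket k * cmod (c t k)" for t k
    by (rule cmod_deriv_coeff_le)
  show "continuous_on {0..T} (\<lambda>t. deriv_coeff i (c t) k)" for k
    unfolding deriv_coeff_def by (intro continuous_intros coeff_continuous)
qed auto

lemma synth_velocity_continuous: "continuous_on ({0..T} \<times> UNIV) (\<lambda>p. synth (velocity_coeff i (c (fst p))) (snd p))"
proof (rule continuous_on_synth_sob_bound[OF s c])
  show "cmod (velocity_coeff i (c t) k) \<le> bracket k * cmod (c t k)" for t k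
    by (rule order_trans[OF cmod_velocity_coeff_le cmod_le_bracket_mult])
  show "continuous_on {0..T} (\<lambda>t. velocity_coeff i (c t) k)" for k
    unfolding velocity_coeff_def by (intro continuous_intros coeff_continuous)
qed auto

lemma synth_transport_continuous:
  "continuous_on ({0..T} \<times> UNIV) (\<lambda>p. synth (transport (c (fst p)) (c (fst p))) (snd p))"
proof -
  have "continuous_on ({0..T} \<times> UNIV)
     (\<lambda>p. - (\<Sum>i\<in>UNIV. synth (velocity_coeff i (c (fst p))) (snd p) * synth (deriv_coeff i (c (fst p))) (snd p)))"
    by (intro continuous_intros synth_velocity_continuous synth_deriv_continuous)
  then show ?thesis
    by (rule continuous_on_cong[THEN iffD1, rotated 2]) (use l1_transport(2)[OF s c] in auto)
qed

text \<open>The partial sums satisfy the integrated equation term by term. Their integrands converge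
  pointwise and are dominated by a constant, since the transport term is bounded in \<open>l\<^sup>1\<close>; the limit
  integrand is continuous, so the fundamental theorem of calculus applies. Dominated convergence replaces
  any uniform control of the tails of the transport term.\<close>

lemma synth_time_derivative:
  assumes t: "t \<in> {0..T}"
  shows "((\<lambda>\<tau>. synth (c \<tau>) x) has_vector_derivative synth (transport (c t) (c t)) x) (at t within {0..T})"
proof -
  let ?G = "\<lambda>\<tau>. synth (transport (c \<tau>) (c \<tau>)) x"
  have "continuous_on {0..T} (\<lambda>\<tau>. (\<lambda>p. synth (transport (c (fst p)) (c (fst p))) (snd p)) (\<tau>, x))"
    by (rule continuous_on_compose2[OF synth_transport_continuous]) (auto intro!: continuous_intros)
  then have G: "continuous_on {0..T} ?G" by simp
  have tc: "continuous_on {0..T} (\<lambda>\<tau>. partial_synth N (c \<tau>) x)" for N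
    unfolding partial_synth_def by (intro continuous_intros coeff_continuous)
  have eq: "synth (c t) x = synth (c 0) x + integral {0..t} ?G" if t: "t \<in> {0..T}" for t
  proof -
    have int: "((\<lambda>\<tau>. partial_synth N (transport (c \<tau>) (c \<tau>)) x) has_integral
        partial_synth N (c t) x - partial_synth N (c 0) x) {0..t}" for N
    proof (rule fundamental_theorem_of_calculus)
      show "0 \<le> t" using t by simp
      fix \<tau> assume \<tau>: "\<tau> \<in> {0..t}"
      have "((\<lambda>\<tau>. c \<tau> k * wave k x) has_vector_derivative transport (c \<tau>) (c \<tau>) k * wave k x) (at \<tau> within {0..t})" for k
        by (rule has_vector_derivative_mult_left, rule has_vector_derivative_within_subset[OF ode]) (use \<tau> t in auto)
      then show "((\<lambda>\<tau>. partial_synth N (c \<tau>) x) has_vector_derivative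
          partial_synth N (transport (c \<tau>) (c \<tau>)) x) (at \<tau> within {0..t})"
        unfolding partial_synth_def by (intro has_vector_derivative_sum)
    qed
    have "(\<lambda>N. integral {0..t} (\<lambda>\<tau>. partial_synth N (transport (c \<tau>) (c \<tau>)) x)) \<longlonglongrightarrow> integral {0..t} ?G"
    proof (rule dominated_convergence(2)[where h = "\<lambda>_. 2 * (emb_const s UNIV * R)\<^sup>2"])
      show "(\<lambda>\<tau>. partial_synth N (transport (c \<tau>) (c \<tau>)) x) integrable_on {0..t}" for N
        using int by (rule has_integral_integrable)
      show "cmod (partial_synth N (transport (c \<tau>) (c \<tau>)) x) \<le> 2 * (emb_const s UNIV * R)\<^sup>2" if "\<tau> \<in> {0..t}" for N \<tau>
      proof -
        have "\<tau> \<in> {0..T}" using that t by auto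
        then show ?thesis
          using cmod_partial_synth_le[OF l1_transport(1)[OF s c]] infsum_transport_le[OF s c] order_trans by blast
      qed
      show "(\<lambda>N. partial_synth N (transport (c \<tau>) (c \<tau>)) x) \<longlonglongrightarrow> ?G \<tau>" if "\<tau> \<in> {0..t}" for \<tau>
        using that t by (intro partial_synth_tendsto l1_transport(1)[OF s c]) auto
    qed auto
    then have "(\<lambda>N. partial_synth N (c t) x - partial_synth N (c 0) x) \<longlonglongrightarrow> integral {0..t} ?G"
      by (simp only: integral_unique[OF int])
    moreover have "(\<lambda>N. partial_synth N (c t) x - partial_synth N (c 0) x) \<longlonglongrightarrow> synth (c t) x - synth (c 0) x"
      using t T by (intro tendsto_diff partial_synth_tendsto sob_bound_summable[OF c s]) auto
    ultimately have "synth (c t) x - synth (c 0) x = integral {0..t} ?G" using LIMSEQ_unique by blast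
    then show ?thesis by (simp add: algebra_simps)
  qed
  have "((\<lambda>t. synth (c 0) x + integral {0..t} ?G) has_vector_derivative 0 + ?G t) (at t within {0..T})"
    by (intro has_vector_derivative_add has_vector_derivative_const integral_has_vector_derivative G t)
  then have "((\<lambda>t. synth (c 0) x + integral {0..t} ?G) has_vector_derivative ?G t) (at t within {0..T})"
    by simp
  then show ?thesis
    by (rule has_vector_derivative_transform[OF t, rotated]) (rule eq)
qed

definition "sol t x = Re (synth (c t) x)"
definition "grad t x = (\<chi> i. Re (synth (deriv_coeff i (c t)) x))"
definition "vel t x = (\<chi> i. Re (synth (velocity_coeff i (c t)) x))"
definition "time_deriv t x = Re (synth (transport (c t) (c t)) x)"

lemma sol_has_derivative:
  assumes t: "t \<in> {0..T}"
  shows "(sol t has_derivative (\<lambda>\<xi>. grad t x \<bullet> \<xi>)) (at x)"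
  unfolding sol_def[abs_def] grad_def by (rule Re_synth_has_derivative[OF s c[OF t]])

lemma sol_time_derivative:
  assumes "t \<in> {0..T}"
  shows "((\<lambda>\<tau>. sol \<tau> x) has_vector_derivative time_deriv t x) (at t within {0..T})"
  unfolding sol_def time_deriv_def
  by (rule bounded_linear.has_vector_derivative[OF bounded_linear_Re synth_time_derivative[OF assms]])

lemma time_deriv_eq:
  assumes t: "t \<in> {0..T}"
  shows "time_deriv t x = - (\<Sum>i\<in>UNIV. vel t x $ i * grad t x $ i)"
  unfolding time_deriv_def vel_def grad_def vec_lambda_beta by (rule Re_synth_transport[OF s c[OF t] herm[OF t]])

text \<open>Continuity of the two partial derivatives, in time and in space, gives the total one.\<close>

lemma sol_C1: "C1_on ({0..T} \<times> UNIV) (\<lambda>(t, x). sol t x)"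
proof -
  define D :: "real \<times> (real^2) \<Rightarrow> (real \<times> (real^2)) \<Rightarrow>\<^sub>L real" where
    "D p = time_deriv (fst p) (snd p) *\<^sub>R fst_blinfun + (blinfun_inner_right (grad (fst p) (snd p)) o\<^sub>L snd_blinfun)" for p
  have gcont: "continuous_on ({0..T} \<times> UNIV) (\<lambda>p. grad (fst p) (snd p))"
    unfolding grad_def by (intro continuous_on_vec_lambda continuous_intros synth_deriv_continuous)
  have tcont: "continuous_on ({0..T} \<times> UNIV) (\<lambda>p. time_deriv (fst p) (snd p))"
    unfolding time_deriv_def by (intro continuous_intros synth_transport_continuous)
  have bcont: "continuous_on ({0..T} \<times> UNIV) (\<lambda>p. blinfun_inner_right (grad (fst p) (snd p)))"
    by (intro bounded_linear.continuous_on[OF bounded_linear_blinfun_inner_right] gcont)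
  have "continuous_on ({0..T} \<times> UNIV) D"
    unfolding D_def
    by (intro continuous_intros tcont bounded_bilinear.continuous_on[OF bounded_bilinear_blinfun_compose] bcont)
  moreover have "((\<lambda>(t, x). sol t x) has_derivative blinfun_apply (D p)) (at p within {0..T} \<times> UNIV)"
    if p: "p \<in> {0..T} \<times> UNIV" for p
  proof -
    obtain t x where tx: "p = (t, x)" by (cases p)
    have t: "t \<in> {0..T}" using p tx by simp
    have "((\<lambda>(t, x). sol t x) has_derivative (\<lambda>(tx, ty). tx *\<^sub>R time_deriv t x + blinfun_inner_right (grad t x) ty))
        (at (t, x) within {0..T} \<times> UNIV)"
    proof (rule has_derivative_partialsI[where fy = "\<lambda>t x. blinfun_inner_right (grad t x)"])
      show "((\<lambda>t. sol t x) has_derivative (\<lambda>h. h *\<^sub>R time_deriv t x)) (at t within {0..T})"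
        using sol_time_derivative[OF t] by (simp add: has_vector_derivative_def)
      show "(sol t has_derivative blinfun_apply (blinfun_inner_right (grad t x))) (at x within UNIV)" if "t \<in> {0..T}" for t x
        using sol_has_derivative[OF that] by simp
      show "continuous (at (t, x) within {0..T} \<times> UNIV) (\<lambda>(t, x). blinfun_inner_right (grad t x))"
        using bcont t by (auto simp: continuous_on_eq_continuous_within case_prod_unfold)
    qed auto
    moreover have "(\<lambda>(tx, ty). tx *\<^sub>R time_deriv t x + blinfun_inner_right (grad t x) ty) = blinfun_apply (D p)"
      by (auto simp: fun_eq_iff D_def tx blinfun.add_left blinfun.scaleR_left)
    ultimately show ?thesis by (simp add: tx)
  qed
  ultimately show ?thesis unfolding C1_on_def by blast
qed

lemma sol_is_solution:
  assumes zero: "\<And>t. t \<in> {0..T} \<Longrightarrow> c t 0 = 0" and init: "AE x in lebesgue. sol 0 x = \<theta>\<^sub>0 x"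
  shows "ipmb_smooth_solution 0 \<theta>\<^sub>0 T sol"
  unfolding ipmb_smooth_solution_def
proof (intro conjI ballI allI exI[of _ vel])
  show "C1_on ({0..T} \<times> UNIV) (\<lambda>(t, x). sol t x)" by (rule sol_C1)
  show "AE x in lebesgue. sol 0 x = \<theta>\<^sub>0 x" by (rule init)
  have "continuous_on ({0..T} \<times> UNIV) (\<lambda>p. vel (fst p) (snd p))"
    unfolding vel_def by (intro continuous_on_vec_lambda continuous_intros synth_velocity_continuous)
  then show "continuous_on ({0..T} \<times> UNIV) (\<lambda>(t, x). vel t x)" by (simp add: case_prod_unfold)
  fix t assume t: "t \<in> {0..T}"
  have l1: "l1 (c t)" using sob_bound_summable[OF c[OF t] s] .
  have coef: "fourier_coeff (sol t) = c t"
    unfolding sol_def[abs_def] by (rule fourier_coeff_synth[OF l1 herm[OF t]])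
  show "torus_periodic (sol t)" unfolding sol_def[abs_def] by (rule Re_synth_periodic)
  show "zero_mean (sol t)" by (simp add: zero_mean_iff coef zero[OF t])
  have "sol t \<in> torus_L2" unfolding sol_def[abs_def] by (rule Re_synth_torus_L2[OF l1])
  moreover have vcoef: "fourier_coeff (\<lambda>x. vel t x $ i) = velocity_coeff i (c t)" for i
    unfolding vel_def vec_lambda_beta by (rule fourier_coeff_synth[OF l1_velocity_coeff[OF l1] hermitian_velocity_coeff[OF herm[OF t]]])
  moreover have "(\<lambda>x. vel t x $ i) \<in> torus_L2" for i
    unfolding vel_def vec_lambda_beta by (rule Re_synth_torus_L2[OF l1_velocity_coeff[OF l1]])
  ultimately show "fourier_multiplier (M1_symbol 0) (sol t) (\<lambda>x. vel t x $ 1)"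
    "fourier_multiplier (M2_symbol 0) (sol t) (\<lambda>x. vel t x $ 2)"
    by (auto simp: fourier_multiplier_def coef vcoef velocity_coeff_def)
  fix x
  have "vector_derivative (\<lambda>\<tau>. sol \<tau> x) (at t within {0..T}) = time_deriv t x"
    by (rule vector_derivative_within_closed_interval[OF T t sol_time_derivative[OF t]])
  moreover have "frechet_derivative (sol t) (at x) = (\<lambda>\<xi>. grad t x \<bullet> \<xi>)"
    using frechet_derivative_at[OF sol_has_derivative[OF t]] by simp
  ultimately show "vector_derivative (\<lambda>\<tau>. sol \<tau> x) (at t within {0..T})
      + (\<Sum>i\<in>UNIV. vel t x $ i * frechet_derivative (sol t) (at x) (axis i 1)) = 0"
    by (simp add: time_deriv_eq[OF t] inner_axis)
qed

end

section \<open>Strong measurability\<close>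

lemma simple_function_floor:
  assumes h: "0 < h"
  shows "simple_function (lebesgue_on {0<..<T}) (\<lambda>t::real. \<lfloor>t / h\<rfloor>)"
  unfolding simple_function_eq_measurable
proof
  have "(\<lambda>t::real. \<lfloor>t / h\<rfloor>) ` space (lebesgue_on {0<..<T}) \<subseteq> {0..\<lfloor>T / h\<rfloor>}"
    using h by (auto intro!: floor_mono divide_right_mono)
  then show "finite ((\<lambda>t::real. \<lfloor>t / h\<rfloor>) ` space (lebesgue_on {0<..<T}))"
    by (rule finite_subset) simp
  have "(\<lambda>t::real. \<lfloor>t / h\<rfloor>) \<in> lborel \<rightarrow>\<^sub>M count_space UNIV" by measurable
  then show "(\<lambda>t::real. \<lfloor>t / h\<rfloor>) \<in> lebesgue_on {0<..<T} \<rightarrow>\<^sub>M count_space UNIV"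
    by (intro measurable_restrict_space1 measurable_completion)
qed

text \<open>Truncating nearby coefficients: inside the box the error is uniform, outside only the tail
  of \<open>c\<close> is left.\<close>

lemma sob_bound_trunc_diff:
  assumes c: "sob_bound s R c" and d: "\<And>k. cmod (d k - c k) \<le> \<delta>"
  shows "sob_bound s (sqrt (\<delta>\<^sup>2 * box_weight s n + (\<Sum>\<^sub>\<infinity>k\<in>- freq_box n. (bracket k powr s * cmod (c k))\<^sup>2)))
    (\<lambda>k. trunc n d k - c k)"
proof -
  let ?q = "\<lambda>k. (bracket k powr s * cmod (c k))\<^sup>2"
  let ?tail = "\<Sum>\<^sub>\<infinity>k\<in>- freq_box n. ?q k"
  have tail: "0 \<le> ?tail" by (intro infsum_nonneg) simp
  have sumq: "?q summable_on - freq_box n"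
    by (rule summable_on_subset_banach[OF sob_bound_summable_sq(1)[OF c]]) simp
  show ?thesis
    unfolding sob_bound_def
  proof (intro conjI allI impI)
    fix F :: "(int^2) set" assume F: "finite F"
    let ?e = "\<lambda>k. (bracket k powr s * cmod (trunc n d k - c k))\<^sup>2"
    have "(\<Sum>k\<in>F. ?e k) = (\<Sum>k\<in>F \<inter> freq_box n. ?e k) + (\<Sum>k\<in>F - freq_box n. ?e k)"
      using F by (rule sum.Int_Diff)
    also have "(\<Sum>k\<in>F \<inter> freq_box n. ?e k) \<le> (\<Sum>k\<in>freq_box n. \<delta>\<^sup>2 * (bracket k powr s)\<^sup>2)"
    proof (rule sum_le_included[where i = "\<lambda>k. k"])
      have "?e k \<le> \<delta>\<^sup>2 * (bracket k powr s)\<^sup>2" if "k \<in> freq_box n" for k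
      proof -
        have "(cmod (trunc n d k - c k))\<^sup>2 \<le> \<delta>\<^sup>2"
          using that d[of k] by (intro power_mono) (auto simp: trunc_def)
        then have "(bracket k powr s)\<^sup>2 * (cmod (trunc n d k - c k))\<^sup>2 \<le> (bracket k powr s)\<^sup>2 * \<delta>\<^sup>2"
          by (intro mult_left_mono) auto
        then show ?thesis by (simp add: power_mult_distrib mult.commute)
      qed
      then show "\<forall>k\<in>F \<inter> freq_box n. \<exists>l\<in>freq_box n. l = k \<and> ?e k \<le> \<delta>\<^sup>2 * (bracket l powr s)\<^sup>2" by auto
    qed (use F in auto)
    also have "(\<Sum>k\<in>F - freq_box n. ?e k) = (\<Sum>k\<in>F - freq_box n. ?q k)"
      by (intro sum.cong) (auto simp: trunc_def)
    also have "\<dots> \<le> ?tail" using F sumq by (intro finite_sum_le_infsum) auto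
    finally have "(\<Sum>k\<in>F. ?e k) \<le> \<delta>\<^sup>2 * box_weight s n + ?tail"
      by (simp add: box_weight_def sum_distrib_left)
    also have "\<dots> = (sqrt (\<delta>\<^sup>2 * box_weight s n + ?tail))\<^sup>2"
      using tail by (simp add: add_nonneg_nonneg)
    finally show "(\<Sum>k\<in>F. ?e k) \<le> (sqrt (\<delta>\<^sup>2 * box_weight s n + ?tail))\<^sup>2" by simp
  qed (use tail in \<open>simp add: add_nonneg_nonneg\<close>)
qed

lemma synth_diff:
  assumes "l1 a" "l1 b"
  shows "synth (\<lambda>k. a k - b k) x = synth a x - synth b x"
proof -
  have "((\<lambda>k. a k * wave k x + - (b k * wave k x)) has_sum (synth a x + - synth b x)) UNIV"
    by (intro has_sum_add has_sum_uminusI synth_has_sum assms)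
  then show ?thesis unfolding synth_def[of "\<lambda>k. a k - b k"] by (intro infsumI) (simp add: left_diff_distrib)
qed

text \<open>The simple functions freeze time on a grid and truncate frequencies. The grid of the \<open>n\<close>-th
  function is fine enough for the Lipschitz bound on single coefficients to beat the total
  weight of the box, so the approximation converges in \<open>H\<^sup>s\<close>.\<close>

lemma synth_Linf_sobolev:
  fixes c :: "real \<Rightarrow> int^2 \<Rightarrow> complex"
  assumes s: "2 < s" and c: "\<And>t. t \<in> {0..T} \<Longrightarrow> sob_bound s R (c t)"
    and herm: "\<And>t. t \<in> {0..T} \<Longrightarrow> hermitian (c t)"
    and lip: "\<And>t t' k. t \<in> {0..T} \<Longrightarrow> t' \<in> {0..T} \<Longrightarrow> cmod (c t' k - c t k) \<le> L * \<bar>t' - t\<bar>"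
  shows "(\<lambda>t x. Re (synth (c t) x)) \<in> Linf_sobolev T s"
proof -
  define h where "h n = 1 / ((real n + 1) * (1 + box_weight s n))" for n
  have w1: "0 < 1 + box_weight s n" for n using box_weight_nonneg[of s n] by linarith
  have h: "0 < h n" for n unfolding h_def using w1[of n] by (intro divide_pos_pos mult_pos_pos) auto
  have h1: "h n \<le> 1 / (real n + 1)" for n
    unfolding h_def using mult_left_mono[of 1 "1 + box_weight s n" "real n + 1"] by (intro frac_le) auto
  have h2: "h n * box_weight s n \<le> 1" for n
  proof -
    have "box_weight s n \<le> (real n + 1) * (1 + box_weight s n)"
      using mult_right_mono[of 1 "real n + 1" "1 + box_weight s n"] by simp
    then have "box_weight s n / ((real n + 1) * (1 + box_weight s n)) \<le> 1"
      using w1[of n] by (subst divide_le_eq_1_pos) (auto intro: mult_pos_pos)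
    then show ?thesis by (simp add: h_def)
  qed
  define \<tau> where "\<tau> n t = h n * real_of_int \<lfloor>t / h n\<rfloor>" for n t
  have \<tau>: "\<tau> n t \<in> {0..T}" "\<bar>\<tau> n t - t\<bar> \<le> h n" if t: "t \<in> {0<..<T}" for n t
  proof -
    have "real_of_int \<lfloor>t / h n\<rfloor> * h n \<le> t" "t < (real_of_int \<lfloor>t / h n\<rfloor> + 1) * h n"
      using floor_divide_lower[OF h] floor_divide_upper[OF h] by auto
    moreover have "0 \<le> \<tau> n t" unfolding \<tau>_def using h[of n] t by (intro mult_nonneg_nonneg) auto
    ultimately show "\<tau> n t \<in> {0..T}" "\<bar>\<tau> n t - t\<bar> \<le> h n"
      using t by (auto simp: \<tau>_def algebra_simps)
  qed
  define g where "g n t x = Re (synth (trunc n (c (\<tau> n t))) x)" for n t x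
  have simple: "simple_function (lebesgue_on {0<..<T}) (g n)" for n
  proof -
    have "g n = (\<lambda>j x. Re (synth (trunc n (c (h n * real_of_int j))) x)) \<circ> (\<lambda>t. \<lfloor>t / h n\<rfloor>)"
      by (simp add: fun_eq_iff g_def \<tau>_def)
    then show ?thesis using simple_function_compose[OF simple_function_floor[OF h]] by simp
  qed
  have gs: "g n t \<in> sobolev s" if t: "t \<in> {0<..<T}" for n t
    unfolding g_def[abs_def]
    by (rule synth_sobolev(1)[OF trunc_sob_bound[OF c] trunc_hermitian[OF herm] s]) (use \<tau>[OF t] in auto)
  have conv: "(\<lambda>n. sobolev_norm s (\<lambda>x. g n t x - Re (synth (c t) x))) \<longlonglongrightarrow> 0" if t: "t \<in> {0<..<T}" for t
  proof -
    have tT: "t \<in> {0..T}" using t by auto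
    have L: "0 \<le> L"
    proof -
      have "0 \<le> L * \<bar>t - 0\<bar>" using lip[of 0 t 0] tT order_trans[OF norm_ge_zero] by fastforce
      then show ?thesis using t by (simp add: zero_le_mult_iff)
    qed
    define tail where "tail n = (\<Sum>\<^sub>\<infinity>k\<in>- freq_box n. (bracket k powr s * cmod (c t k))\<^sup>2)" for n
    have tail: "tail \<longlonglongrightarrow> 0"
      unfolding tail_def by (rule infsum_outside_box_tendsto[OF sob_bound_summable_sq(1)[OF c[OF tT]]])
    have le: "sobolev_norm s (\<lambda>x. g n t x - Re (synth (c t) x)) \<le> sqrt (L\<^sup>2 * (1 / (real n + 1)) + tail n)" for n
    proof -
      let ?d = "\<lambda>k. trunc n (c (\<tau> n t)) k - c t k"
      have "cmod (c (\<tau> n t) k - c t k) \<le> L * h n" for k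
        using lip[OF tT \<tau>(1)[OF t], where k = k] \<tau>(2)[OF t] L by (meson mult_left_mono order_trans)
      from sob_bound_trunc_diff[OF c[OF tT] this, of n]
      have "sob_bound s (sqrt ((L * h n)\<^sup>2 * box_weight s n + tail n)) ?d"
        by (simp add: tail_def)
      moreover have "(L * h n)\<^sup>2 * box_weight s n \<le> L\<^sup>2 * (1 / (real n + 1))"
      proof -
        have "h n * (h n * box_weight s n) \<le> 1 / (real n + 1) * 1"
          using h1 h2 h[of n] by (intro mult_mono) auto
        then have "L\<^sup>2 * (h n * (h n * box_weight s n)) \<le> L\<^sup>2 * (1 / (real n + 1))"
          by (intro mult_left_mono) auto
        then show ?thesis by (simp add: power_mult_distrib power2_eq_square mult_ac)
      qed
      ultimately have d: "sob_bound s (sqrt (L\<^sup>2 * (1 / (real n + 1)) + tail n)) ?d"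
        by (elim sob_bound_mono) (intro real_sqrt_le_mono add_right_mono)
      have "l1 (trunc n (c (\<tau> n t)))" "l1 (c t)"
        using sob_bound_summable[OF trunc_sob_bound[OF c[OF \<tau>(1)[OF t]]] s] sob_bound_summable[OF c[OF tT] s] by auto
      then have eq: "(\<lambda>x. g n t x - Re (synth (c t) x)) = (\<lambda>x. Re (synth ?d x))"
        by (simp add: g_def synth_diff fun_eq_iff)
      have "hermitian ?d"
        using trunc_hermitian[OF herm[OF \<tau>(1)[OF t]], of n n] herm[OF tT] by (simp add: hermitian_def)
      then show ?thesis unfolding eq by (rule synth_sobolev(2)[OF d _ s])
    qed
    show ?thesis
    proof (rule tendsto_sandwich[OF _ _ tendsto_const])
      show "\<forall>\<^sub>F n in sequentially. 0 \<le> sobolev_norm s (\<lambda>x. g n t x - Re (synth (c t) x))"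
        by (intro always_eventually allI) (simp add: sobolev_norm_eq infsum_nonneg)
      show "\<forall>\<^sub>F n in sequentially. sobolev_norm s (\<lambda>x. g n t x - Re (synth (c t) x)) \<le> sqrt (L\<^sup>2 * (1 / (real n + 1)) + tail n)"
        using le by (intro always_eventually allI)
      have "(\<lambda>n. 1 / (real n + 1)) \<longlonglongrightarrow> 0"
        using LIMSEQ_inverse_real_of_nat by (simp add: inverse_eq_divide add.commute)
      from tendsto_real_sqrt[OF tendsto_add[OF tendsto_mult[OF tendsto_const[of "L\<^sup>2"] this] tail]]
      show "(\<lambda>n. sqrt (L\<^sup>2 * (1 / (real n + 1)) + tail n)) \<longlonglongrightarrow> 0" by simp
    qed
  qed
  have sob: "(\<lambda>x. Re (synth (c t) x)) \<in> sobolev s" "sobolev_norm s (\<lambda>x. Re (synth (c t) x)) \<le> R" if "t \<in> {0<..<T}" for t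
    using synth_sobolev[OF c herm s, of t] that by auto
  show ?thesis
    unfolding Linf_sobolev_def mem_Collect_eq
  proof (intro conjI exI[of _ g] exI[of _ R] allI ballI)
    show "AE t in lebesgue_on {0<..<T}. (\<lambda>x. Re (synth (c t) x)) \<in> sobolev s"
      by (intro AE_I2) (use sob in auto)
    show "AE t in lebesgue_on {0<..<T}. (\<lambda>n. sobolev_norm s (\<lambda>x. g n t x - Re (synth (c t) x))) \<longlonglongrightarrow> 0"
      by (intro AE_I2) (use conv in auto)
    show "AE t in lebesgue_on {0<..<T}. sobolev_norm s (\<lambda>x. Re (synth (c t) x)) \<le> R"
      by (intro AE_I2) (use sob in auto)
  qed (use simple gs in auto)
qed

section \<open>Uniqueness in frequency space\<close>

lemma gronwall:
  fixes f :: "real \<Rightarrow> real"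
  assumes f: "\<And>t. t \<in> {0..T} \<Longrightarrow> (f has_real_derivative f' t) (at t within {0..T})"
    and le: "\<And>t. t \<in> {0..T} \<Longrightarrow> f' t \<le> K * f t + \<eta>" and f0: "f 0 = 0"
    and K: "0 \<le> K" "0 \<le> \<eta>" and t: "t \<in> {0..T}"
  shows "f t \<le> \<eta> * t * exp (K * t)"
proof -
  \<comment> \<open>The differential inequality says exactly that this function does not increase.\<close>
  define \<phi> where "\<phi> t = f t * exp (- K * t) - \<eta> * t" for t
  have d: "(\<phi> has_real_derivative (f' t - K * f t) * exp (- K * t) - \<eta>) (at t within {0..T})" if "t \<in> {0..T}" for t
    unfolding \<phi>_def by (rule derivative_eq_intros f[OF that] refl)+ (simp add: algebra_simps)
  have "\<phi> t \<le> \<phi> 0"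
  proof (rule DERIV_nonpos_imp_decreasing_open[of 0 t \<phi>])
    show "0 \<le> t" using t by simp
    show "continuous_on {0..t} \<phi>"
    proof -
      have "(\<phi> has_real_derivative (f' \<tau> - K * f \<tau>) * exp (- K * \<tau>) - \<eta>) (at \<tau> within {0..t})" if "\<tau> \<in> {0..t}" for \<tau>
        by (rule has_field_derivative_subset[OF d]) (use t that in auto)
      then show ?thesis by (rule DERIV_continuous_on)
    qed
    fix \<tau> assume \<tau>: "0 < \<tau>" "\<tau> < t"
    have mem: "\<tau> \<in> {0..T}" using \<tau> t by auto
    have "(\<phi> has_real_derivative (f' \<tau> - K * f \<tau>) * exp (- K * \<tau>) - \<eta>) (at \<tau>)"
      using d[OF mem] \<tau> t by (simp add: at_within_Icc_at)
    moreover have "(f' \<tau> - K * f \<tau>) * exp (- K * \<tau>) \<le> \<eta> * 1"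
      using le[OF mem] K \<tau> by (intro mult_mono) auto
    ultimately show "\<exists>y. (\<phi> has_real_derivative y) (at \<tau>) \<and> y \<le> 0" by (intro exI conjI) auto
  qed
  then have "f t * exp (- K * t) \<le> \<eta> * t" by (simp add: \<phi>_def f0)
  then have "f t * exp (- K * t) * exp (K * t) \<le> \<eta> * t * exp (K * t)" by (intro mult_right_mono) auto
  then show ?thesis by (simp add: mult.assoc flip: exp_add)
qed

text \<open>Exchanges a finite sum with an infinite one, so that the bound may use the finite sum for
  each \<open>l\<close>.\<close>

lemma pairing_le:
  assumes F: "finite F" and S: "\<And>k. k \<in> F \<Longrightarrow> (f k has_sum S k) X" and g: "g summable_on X"
    and le: "\<And>l. l \<in> X \<Longrightarrow> cmod (\<Sum>k\<in>F. cnj (w k) * f k l) \<le> g l"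
  shows "cmod (\<Sum>k\<in>F. cnj (w k) * S k) \<le> infsum g X"
proof -
  have "((\<lambda>l. \<Sum>k\<in>F. cnj (w k) * f k l) has_sum (\<Sum>k\<in>F. cnj (w k) * S k)) X"
    using F S by (induction F rule: finite_induct) (auto intro!: has_sum_add has_sum_cmult_right)
  from norm_infsum_le[OF this has_sum_infsum[OF g] le] show ?thesis .
qed

lemma transport_split:
  assumes a: "sob_bound s A a" and b: "sob_bound s B b" and s: "2 < s"
  shows "transport a a k - transport b b k = transport a (\<lambda>j. a j - b j) k + transport (\<lambda>j. a j - b j) b k"
proof -
  note w = sob_bound_diff[OF a b]
  have "((\<lambda>l. transport_term a a k l + - transport_term b b k l) has_sum (transport a a k + - transport b b k)) UNIV"
    unfolding transport_def
    by (intro has_sum_add has_sum_uminusI has_sum_infsum transport_term_summable[OF a a s] transport_term_summable[OF b b s])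
  moreover have "((\<lambda>l. transport_term a (\<lambda>j. a j - b j) k l + transport_term (\<lambda>j. a j - b j) b k l)
      has_sum (transport a (\<lambda>j. a j - b j) k + transport (\<lambda>j. a j - b j) b k)) UNIV"
    unfolding transport_def
    by (intro has_sum_add has_sum_infsum transport_term_summable[OF a w s] transport_term_summable[OF w b s])
  moreover have "transport_term a a k l + - transport_term b b k l
      = transport_term a (\<lambda>j. a j - b j) k l + transport_term (\<lambda>j. a j - b j) b k l" for l
    by (simp add: transport_term_def algebra_simps)
  ultimately show ?thesis using has_sum_unique by fastforce
qed

lemma l2_shift_le:
  assumes "sob_bound s M c" "0 \<le> s" "finite F"
  shows "(\<Sum>k\<in>F. (cmod (c (k - l)))\<^sup>2) \<le> M\<^sup>2"
proof -
  have "(\<Sum>k\<in>F. (cmod (c (k - l)))\<^sup>2) = (\<Sum>j\<in>(\<lambda>k. k - l) ` F. (cmod (c j))\<^sup>2)"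
    by (subst sum.reindex) (auto simp: inj_on_def)
  also have "\<dots> \<le> M\<^sup>2" using assms by (intro sob_bound_l2) auto
  finally show ?thesis .
qed

definition l2_energy :: "nat \<Rightarrow> (int^2 \<Rightarrow> complex) \<Rightarrow> real" where
  "l2_energy N w = (\<Sum>k\<in>freq_box N. (cmod (w k))\<^sup>2)"

text \<open>The full \<open>l\<^sup>2\<close> norm exceeds its part in the box by a tail that is small uniformly in \<open>w\<close>.\<close>

lemma l2_shift_le_energy:
  assumes w: "sob_bound s M w" and s: "2 < s" and F: "finite F"
  shows "(\<Sum>k\<in>F. (cmod (w (k - l)))\<^sup>2) \<le> l2_energy N w + M * (emb_const s (- freq_box N) * M)"
proof -
  let ?G = "(\<lambda>k. k - l) ` F"
  have "(\<Sum>k\<in>F. (cmod (w (k - l)))\<^sup>2) = (\<Sum>j\<in>?G. (cmod (w j))\<^sup>2)"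
    by (subst sum.reindex) (auto simp: inj_on_def)
  also have "\<dots> = (\<Sum>j\<in>?G \<inter> freq_box N. (cmod (w j))\<^sup>2) + (\<Sum>j\<in>?G - freq_box N. (cmod (w j))\<^sup>2)"
    using F by (intro sum.Int_Diff) auto
  also have "\<dots> \<le> l2_energy N w + M * (emb_const s (- freq_box N) * M)"
  proof (rule add_mono)
    show "(\<Sum>j\<in>?G \<inter> freq_box N. (cmod (w j))\<^sup>2) \<le> l2_energy N w"
      unfolding l2_energy_def by (intro sum_mono2) auto
    have "(\<Sum>j\<in>?G - freq_box N. (cmod (w j))\<^sup>2) \<le> (\<Sum>j\<in>?G - freq_box N. M * (bracket j * cmod (w j)))"
    proof (rule sum_mono)
      fix j
      show "(cmod (w j))\<^sup>2 \<le> M * (bracket j * cmod (w j))"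
        unfolding power2_eq_square using sob_bound_cmod[OF w, of j] s cmod_le_bracket_mult[of "w j" j] sob_bound_nonneg[OF w]
        by (intro mult_mono) auto
    qed
    also have "\<dots> = M * (\<Sum>j\<in>?G - freq_box N. bracket j * cmod (w j))" by (simp add: sum_distrib_left)
    also have "\<dots> \<le> M * (emb_const s (- freq_box N) * M)"
      using F sob_bound_nonneg[OF w] by (intro mult_left_mono sob_bound_weighted_l1[OF w s]) auto
    finally show "(\<Sum>j\<in>?G - freq_box N. (cmod (w j))\<^sup>2) \<le> M * (emb_const s (- freq_box N) * M)" .
  qed
  finally show ?thesis .
qed

text \<open>Transport of the difference by \<open>a\<close>: interactions inside the box cancel by incompressibility, and
  those with frequencies outside the box are controlled by the tail.\<close>

lemma difference_estimate_advected:
  assumes a: "sob_bound s A a" "hermitian a" and w: "sob_bound s M w" and s: "2 < s"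
  shows "Re (\<Sum>k\<in>freq_box N. cnj (w k) * transport a w k) \<le> A * M * (emb_const s (- freq_box N) * M)"
proof -
  let ?F = "freq_box N"
  let ?tail = "\<lambda>k. \<Sum>\<^sub>\<infinity>l\<in>- ?F. transport_term a w k l"
  have split: "transport a w k = (\<Sum>l\<in>?F. transport_term a w k l) + ?tail k" for k
  proof -
    have "infsum (transport_term a w k) (?F \<union> - ?F) = infsum (transport_term a w k) ?F + ?tail k"
      by (intro infsum_Un_disjoint transport_term_summable[OF a(1) w s]) auto
    then show ?thesis by (simp add: transport_def)
  qed
  have "Re (\<Sum>k\<in>?F. \<Sum>l\<in>?F. complex_of_real 1 * cnj (w k) * transport_term a w k l) = 0"
    unfolding energy_antisym[OF a(2), where W = "\<lambda>_. 1"] by simp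
  then have zero: "Re (\<Sum>k\<in>?F. cnj (w k) * (\<Sum>l\<in>?F. transport_term a w k l)) = 0"
    by (simp add: sum_distrib_left)
  have "cmod (\<Sum>k\<in>?F. cnj (w k) * ?tail k) \<le> (\<Sum>\<^sub>\<infinity>l\<in>- ?F. A * M * (bracket l * cmod (w l)))"
  proof (rule pairing_le)
    show "(transport_term a w k has_sum ?tail k) (- ?F)" for k
      by (intro has_sum_infsum transport_term_summable[OF a(1) w s])
    show "(\<lambda>l. A * M * (bracket l * cmod (w l))) summable_on - ?F"
      by (intro summable_on_cmult_right sob_bound_weighted_summable[OF w s])
    fix l
    have "cmod (\<Sum>k\<in>?F. cnj (w k) * transport_term a w k l)
        \<le> (\<Sum>k\<in>?F. cmod (w k) * (cmod (a (k - l)) * (bracket l * cmod (w l))))"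
      by (intro order_trans[OF norm_sum] sum_mono) (simp add: norm_mult mult_left_mono transport_term_le)
    also have "\<dots> = (\<Sum>k\<in>?F. cmod (a (k - l)) * cmod (w k)) * (bracket l * cmod (w l))"
      by (simp add: sum_distrib_left mult_ac)
    also have "\<dots> \<le> (A * M) * (bracket l * cmod (w l))"
      using l2_shift_le[OF a(1) _ finite_freq_box] sob_bound_l2[OF w _ finite_freq_box] s sob_bound_nonneg[OF a(1)] sob_bound_nonneg[OF w]
      by (intro mult_right_mono sum_mult_le_of_squares) auto
    finally show "cmod (\<Sum>k\<in>?F. cnj (w k) * transport_term a w k l) \<le> A * M * (bracket l * cmod (w l))" .
  qed simp
  also have "\<dots> = A * M * (\<Sum>\<^sub>\<infinity>l\<in>- ?F. bracket l * cmod (w l))" by (rule infsum_cmult_right')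
  also have "\<dots> \<le> A * M * (emb_const s (- ?F) * M)"
    using sob_bound_nonneg[OF a(1)] sob_bound_nonneg[OF w]
    by (intro mult_left_mono sob_bound_weighted_infsum[OF w s]) auto
  finally have "Re (\<Sum>k\<in>?F. cnj (w k) * ?tail k) \<le> A * M * (emb_const s (- ?F) * M)"
    using complex_Re_le_cmod order_trans by blast
  then show ?thesis using zero by (simp add: split distrib_left sum.distrib)
qed

text \<open>Transport of \<open>b\<close> by the velocity of the difference: no derivative falls on the difference, so
  Young's inequality suffices.\<close>

lemma difference_estimate_advecting:
  assumes b: "sob_bound s B b" and w: "sob_bound s M w" and s: "2 < s"
  shows "Re (\<Sum>k\<in>freq_box N. cnj (w k) * transport w b k)
    \<le> (l2_energy N w + M * (emb_const s (- freq_box N) * M)) * (emb_const s UNIV * B)"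
proof -
  let ?F = "freq_box N"
  let ?E = "l2_energy N w + M * (emb_const s (- freq_box N) * M)"
  have E0: "0 \<le> l2_energy N w" by (simp add: l2_energy_def sum_nonneg)
  have M: "0 \<le> M" using sob_bound_nonneg[OF w] .
  have E: "0 \<le> ?E" using E0 M by simp
  have "cmod (\<Sum>k\<in>?F. cnj (w k) * transport w b k) \<le> (\<Sum>\<^sub>\<infinity>l. ?E * (bracket l * cmod (b l)))"
  proof (rule pairing_le)
    show "(transport_term w b k has_sum transport w b k) UNIV" for k
      unfolding transport_def by (intro has_sum_infsum transport_term_summable[OF w b s])
    show "(\<lambda>l. ?E * (bracket l * cmod (b l))) summable_on UNIV"
      by (intro summable_on_cmult_right sob_bound_weighted_summable[OF b s])
    fix l
    have "cmod (\<Sum>k\<in>?F. cnj (w k) * transport_term w b k l)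
        \<le> (\<Sum>k\<in>?F. cmod (w k) * (cmod (w (k - l)) * (bracket l * cmod (b l))))"
      by (intro order_trans[OF norm_sum] sum_mono) (simp add: norm_mult mult_left_mono transport_term_le)
    also have "\<dots> = (\<Sum>k\<in>?F. cmod (w (k - l)) * cmod (w k)) * (bracket l * cmod (b l))"
      by (simp add: sum_distrib_left mult_ac)
    also have "\<dots> \<le> ?E * (bracket l * cmod (b l))"
    proof (rule mult_right_mono)
      have "l2_energy N w \<le> ?E" using M by simp
      then have "(\<Sum>k\<in>?F. (cmod (w k))\<^sup>2) \<le> (sqrt ?E)\<^sup>2" using E by (simp add: l2_energy_def)
      moreover have "(\<Sum>k\<in>?F. (cmod (w (k - l)))\<^sup>2) \<le> ?E"
        by (rule l2_shift_le_energy[OF w s finite_freq_box])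
      then have "(\<Sum>k\<in>?F. (cmod (w (k - l)))\<^sup>2) \<le> (sqrt ?E)\<^sup>2" using E by simp
      ultimately have "(\<Sum>k\<in>?F. cmod (w (k - l)) * cmod (w k)) \<le> sqrt ?E * sqrt ?E"
        using E by (intro sum_mult_le_of_squares) auto
      then show "(\<Sum>k\<in>?F. cmod (w (k - l)) * cmod (w k)) \<le> ?E" using E by simp
    qed simp
    finally show "cmod (\<Sum>k\<in>?F. cnj (w k) * transport_term w b k l) \<le> ?E * (bracket l * cmod (b l))" .
  qed simp
  also have "\<dots> = ?E * (\<Sum>\<^sub>\<infinity>l. bracket l * cmod (b l))" by (rule infsum_cmult_right')
  also have "\<dots> \<le> ?E * (emb_const s UNIV * B)"
    using E by (intro mult_left_mono sob_bound_weighted_infsum[OF b s])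
  finally show ?thesis using complex_Re_le_cmod order_trans by blast
qed

text \<open>A Gronwall argument for the \<open>l\<^sup>2\<close> norm of the difference, restricted to a box so that only
  finite sums are differentiated. The error made by the restriction vanishes as the box grows.\<close>

theorem fourier_transport_unique:
  fixes a b :: "real \<Rightarrow> int^2 \<Rightarrow> complex"
  assumes s: "2 < s"
    and a: "\<And>t. t \<in> {0..T} \<Longrightarrow> sob_bound s R (a t)" "\<And>t. t \<in> {0..T} \<Longrightarrow> hermitian (a t)"
      "\<And>t k. t \<in> {0..T} \<Longrightarrow> ((\<lambda>\<tau>. a \<tau> k) has_vector_derivative transport (a t) (a t) k) (at t within {0..T})"
    and b: "\<And>t. t \<in> {0..T} \<Longrightarrow> sob_bound s R (b t)"
      "\<And>t k. t \<in> {0..T} \<Longrightarrow> ((\<lambda>\<tau>. b \<tau> k) has_vector_derivative transport (b t) (b t) k) (at t within {0..T})"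
    and init: "a 0 = b 0" and t: "t \<in> {0..T}"
  shows "a t = b t"
proof
  fix k
  define w where "w t j = a t j - b t j" for t j
  define M where "M = 2 * (R + R)"
  define tail where "tail N = M * (emb_const s (- freq_box N) * M)" for N
  define \<kappa> where "\<kappa> = emb_const s UNIV * R"
  define K where "K = 2 * \<kappa>"
  define \<eta> where "\<eta> N = 2 * (R * tail N + tail N * \<kappa>)" for N
  have R: "0 \<le> R" using a(1)[OF t] sob_bound_nonneg by blast
  have nn: "0 \<le> M" "0 \<le> tail N" "0 \<le> \<kappa>" "0 \<le> K" "0 \<le> \<eta> N" for N
    using R by (auto simp: M_def tail_def \<kappa>_def K_def \<eta>_def)
  have w: "sob_bound s M (w t)" if "t \<in> {0..T}" for t
    unfolding w_def[abs_def] M_def by (rule sob_bound_diff[OF a(1)[OF that] b(1)[OF that]])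
  have energy: "l2_energy N (w t) \<le> \<eta> N * t * exp (K * t)" for N
  proof (rule gronwall[OF _ _ _ nn(4) nn(5) t])
    define D where "D t j = transport (a t) (w t) j + transport (w t) (b t) j" for t j
    let ?F = "freq_box N"
    show "l2_energy N (w 0) = 0" by (simp add: l2_energy_def w_def init)
    fix t assume t: "t \<in> {0..T}"
    have wd: "((\<lambda>\<tau>. w \<tau> j) has_vector_derivative D t j) (at t within {0..T})" for j
      using has_vector_derivative_diff[OF a(3)[OF t, of j] b(2)[OF t, of j]]
      unfolding transport_split[OF a(1)[OF t] b(1)[OF t] s] by (simp add: w_def[abs_def] D_def)
    show "((\<lambda>t. l2_energy N (w t)) has_real_derivative 2 * Re (\<Sum>j\<in>?F. cnj (w t j) * D t j)) (at t within {0..T})"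
    proof -
      have "((\<lambda>\<tau>. (cmod (w \<tau> j))\<^sup>2) has_real_derivative 2 * Re (cnj (w t j) * D t j)) (at t within {0..T})" for j
      proof -
        have re: "((\<lambda>\<tau>. Re (w \<tau> j)) has_real_derivative Re (D t j)) (at t within {0..T})"
          using bounded_linear.has_vector_derivative[OF bounded_linear_Re wd]
          by (simp add: has_real_derivative_iff_has_vector_derivative)
        have im: "((\<lambda>\<tau>. Im (w \<tau> j)) has_real_derivative Im (D t j)) (at t within {0..T})"
          using bounded_linear.has_vector_derivative[OF bounded_linear_Im wd]
          by (simp add: has_real_derivative_iff_has_vector_derivative)
        show ?thesis unfolding cmod_power2
          by (rule derivative_eq_intros re im refl)+ (simp add: algebra_simps)
      qed
      then have "((\<lambda>t. l2_energy N (w t)) has_real_derivative (\<Sum>j\<in>?F. 2 * Re (cnj (w t j) * D t j))) (at t within {0..T})"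
        unfolding l2_energy_def by (intro DERIV_sum)
      moreover have "(\<Sum>j\<in>?F. 2 * Re (cnj (w t j) * D t j)) = 2 * Re (\<Sum>j\<in>?F. cnj (w t j) * D t j)"
        by (simp only: Re_sum sum_distrib_left)
      ultimately show ?thesis by simp
    qed
    have "Re (\<Sum>j\<in>?F. cnj (w t j) * D t j)
        = Re (\<Sum>j\<in>?F. cnj (w t j) * transport (a t) (w t) j) + Re (\<Sum>j\<in>?F. cnj (w t j) * transport (w t) (b t) j)"
      by (simp only: D_def distrib_left sum.distrib plus_complex.sel)
    also have "\<dots> \<le> R * tail N + (l2_energy N (w t) + tail N) * \<kappa>"
      using difference_estimate_advected[OF a(1,2)[OF t] w[OF t] s, of N]
        difference_estimate_advecting[OF b(1)[OF t] w[OF t] s, of N]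
      by (simp add: tail_def \<kappa>_def mult.assoc)
    finally show "2 * Re (\<Sum>j\<in>?F. cnj (w t j) * D t j) \<le> K * l2_energy N (w t) + \<eta> N"
      by (simp add: K_def \<eta>_def algebra_simps)
  qed
  \<comment> \<open>The energy estimate holds for every box; let the boxes exhaust the lattice.\<close>
  have "tail \<longlonglongrightarrow> 0"
    unfolding tail_def by (rule tendsto_eq_intros emb_const_outside_box[OF s] refl)+ simp
  then have lim: "(\<lambda>N. \<eta> N * t * exp (K * t)) \<longlonglongrightarrow> 0"
    unfolding \<eta>_def by (auto intro!: tendsto_eq_intros)
  have "\<forall>\<^sub>F N in sequentially. (cmod (w t k))\<^sup>2 \<le> \<eta> N * t * exp (K * t)"
    using freq_box_eventually[of k]
  proof eventually_elim
    case (elim N)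
    then have "(cmod (w t k))\<^sup>2 \<le> l2_energy N (w t)"
      unfolding l2_energy_def by (intro member_le_sum) auto
    then show ?case using energy[of N] by linarith
  qed
  then have "(cmod (w t k))\<^sup>2 \<le> 0"
    by (rule tendsto_lowerbound[OF lim]) simp
  then show "a t k = b t k" by (simp add: w_def)
qed

section \<open>Coefficients of a classical solution\<close>

text \<open>An open set of times avoiding a set of full measure is negligible, hence empty.\<close>

lemma AE_interval_dense:
  assumes T: "0 < T" and ae: "AE t in lebesgue_on {0<..<T::real}. P t"
  shows "{0..T} \<subseteq> closure {t \<in> {0<..<T}. P t}"
proof -
  let ?G = "{t \<in> {0<..<T}. P t}"
  have "AE t in lebesgue. t \<in> {0<..<T} \<longrightarrow> P t"
    using ae by (subst (asm) AE_restrict_space_iff) auto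
  then have "negligible {t. \<not> (t \<in> {0<..<T} \<longrightarrow> P t)}" by (simp only: AE_lebesgue_iff_negligible)
  moreover have "{0<..<T} - closure ?G \<subseteq> {t. \<not> (t \<in> {0<..<T} \<longrightarrow> P t)}"
    using closure_subset[of ?G] by auto
  ultimately have "negligible ({0<..<T} - closure ?G)" by (rule negligible_subset)
  moreover have "open ({0<..<T} - closure ?G)" by (intro open_Diff) auto
  ultimately have "{0<..<T} - closure ?G = {}" using open_not_negligible by blast
  then have "closure {0<..<T} \<subseteq> closure ?G" by (intro closure_minimal) auto
  then show ?thesis using T by simp
qed

lemma fourier_coeff_cong_AE:
  assumes f: "set_integrable lebesgue torus_cell f" and g: "set_integrable lebesgue torus_cell g"
    and ae: "AE x in lebesgue. f x = g x"
  shows "fourier_coeff f = fourier_coeff g"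
proof
  fix k
  have "(LINT x:torus_cell|lebesgue. complex_of_real (f x) * cnj (wave k x))
      = (LINT x:torus_cell|lebesgue. complex_of_real (g x) * cnj (wave k x))"
    unfolding set_lebesgue_integral_def
  proof (rule integral_cong_AE)
    show "(\<lambda>x. indicat_real torus_cell x *\<^sub>R (complex_of_real (f x) * cnj (wave k x))) \<in> borel_measurable lebesgue"
      "(\<lambda>x. indicat_real torus_cell x *\<^sub>R (complex_of_real (g x) * cnj (wave k x))) \<in> borel_measurable lebesgue"
      using set_integrable_complex_mult_wave[OF f, of k] set_integrable_complex_mult_wave[OF g, of k]
      unfolding set_integrable_def by (auto intro: borel_measurable_integrable)
    show "AE x in lebesgue. indicat_real torus_cell x *\<^sub>R (complex_of_real (f x) * cnj (wave k x))
        = indicat_real torus_cell x *\<^sub>R (complex_of_real (g x) * cnj (wave k x))"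
      using ae by eventually_elim simp
  qed
  then show "fourier_coeff f k = fourier_coeff g k" by (simp add: fourier_coeff_eq_fcoef fcoef_def)
qed

text \<open>The time derivative is the total derivative in the direction \<open>(1, 0)\<close>.\<close>

lemma C1_onE:
  assumes "C1_on ({0..T} \<times> UNIV) (\<lambda>(t, x). \<theta> t x)"
  obtains dt :: "real \<Rightarrow> real^2 \<Rightarrow> real" where
    "continuous_on ({0..T} \<times> UNIV) (\<lambda>(t, x). \<theta> t x)"
    "continuous_on ({0..T} \<times> UNIV) (\<lambda>(t, x). dt t x)"
    "\<And>t x. t \<in> {0..T} \<Longrightarrow> ((\<lambda>\<tau>. \<theta> \<tau> x) has_vector_derivative dt t x) (at t within {0..T})"
proof -
  obtain D :: "real \<times> (real^2) \<Rightarrow> (real \<times> (real^2)) \<Rightarrow>\<^sub>L real" where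
    D: "\<And>p. p \<in> {0..T} \<times> UNIV \<Longrightarrow> ((\<lambda>(t, x). \<theta> t x) has_derivative blinfun_apply (D p)) (at p within {0..T} \<times> UNIV)"
    and cont: "continuous_on ({0..T} \<times> UNIV) D"
    using assms unfolding C1_on_def by blast
  show ?thesis
  proof (rule that[of "\<lambda>t x. D (t, x) (1, 0)"])
    show "continuous_on ({0..T} \<times> UNIV) (\<lambda>(t, x). \<theta> t x)"
      using D has_derivative_continuous unfolding continuous_on_eq_continuous_within by blast
    show "continuous_on ({0..T} \<times> UNIV) (\<lambda>(t, x). D (t, x) (1, 0))"
      using cont by (auto simp: case_prod_unfold intro!: continuous_intros)
    fix t x assume t: "t \<in> {0..T}"
    have d: "((\<lambda>(t, x). \<theta> t x) has_derivative blinfun_apply (D (t, x))) (at (t, x) within (\<lambda>\<tau>. (\<tau>, x)) ` {0..T})"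
      by (rule has_derivative_subset[OF D]) (use t in auto)
    have "((\<lambda>\<tau>. (\<tau>, x)) has_derivative (\<lambda>h. (h, 0))) (at t within {0..T})"
      by (auto intro!: derivative_eq_intros)
    from has_derivative_in_compose[OF this, of "\<lambda>(t, x). \<theta> t x"] d
    have "((\<lambda>\<tau>. \<theta> \<tau> x) has_derivative (\<lambda>h. D (t, x) (h, 0))) (at t within {0..T})" by simp
    moreover have "(\<lambda>h. D (t, x) (h, 0)) = (\<lambda>h. h *\<^sub>R D (t, x) (1, 0))"
    proof
      fix h
      have "(h, 0) = h *\<^sub>R (1::real, 0::real^2)" by simp
      then show "D (t, x) (h, 0) = h *\<^sub>R D (t, x) (1, 0)" by (simp only: blinfun.scaleR_right)
    qed
    ultimately show "((\<lambda>\<tau>. \<theta> \<tau> x) has_vector_derivative D (t, x) (1, 0)) (at t within {0..T})"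
      unfolding has_vector_derivative_def by (simp only:)
  qed
qed

text \<open>Differentiation under the integral sign over the period cell.\<close>

lemma fourier_coeff_time_derivative:
  assumes \<theta>: "continuous_on ({0..T} \<times> UNIV) (\<lambda>(t, x). \<theta> t x)"
    and dt: "continuous_on ({0..T} \<times> UNIV) (\<lambda>(t, x). dt t x)"
    and d: "\<And>t x. t \<in> {0..T} \<Longrightarrow> ((\<lambda>\<tau>. \<theta> \<tau> x) has_vector_derivative dt t x) (at t within {0..T})"
    and t: "t \<in> {0..T}"
  shows "((\<lambda>\<tau>. fourier_coeff (\<theta> \<tau>) k) has_vector_derivative fourier_coeff (dt t) k) (at t within {0..T})"
proof -
  have slice: "continuous_on torus_cell (f t)"
    if "continuous_on ({0..T} \<times> UNIV) (\<lambda>(t, x). f t x)" "t \<in> {0..T}" for f :: "real \<Rightarrow> real^2 \<Rightarrow> real" and t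
  proof -
    have "continuous_on torus_cell (\<lambda>x. (\<lambda>(t, x). f t x) (t, x))"
      by (rule continuous_on_compose2[OF that(1)]) (use that(2) in \<open>auto intro!: continuous_intros\<close>)
    then show ?thesis by simp
  qed
  have coeff: "fourier_coeff (f t) k = (1 / (2 * pi)\<^sup>2) *\<^sub>R integral torus_cell (\<lambda>x. complex_of_real (f t x) * cnj (wave k x))"
    if "continuous_on ({0..T} \<times> UNIV) (\<lambda>(t, x). f t x)" "t \<in> {0..T}" for f :: "real \<Rightarrow> real^2 \<Rightarrow> real" and t
    unfolding fourier_coeff_eq_fcoef by (intro fcoef_has_integral continuous_intros slice[OF that])
  have "((\<lambda>\<tau>. integral (cbox 0 (\<chi> i. 2 * pi)) (\<lambda>x. complex_of_real (\<theta> \<tau> x) * cnj (wave k x))) has_vector_derivative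
      integral (cbox 0 (\<chi> i. 2 * pi)) (\<lambda>x. complex_of_real (dt t x) * cnj (wave k x))) (at t within {0..T})"
  proof (rule leibniz_rule_vector_derivative)
    show "((\<lambda>\<tau>. complex_of_real (\<theta> \<tau> x) * cnj (wave k x)) has_vector_derivative complex_of_real (dt \<tau> x) * cnj (wave k x)) (at \<tau> within {0..T})"
      if "\<tau> \<in> {0..T}" for \<tau> x
      by (rule has_vector_derivative_mult_left[OF bounded_linear.has_vector_derivative[OF bounded_linear_of_real d[OF that]]])
    show "(\<lambda>x. complex_of_real (\<theta> \<tau> x) * cnj (wave k x)) integrable_on cbox 0 (\<chi> i. 2 * pi)" if "\<tau> \<in> {0..T}" for \<tau>
      using slice[OF \<theta> that] unfolding torus_cell_def
      by (intro integrable_continuous continuous_intros continuous_on_id)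
    have "continuous_on ({0..T} \<times> cbox 0 (\<chi> i. 2 * pi)) (\<lambda>(t, x). dt t x)"
      by (rule continuous_on_subset[OF dt]) auto
    then show "continuous_on ({0..T} \<times> cbox 0 (\<chi> i. 2 * pi)) (\<lambda>(t, x). complex_of_real (dt t x) * cnj (wave k x))"
      unfolding case_prod_unfold by (intro continuous_intros)
  qed (use t in auto)
  from bounded_linear.has_vector_derivative[OF bounded_linear_scaleR_right this, of "1 / (2 * pi)\<^sup>2"]
  have "((\<lambda>\<tau>. (1 / (2 * pi)\<^sup>2) *\<^sub>R integral torus_cell (\<lambda>x. complex_of_real (\<theta> \<tau> x) * cnj (wave k x))) has_vector_derivative
      fourier_coeff (dt t) k) (at t within {0..T})"
    unfolding coeff[OF dt t] by (simp add: torus_cell_def)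
  then show ?thesis
    by (rule has_vector_derivative_transform[OF t, rotated]) (rule coeff[OF \<theta>])
qed

text \<open>Every classical solution in \<open>L\<^sup>\<infinity>(0,T;H\<^sup>s)\<close> solves the system of coefficients. The \<open>H\<^sup>s\<close> bound,
  given for almost every time, extends to every time because each finite partial sum of the norm is
  continuous in time. Then the scalar, its velocity and its gradient equal their Fourier series
  everywhere, and the equation can be read off coefficient by coefficient.\<close>

lemma solution_coefficients:
  assumes s: "2 < s" and T: "0 < T" and sol: "ipmb_smooth_solution 0 \<theta>\<^sub>0 T \<theta>" and Linf: "\<theta> \<in> Linf_sobolev T s"
  defines "c \<equiv> \<lambda>t. fourier_coeff (\<theta> t)"
  obtains R where "\<And>t. t \<in> {0..T} \<Longrightarrow> sob_bound s R (c t)"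
    "\<And>t k. t \<in> {0..T} \<Longrightarrow> ((\<lambda>\<tau>. c \<tau> k) has_vector_derivative transport (c t) (c t) k) (at t within {0..T})"
    "\<And>t. t \<in> {0..T} \<Longrightarrow> \<theta> t = (\<lambda>x. Re (synth (c t) x))"
proof -
  have C1: "C1_on ({0..T} \<times> UNIV) (\<lambda>(t, x). \<theta> t x)"
    using sol by (simp add: ipmb_smooth_solution_def)
  obtain u :: "real \<Rightarrow> real^2 \<Rightarrow> real^2" where
    u: "continuous_on ({0..T} \<times> UNIV) (\<lambda>(t, x). u t x)"
    and mult: "\<And>t. t \<in> {0..T} \<Longrightarrow> fourier_multiplier (M1_symbol 0) (\<theta> t) (\<lambda>x. u t x $ 1)"
      "\<And>t. t \<in> {0..T} \<Longrightarrow> fourier_multiplier (M2_symbol 0) (\<theta> t) (\<lambda>x. u t x $ 2)"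
    and pde: "\<And>t x. t \<in> {0..T} \<Longrightarrow> vector_derivative (\<lambda>\<tau>. \<theta> \<tau> x) (at t within {0..T})
           + (\<Sum>i\<in>UNIV. u t x $ i * frechet_derivative (\<theta> t) (at x) (axis i 1)) = 0"
    using sol unfolding ipmb_smooth_solution_def by blast
  obtain dt where \<theta>: "continuous_on ({0..T} \<times> UNIV) (\<lambda>(t, x). \<theta> t x)"
    and dt: "continuous_on ({0..T} \<times> UNIV) (\<lambda>(t, x). dt t x)"
    and d: "\<And>t x. t \<in> {0..T} \<Longrightarrow> ((\<lambda>\<tau>. \<theta> \<tau> x) has_vector_derivative dt t x) (at t within {0..T})"
    using C1_onE[OF C1] by blast
  have c': "((\<lambda>\<tau>. c \<tau> k) has_vector_derivative fourier_coeff (dt t) k) (at t within {0..T})" if "t \<in> {0..T}" for t k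
    unfolding c_def by (rule fourier_coeff_time_derivative[OF \<theta> dt d that])
  have ccont: "continuous_on {0..T} (\<lambda>t. c t k)" for k
    by (auto simp: continuous_on_eq_continuous_within intro: has_vector_derivative_continuous[OF c'])
  obtain C where C: "AE t in lebesgue_on {0<..<T}. \<theta> t \<in> sobolev s" "AE t in lebesgue_on {0<..<T}. sobolev_norm s (\<theta> t) \<le> C"
    using Linf by (auto simp: Linf_sobolev_def)
  define R where "R = \<bar>C\<bar>"
  have "AE t in lebesgue_on {0<..<T}. sob_bound s R (c t)"
    using C by eventually_elim (auto simp: c_def R_def intro!: sobolev_sob_bound)
  then have dense: "{0..T} \<subseteq> closure {t \<in> {0<..<T}. sob_bound s R (c t)}" by (rule AE_interval_dense[OF T])
  have bound: "sob_bound s R (c t)" if t: "t \<in> {0..T}" for t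
    unfolding sob_bound_def
  proof (intro conjI allI impI)
    show "0 \<le> R" by (simp add: R_def)
    fix F :: "(int^2) set" assume F: "finite F"
    let ?G = "{t \<in> {0<..<T}. sob_bound s R (c t)}"
    let ?q = "\<lambda>t. \<Sum>k\<in>F. (bracket k powr s * cmod (c t k))\<^sup>2"
    have "closure ?G \<subseteq> {0..T}" by (rule closure_minimal) auto
    then have "continuous_on (closure ?G) ?q"
      by (intro continuous_intros) (rule continuous_on_subset[OF ccont])
    moreover have "t \<in> closure ?G" using dense t by blast
    ultimately show "?q t \<le> R\<^sup>2"
      by (rule continuous_le_on_closure) (use sob_boundD[OF _ F] in auto)
  qed
  have l1: "l1 (c t)" if "t \<in> {0..T}" for t using sob_bound_summable[OF bound[OF that] s] .
  have herm: "hermitian (c t)" for t unfolding c_def by (rule hermitian_fourier_coeff)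
  have slice: "continuous_on UNIV (f t)"
    if "continuous_on ({0..T} \<times> UNIV) (\<lambda>(t, x). f t x)" "t \<in> {0..T}" for f :: "real \<Rightarrow> real^2 \<Rightarrow> 'z::topological_space" and t
  proof -
    have "continuous_on UNIV (\<lambda>x. (\<lambda>(t, x). f t x) (t, x))"
      by (rule continuous_on_compose2[OF that(1)]) (use that(2) in \<open>auto intro!: continuous_intros\<close>)
    then show ?thesis by simp
  qed
  have eq: "\<theta> t = (\<lambda>x. Re (synth (c t) x))" if t: "t \<in> {0..T}" for t
    unfolding c_def
    using mult(1)[OF t] l1[OF t] by (intro continuous_eq_synth slice[OF \<theta> t]) (auto simp: fourier_multiplier_def c_def)
  have vel: "(\<lambda>x. u t x $ i) = (\<lambda>x. Re (synth (velocity_coeff i (c t)) x))" if t: "t \<in> {0..T}" for t i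
  proof -
    have coef: "fourier_coeff (\<lambda>x. u t x $ i) = velocity_coeff i (c t)" and L2: "(\<lambda>x. u t x $ i) \<in> torus_L2"
      using mult[OF t] exhaust_2[of i] by (auto simp: fourier_multiplier_def velocity_coeff_def c_def fun_eq_iff)
    have "continuous_on UNIV (\<lambda>x. u t x $ i)" by (intro continuous_intros slice[OF u t])
    from continuous_eq_synth[OF L2 this] show ?thesis
      unfolding coef using l1_velocity_coeff[OF l1[OF t]] by simp
  qed
  have ode: "((\<lambda>\<tau>. c \<tau> k) has_vector_derivative transport (c t) (c t) k) (at t within {0..T})" if t: "t \<in> {0..T}" for t k
  proof -
    have "dt t = (\<lambda>x. Re (synth (transport (c t) (c t)) x))"
    proof
      fix x
      have "vector_derivative (\<lambda>\<tau>. \<theta> \<tau> x) (at t within {0..T}) = dt t x"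
        by (rule vector_derivative_within_closed_interval[OF T t d[OF t]])
      moreover have "frechet_derivative (\<theta> t) (at x) (axis i 1) = Re (synth (deriv_coeff i (c t)) x)" for i
        unfolding eq[OF t] frechet_derivative_at[OF Re_synth_has_derivative[OF s bound[OF t], of x], symmetric]
        by (simp add: inner_axis)
      moreover have "u t x $ i = Re (synth (velocity_coeff i (c t)) x)" for i
        using fun_cong[OF vel[OF t]] .
      ultimately have "dt t x = - (\<Sum>i\<in>UNIV. Re (synth (velocity_coeff i (c t)) x) * Re (synth (deriv_coeff i (c t)) x))"
        using pde[OF t, of x] by (simp add: eq_neg_iff_add_eq_0)
      then show "dt t x = Re (synth (transport (c t) (c t)) x)"
        by (simp add: Re_synth_transport[OF s bound[OF t] herm])
    qed
    then have "fourier_coeff (dt t) = transport (c t) (c t)"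
      using fourier_coeff_synth[OF l1_transport(1)[OF s bound[OF t]] transport_hermitian[OF herm herm]] by simp
    then show ?thesis using c'[OF t, of k] by simp
  qed
  show ?thesis using that[OF bound ode eq] .
qed

section \<open>Local well-posedness\<close>

theorem theorem6p10:
  fixes s :: real and \<theta>\<^sub>0 :: "real^2 \<Rightarrow> real"
  assumes "s > 2"
    and "\<theta>\<^sub>0 \<in> sobolev s"
    and "zero_mean \<theta>\<^sub>0"
  shows "\<exists>T>0. \<exists>\<theta> :: real \<Rightarrow> real^2 \<Rightarrow> real.
           ipmb_smooth_solution 0 \<theta>\<^sub>0 T \<theta> \<and> \<theta> \<in> Linf_sobolev T s \<and>
           (\<forall>\<theta>'. ipmb_smooth_solution 0 \<theta>\<^sub>0 T \<theta>' \<and> \<theta>' \<in> Linf_sobolev T s \<longrightarrow>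
                 (\<forall>t\<in>{0..T}. \<forall>x. \<theta>' t x = \<theta> t x))"
proof -
  note s = assms(1)
  define c0 where "c0 = fourier_coeff \<theta>\<^sub>0"
  obtain A where A: "sob_bound s A c0" and L2: "\<theta>\<^sub>0 \<in> torus_L2"
    using assms(2) by (auto simp: sobolev_iff c0_def)
  have c0: "hermitian c0" "c0 0 = 0"
    using assms(3) by (auto simp: c0_def hermitian_fourier_coeff zero_mean_iff)
  obtain T R L and c :: "real \<Rightarrow> int^2 \<Rightarrow> complex" where T: "0 < T" and init: "c 0 = c0"
    and c: "\<And>t. t \<in> {0..T} \<Longrightarrow> sob_bound s R (c t)"
    and herm: "\<And>t. t \<in> {0..T} \<Longrightarrow> hermitian (c t)"
    and zero: "\<And>t. t \<in> {0..T} \<Longrightarrow> c t 0 = 0"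
    and lip: "\<And>t t' k. t \<in> {0..T} \<Longrightarrow> t' \<in> {0..T} \<Longrightarrow> cmod (c t' k - c t k) \<le> L * \<bar>t' - t\<bar>"
    and ode: "\<And>t k. t \<in> {0..T} \<Longrightarrow> ((\<lambda>\<tau>. c \<tau> k) has_vector_derivative transport (c t) (c t) k) (at t within {0..T})"
    by (rule fourier_transport_local_solution[OF s A c0]) (rule that)
  define \<theta> where "\<theta> t x = Re (synth (c t) x)" for t x
  have l1: "l1 c0" using sob_bound_summable[OF A s] .
  have "AE x in lebesgue. \<theta> 0 x = \<theta>\<^sub>0 x"
    using torus_L2_AE_eq_synth[OF L2] l1 unfolding c0_def[symmetric] by (auto simp: \<theta>_def init elim: eventually_mono)
  moreover have sol: "\<theta> = sol c"
    by (intro ext) (simp only: \<theta>_def sol_def[OF s T c herm ode])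
  ultimately have "ipmb_smooth_solution 0 \<theta>\<^sub>0 T \<theta>"
    unfolding sol by (intro sol_is_solution[OF s T c herm ode zero])
  moreover have "\<theta> \<in> Linf_sobolev T s"
    unfolding \<theta>_def[abs_def] by (rule synth_Linf_sobolev[OF s c herm lip])
  moreover have "\<theta>' t x = \<theta> t x"
    if sol': "ipmb_smooth_solution 0 \<theta>\<^sub>0 T \<theta>'" "\<theta>' \<in> Linf_sobolev T s" and t: "t \<in> {0..T}" for \<theta>' t x
  proof -
    define c' where "c' t = fourier_coeff (\<theta>' t)" for t
    obtain R' where c': "\<And>t. t \<in> {0..T} \<Longrightarrow> sob_bound s R' (c' t)"
      and ode': "\<And>t k. t \<in> {0..T} \<Longrightarrow> ((\<lambda>\<tau>. c' \<tau> k) has_vector_derivative transport (c' t) (c' t) k) (at t within {0..T})"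
      and eq': "\<And>t. t \<in> {0..T} \<Longrightarrow> \<theta>' t = (\<lambda>x. Re (synth (c' t) x))"
      by (rule solution_coefficients[OF s T sol', folded c'_def]) (rule that)
    have init': "c' 0 = c0"
      unfolding c'_def c0_def
    proof (rule fourier_coeff_cong_AE)
      have "\<theta>' 0 \<in> torus_L2" using sol'(1) T by (auto simp: ipmb_smooth_solution_def fourier_multiplier_def)
      then show "set_integrable lebesgue torus_cell (\<theta>' 0)" by (rule torus_L2_integrable)
      show "set_integrable lebesgue torus_cell \<theta>\<^sub>0" by (rule torus_L2_integrable[OF L2])
      show "AE x in lebesgue. \<theta>' 0 x = \<theta>\<^sub>0 x" using sol'(1) by (simp add: ipmb_smooth_solution_def)
    qed
    have "c t = c' t"
    proof (rule fourier_transport_unique[OF s _ herm ode _ ode' _ t])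
      show "sob_bound s (max R R') (c \<tau>)" if "\<tau> \<in> {0..T}" for \<tau>
        by (rule sob_bound_mono[OF c[OF that]]) simp
      show "sob_bound s (max R R') (c' \<tau>)" if "\<tau> \<in> {0..T}" for \<tau>
        by (rule sob_bound_mono[OF c'[OF that]]) simp
      show "c 0 = c' 0" by (simp add: init init')
    qed
    then show ?thesis by (simp add: eq'[OF t] \<theta>_def)
  qed
  ultimately show ?thesis using T by blast
qed

end
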